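(* Let $\mathbf{x}\neq\mathbf{x}_0$ be points of $\mathbb{R}^3$ with parabolic cylinder coordinates $(\xi,\eta,z)$ and $(\xi_0,\eta_0,z_0)$, respectively. Then $$\frac{1}{\|\mathbf{x}-\mathbf{x}_0\|}=\sum_{j=1}^2\int_0^\infty\int_{-\infty}^\infty p_j(\lambda)\,u_j(\lambda,\sqrt{2k}\,\xi)\,u_j(\lambda,i\sqrt{2k}\,\eta)\,u_j(\lambda,\sqrt{2k}\,\xi_0)\,u_j(\lambda,i\sqrt{2k}\,\eta_0)\,e^{-k|z-z_0|}\,d\lambda\,dk,$$ where $$p_1(\lambda)=\frac{1}{4\pi^3}\left|\Gamma\left(\tfrac14+\tfrac{i\lambda}{2}\right)\right|^4,\qquad p_2(\lambda)=-\frac{1}{\pi^3}\left|\Gamma\left(\tfrac34+\tfrac{i\lambda}{2}\right)\right|^4 .$$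
   Context: $\|\cdot\|$ is the Euclidean norm on $\mathbb{R}^3$. Parabolic cylinder coordinates $(\xi,\eta,z)$ with $\xi\in\mathbb{R}$, $\eta\in[0,\infty)$, $z\in\mathbb{R}$ are related to Cartesian coordinates by $x=\frac12(\xi^2-\eta^2)$, $y=\xi\eta$, $z=z$. For $\lambda,x\in\mathbb{C}$, $u_1(\lambda,x)$ and $u_2(\lambda,x)$ are the solutions (entire in $x$) of $-u''-\frac14x^2u=\lambda u$ with $u_1(\lambda,0)=u_2'(\lambda,0)=1$, $u_1'(\lambda,0)=u_2(\lambda,0)=0$. Equivalently, $$u_1(\lambda,x)=e^{-\frac{i}{4}x^2}M\left(\tfrac14+\tfrac{i}{2}\lambda,\tfrac12,\tfrac{i}{2}x^2\right),\qquad u_2(\lambda,x)=e^{-\frac{i}{4}x^2}\,x\,M\left(\tfrac34+\tfrac{i}{2}\lambda,\tfrac32,\tfrac{i}{2}x^2\right),$$ where $M(a,b,z)=\sum_{n=0}^\infty\frac{(a)_nz^n}{(b)_nn!}$ is Kummer's function, with $(a)_n$ the Pochhammer symbol.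
   Formalization: If x_0 is the mirror image of x in the plane y=0 (and x_0≠x), the two k-integrals diverge separately; for such pairs the identity is stated with the sum over j inside the k-integral. The k-integral is improper (conditionally convergent when z=z_0). *)

theory Defs
  imports "HOL-Complex_Analysis.Complex_Analysis" "HOL-Real_Asymp.Real_Asymp"
begin

definition has_parabolic_cylinder_coords :: "real^3 \<Rightarrow> real \<Rightarrow> real \<Rightarrow> real \<Rightarrow> bool" where
  "has_parabolic_cylinder_coords x \<xi> \<eta> z \<longleftrightarrow>
     \<eta> \<ge> 0 \<and> x $ 1 = (\<xi>\<^sup>2 - \<eta>\<^sup>2) / 2 \<and> x $ 2 = \<xi> * \<eta> \<and> x $ 3 = z"

text \<open>Reflection in the plane \<open>y = 0\<close>, i.e. \<open>\<xi> \<mapsto> - \<xi>\<close> in parabolic cylinder coordinates. If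
  \<open>x0 = reflect_y x \<noteq> x\<close> (hence \<open>z = z0\<close>), then the \<open>\<lambda>\<close>-integrals for \<open>j = 1\<close> and \<open>j = 2\<close> equal
  \<open>(J\<^sub>0 (k * norm (x - x0)) \<plusminus> 1) / 2\<close>, so neither can be integrated over \<open>k\<close> on its own;
  only their sum can.\<close>

definition reflect_y :: "real^3 \<Rightarrow> real^3" where
  "reflect_y x = vector [x $ 1, - (x $ 2), x $ 3]"

definition entire_solution :: "complex \<Rightarrow> complex \<Rightarrow> complex \<Rightarrow> (complex \<Rightarrow> complex) \<Rightarrow> bool" where
  "entire_solution lam a b u \<longleftrightarrow>
     u holomorphic_on UNIV \<and>
     (\<forall>x. - deriv (deriv u) x - x\<^sup>2 / 4 * u x = lam * u x) \<and>
     u 0 = a \<and> deriv u 0 = b"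

text \<open>The descriptions below are proper: \<open>u1_eq_formula\<close> and \<open>u2_eq_formula\<close> show that the
  solutions exist, are unique and have the closed form in terms of Kummer's function.\<close>

definition u1 :: "complex \<Rightarrow> complex \<Rightarrow> complex" where
  "u1 lam = (THE u. entire_solution lam 1 0 u)"

definition u2 :: "complex \<Rightarrow> complex \<Rightarrow> complex" where
  "u2 lam = (THE u. entire_solution lam 0 1 u)"

definition kummer_M :: "complex \<Rightarrow> complex \<Rightarrow> complex \<Rightarrow> complex" where
  "kummer_M a b z = (\<Sum>n. pochhammer a n * z ^ n / (pochhammer b n * fact n))"

definition kummer_fps :: "complex \<Rightarrow> complex \<Rightarrow> complex fps" where
  "kummer_fps a b = Abs_fps (\<lambda>n. pochhammer a n / (pochhammer b n * fact n))"

lemma kummer_M_eq_eval_fps: "kummer_M a b = eval_fps (kummer_fps a b)"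
  by (simp add: kummer_M_def kummer_fps_def eval_fps_def fun_eq_iff)

lemma fps_nth_kummer_Suc:
  assumes "b \<notin> \<int>\<^sub>\<le>\<^sub>0"
  shows "(of_nat n + 1) * (b + of_nat n) * fps_nth (kummer_fps a b) (Suc n) =
         (a + of_nat n) * fps_nth (kummer_fps a b) n"
    and "b + of_nat n \<noteq> 0"
proof -
  have nz: "b + of_nat n \<noteq> 0" for n
  proof
    assume "b + of_nat n = 0"
    hence "b = - of_nat n" by (simp add: eq_neg_iff_add_eq_0)
    with assms show False by auto
  qed
  have pnz: "pochhammer b n \<noteq> 0" for n
    using nz by (auto simp: pochhammer_eq_0_iff eq_neg_iff_add_eq_0)
  have nz': "of_nat n + (1::complex) \<noteq> 0"
    by (metis of_nat_Suc of_nat_neq_0 add.commute)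
  show "b + of_nat n \<noteq> 0" by (rule nz)
  show "(of_nat n + 1) * (b + of_nat n) * fps_nth (kummer_fps a b) (Suc n) =
         (a + of_nat n) * fps_nth (kummer_fps a b) n"
    using nz[of n] pnz[of n] nz'
    by (simp add: kummer_fps_def pochhammer_Suc add.commute[of 1])
qed

lemma fps_conv_radius_kummer:
  assumes b: "b \<notin> \<int>\<^sub>\<le>\<^sub>0"
  shows "fps_conv_radius (kummer_fps a b) = \<infinity>"
  unfolding fps_conv_radius_def
proof (rule conv_radius_inftyI'')
  fix z :: complex
  let ?c = "fps_nth (kummer_fps a b)"
  have "eventually (\<lambda>n::nat. 2 * (norm a + real n) * norm z \<le> (real n - norm b) * (real n + 1)) sequentially"
    by real_asymp
  moreover have "eventually (\<lambda>n::nat. real n > norm b) sequentially"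
    by real_asymp
  ultimately have "eventually (\<lambda>n. norm (?c (Suc n) * z ^ Suc n) \<le> 1/2 * norm (?c n * z ^ n)) sequentially"
  proof eventually_elim
    case (elim n)
    have n1: "norm (of_nat n + 1 :: complex) = real n + 1"
      by (metis norm_of_nat of_nat_Suc add.commute)
    have bn: "norm (b + of_nat n) \<ge> real n - norm b"
      by (metis norm_diff_ineq norm_of_nat add.commute)
    hence bp: "norm (b + of_nat n) > 0" using elim by linarith
    have "2 * norm (a + of_nat n) * norm z \<le> 2 * (norm a + real n) * norm z"
      using norm_triangle_ineq[of a "of_nat n"] by (intro mult_right_mono) auto
    also have "\<dots> \<le> (real n - norm b) * (real n + 1)" by (rule elim)
    also have "\<dots> \<le> norm (b + of_nat n) * (real n + 1)"
      using bn by (intro mult_right_mono) auto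
    finally have le: "2 * norm (a + of_nat n) * norm z \<le> norm (b + of_nat n) * (real n + 1)" .
    have eq: "(real n + 1) * norm (b + of_nat n) * norm (?c (Suc n)) = norm (a + of_nat n) * norm (?c n)"
      using arg_cong[OF fps_nth_kummer_Suc(1)[OF b, of n a], of norm] by (simp add: norm_mult n1)
    have "((real n + 1) * norm (b + of_nat n)) * (2 * norm (?c (Suc n) * z ^ Suc n)) =
          (2 * norm (a + of_nat n) * norm z) * norm (?c n * z ^ n)"
      unfolding norm_mult power_Suc using arg_cong[OF eq, of "\<lambda>y. 2 * norm z * norm (z ^ n) * y"]
      by (simp only: mult_ac)
    also have "\<dots> \<le> (norm (b + of_nat n) * (real n + 1)) * norm (?c n * z ^ n)"
      by (rule mult_right_mono[OF le]) auto
    finally have "((real n + 1) * norm (b + of_nat n)) * (2 * norm (?c (Suc n) * z ^ Suc n)) \<le>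
                  ((real n + 1) * norm (b + of_nat n)) * norm (?c n * z ^ n)"
      by (simp add: mult_ac)
    moreover have "(real n + 1) * norm (b + of_nat n) > 0" using bp by simp
    ultimately show ?case by (auto simp only: mult_le_cancel_left_pos)
  qed
  then obtain N where "\<forall>n\<ge>N. norm (?c (Suc n) * z ^ Suc n) \<le> 1/2 * norm (?c n * z ^ n)"
    by (auto simp: eventually_sequentially)
  thus "summable (\<lambda>n. ?c n * z ^ n)"
    by (intro summable_ratio_test[of "1/2" N]) auto
qed

lemma kummer_ode:
  assumes b: "b \<notin> \<int>\<^sub>\<le>\<^sub>0"
  obtains M' M'' where
    "\<And>z. (kummer_M a b has_field_derivative M' z) (at z)"
    "\<And>z. (M' has_field_derivative M'' z) (at z)"
    "\<And>z. z * M'' z + (b - z) * M' z = a * kummer_M a b z"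
proof -
  define F where "F = kummer_fps a b"
  have r0: "fps_conv_radius F = \<infinity>" unfolding F_def by (rule fps_conv_radius_kummer[OF b])
  have r1: "fps_conv_radius (fps_deriv F) = \<infinity>"
    using fps_conv_radius_deriv[of F] r0 by simp
  have r2: "fps_conv_radius (fps_deriv (fps_deriv F)) = \<infinity>"
    using fps_conv_radius_deriv[of "fps_deriv F"] r1 by simp
  have "fps_X * fps_deriv (fps_deriv F) + fps_const b * fps_deriv F =
        fps_X * fps_deriv F + fps_const a * F"
  proof (rule fps_ext)
    fix n
    have rec: "(of_nat n + 1) * (b + of_nat n) * fps_nth F (Suc n) = (a + of_nat n) * fps_nth F n"
      unfolding F_def by (rule fps_nth_kummer_Suc(1)[OF b])
    show "fps_nth (fps_X * fps_deriv (fps_deriv F) + fps_const b * fps_deriv F) n =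
          fps_nth (fps_X * fps_deriv F + fps_const a * F) n"
      using rec by (cases n) (simp_all add: algebra_simps)
  qed
  hence eq: "eval_fps (fps_X * fps_deriv (fps_deriv F) + fps_const b * fps_deriv F) z =
        eval_fps (fps_X * fps_deriv F + fps_const a * F) z" for z by simp
  have rm: "fps_conv_radius (f * g) = \<infinity>"
    if "fps_conv_radius f = \<infinity>" "fps_conv_radius g = \<infinity>" for f g :: "complex fps"
    using fps_conv_radius_mult[of f g] that by simp
  show ?thesis
  proof (rule that[of "eval_fps (fps_deriv F)" "eval_fps (fps_deriv (fps_deriv F))"])
    show "(kummer_M a b has_field_derivative eval_fps (fps_deriv F) z) (at z)" for z
      unfolding kummer_M_eq_eval_fps F_def[symmetric]
      by (rule has_field_derivative_eval_fps) (simp add: r0)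
    show "(eval_fps (fps_deriv F) has_field_derivative eval_fps (fps_deriv (fps_deriv F)) z) (at z)" for z
      by (rule has_field_derivative_eval_fps) (simp add: r1)
    show "z * eval_fps (fps_deriv (fps_deriv F)) z + (b - z) * eval_fps (fps_deriv F) z =
          a * kummer_M a b z" for z
      using eq[of z]
      unfolding kummer_M_eq_eval_fps F_def[symmetric]
      by (simp add: eval_fps_add eval_fps_mult rm r0 r1 r2 algebra_simps)
  qed
qed

lemma kummer_M_0 [simp]: "kummer_M a b 0 = 1"
  by (simp add: kummer_M_eq_eval_fps eval_fps_at_0 kummer_fps_def)

lemma entire_solutionI:
  assumes "\<And>x. (u has_field_derivative u' x) (at x)"
    and "\<And>x. (u' has_field_derivative u'' x) (at x)"
    and "\<And>x. - u'' x - x\<^sup>2 / 4 * u x = lam * u x"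
    and "u 0 = a" "u' 0 = b"
  shows "entire_solution lam a b u"
proof -
  have d: "deriv u = u'" using assms(1) by (auto intro!: DERIV_imp_deriv)
  have dd: "deriv u' = u''" using assms(2) by (auto intro!: DERIV_imp_deriv)
  have "u holomorphic_on UNIV"
    using assms(1) by (auto simp: holomorphic_on_open)
  thus ?thesis unfolding entire_solution_def d dd using assms(3-5) by simp
qed

definition u1_formula :: "complex \<Rightarrow> complex \<Rightarrow> complex" where
  "u1_formula lam x =
     exp (- (\<i> / 4 * x\<^sup>2)) * kummer_M (1/4 + \<i> / 2 * lam) (1/2) (\<i> / 2 * x\<^sup>2)"

definition u2_formula :: "complex \<Rightarrow> complex \<Rightarrow> complex" where
  "u2_formula lam x =
     exp (- (\<i> / 4 * x\<^sup>2)) * x * kummer_M (3/4 + \<i> / 2 * lam) (3/2) (\<i> / 2 * x\<^sup>2)"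

lemma entire_solution_u1_formula: "entire_solution lam 1 0 (u1_formula lam)"
proof -
  define a where "a = 1/4 + \<i> / 2 * lam"
  have lam: "lam = \<i> / 2 - 2 * \<i> * a"
    by (simp add: a_def algebra_simps)
  have "(1/2 :: complex) \<notin> \<int>\<^sub>\<le>\<^sub>0"
    by (auto elim!: nonpos_Ints_cases simp: complex_eq_iff)
  from kummer_ode[OF this, of a] obtain M' M'' where
    M: "\<And>z. (kummer_M a (1/2) has_field_derivative M' z) (at z)"
       "\<And>z. (M' has_field_derivative M'' z) (at z)"
    and ode: "\<And>z. z * M'' z + (1/2 - z) * M' z = a * kummer_M a (1/2) z" by metis
  note [derivative_intros] = DERIV_chain2[OF M(1)] DERIV_chain2[OF M(2)]
  define E where "E = (\<lambda>x::complex. exp (- (\<i> / 4 * x\<^sup>2)))"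
  define t where "t = (\<lambda>x::complex. \<i> / 2 * x\<^sup>2)"
  have E: "(E has_field_derivative - (\<i> / 2 * x * E x)) (at x)" for x
    unfolding E_def by (auto intro!: derivative_eq_intros)
  note [derivative_intros] = DERIV_chain2[OF E]
  have t: "(t has_field_derivative \<i> * x) (at x)" for x
    unfolding t_def by (auto intro!: derivative_eq_intros)
  note [derivative_intros] = DERIV_chain2[OF t]
  let ?M = "kummer_M a (1/2)"
  have u: "u1_formula lam = (\<lambda>x. E x * ?M (t x))"
    by (simp add: u1_formula_def a_def E_def t_def fun_eq_iff)
  show ?thesis unfolding u
  proof (rule entire_solutionI)
    show "((\<lambda>x. E x * ?M (t x)) has_field_derivative
            (E x * (\<i> * x * M' (t x) - \<i> / 2 * x * ?M (t x)))) (at x)" for x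
      by (rule derivative_eq_intros refl)+ (simp add: algebra_simps)
    show "((\<lambda>x. E x * (\<i> * x * M' (t x) - \<i> / 2 * x * ?M (t x))) has_field_derivative
            (E x * (\<i> * M' (t x) - x\<^sup>2 * M'' (t x) + x\<^sup>2 / 2 * M' (t x) - \<i> / 2 * ?M (t x)
               - \<i> / 2 * x * (\<i> * x * M' (t x) - \<i> / 2 * x * ?M (t x))))) (at x)" for x
      by (rule derivative_eq_intros refl)+ (simp add: algebra_simps power2_eq_square)
    fix x
    have 1: "x\<^sup>2 = - 2 * \<i> * t x" by (simp add: t_def)
    have "x\<^sup>2 * M'' (t x) = - 2 * \<i> * (t x * M'' (t x))" by (simp add: 1)
    also have "t x * M'' (t x) = a * ?M (t x) - (1/2 - t x) * M' (t x)"
      using ode[of "t x"] by (simp add: algebra_simps)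
    finally have 2: "x\<^sup>2 * M'' (t x) = - 2 * \<i> * (a * ?M (t x) - (1/2 - t x) * M' (t x))" .
    have "- (\<i> * M' (t x) - x\<^sup>2 * M'' (t x) + x\<^sup>2 / 2 * M' (t x) - \<i> / 2 * ?M (t x)
               - \<i> / 2 * x * (\<i> * x * M' (t x) - \<i> / 2 * x * ?M (t x)))
          - x\<^sup>2 / 4 * ?M (t x) = lam * ?M (t x)"
      unfolding 2 lam
      by (simp add: t_def algebra_simps power2_eq_square)
    from arg_cong[OF this, of "\<lambda>y. E x * y"]
    show "- (E x * (\<i> * M' (t x) - x\<^sup>2 * M'' (t x) + x\<^sup>2 / 2 * M' (t x) - \<i> / 2 * ?M (t x)
               - \<i> / 2 * x * (\<i> * x * M' (t x) - \<i> / 2 * x * ?M (t x))))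
          - x\<^sup>2 / 4 * (E x * ?M (t x)) = lam * (E x * ?M (t x))"
      by (simp add: algebra_simps)
  qed (simp_all add: E_def t_def)
qed

lemma entire_solution_u2_formula: "entire_solution lam 0 1 (u2_formula lam)"
proof -
  define a where "a = 3/4 + \<i> / 2 * lam"
  have lam: "lam = 3 * \<i> / 2 - 2 * \<i> * a"
    by (simp add: a_def algebra_simps)
  have "(3/2 :: complex) \<notin> \<int>\<^sub>\<le>\<^sub>0"
    by (auto elim!: nonpos_Ints_cases simp: complex_eq_iff)
  from kummer_ode[OF this, of a] obtain M' M'' where
    M: "\<And>z. (kummer_M a (3/2) has_field_derivative M' z) (at z)"
       "\<And>z. (M' has_field_derivative M'' z) (at z)"
    and ode: "\<And>z. z * M'' z + (3/2 - z) * M' z = a * kummer_M a (3/2) z" by metis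
  note [derivative_intros] = DERIV_chain2[OF M(1)] DERIV_chain2[OF M(2)]
  define E where "E = (\<lambda>x::complex. exp (- (\<i> / 4 * x\<^sup>2)))"
  define t where "t = (\<lambda>x::complex. \<i> / 2 * x\<^sup>2)"
  have E: "(E has_field_derivative - (\<i> / 2 * x * E x)) (at x)" for x
    unfolding E_def by (auto intro!: derivative_eq_intros)
  note [derivative_intros] = DERIV_chain2[OF E]
  have t: "(t has_field_derivative \<i> * x) (at x)" for x
    unfolding t_def by (auto intro!: derivative_eq_intros)
  note [derivative_intros] = DERIV_chain2[OF t]
  let ?M = "kummer_M a (3/2)"
  have u: "u2_formula lam = (\<lambda>x. E x * x * ?M (t x))"
    by (simp add: u2_formula_def a_def E_def t_def fun_eq_iff)
  let ?u' = "\<lambda>x. E x * (\<i> * x\<^sup>2 * M' (t x) + (1 - \<i> / 2 * x\<^sup>2) * ?M (t x))"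
  let ?d = "\<lambda>x. \<i> * x * (3 * M' (t x)) - x * (x\<^sup>2 * M'' (t x)) + x ^ 3 / 2 * M' (t x)
               - \<i> * x * ?M (t x)
               - \<i> / 2 * x * (\<i> * x\<^sup>2 * M' (t x) + (1 - \<i> / 2 * x\<^sup>2) * ?M (t x))"
  show ?thesis unfolding u
  proof (rule entire_solutionI)
    show "((\<lambda>x. E x * x * ?M (t x)) has_field_derivative ?u' x) (at x)" for x
      by (rule derivative_eq_intros refl)+ (simp add: algebra_simps power2_eq_square)
    show "(?u' has_field_derivative E x * ?d x) (at x)" for x
      by (rule derivative_eq_intros refl)+ (simp add: algebra_simps power2_eq_square power3_eq_cube)
    fix x
    have 1: "x\<^sup>2 = - 2 * \<i> * t x" by (simp add: t_def)
    have "x\<^sup>2 * M'' (t x) = - 2 * \<i> * (t x * M'' (t x))" by (simp add: 1)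
    also have "t x * M'' (t x) = a * ?M (t x) - (3/2 - t x) * M' (t x)"
      using ode[of "t x"] by (simp add: algebra_simps)
    finally have 2: "x\<^sup>2 * M'' (t x) = - 2 * \<i> * (a * ?M (t x) - (3/2 - t x) * M' (t x))" .
    have "- ?d x - x\<^sup>2 / 4 * (x * ?M (t x)) = lam * (x * ?M (t x))"
      unfolding 2 lam
      by (simp add: t_def algebra_simps power2_eq_square power3_eq_cube)
    from arg_cong[OF this, of "\<lambda>y. E x * y"]
    show "- (E x * ?d x) - x\<^sup>2 / 4 * (E x * x * ?M (t x)) = lam * (E x * x * ?M (t x))"
      by (simp add: algebra_simps)
  qed (simp_all add: E_def t_def)
qed

lemma entire_solution_wronskian:
  assumes u: "entire_solution lam a b u" and v: "entire_solution lam c d v"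
  shows "u x * deriv v x - deriv u x * v x = a * d - b * c"
proof -
  define w where "w = (\<lambda>x. u x * deriv v x - deriv u x * v x)"
  have D: "(f has_field_derivative deriv f x) (at x)"
          "(deriv f has_field_derivative deriv (deriv f) x) (at x)"
    if "entire_solution lam a b f" for a b f x
    using that holomorphic_derivI[of f UNIV x] holomorphic_derivI[of "deriv f" UNIV x]
      holomorphic_deriv[of f UNIV]
    by (auto simp: entire_solution_def)
  have "(w has_field_derivative u x * deriv (deriv v) x - deriv (deriv u) x * v x) (at x)" for x
    unfolding w_def by (rule derivative_eq_intros D[OF u] D[OF v] refl)+ (simp add: algebra_simps)
  moreover have dd: "deriv (deriv f) x = - (x\<^sup>2 / 4 + lam) * f x"
    if "entire_solution lam a b f" for a b f x
    using that unfolding entire_solution_def by (simp add: algebra_simps) (metis add.commute add_diff_cancel_left' minus_diff_eq minus_equation_iff diff_minus_eq_add)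
  ultimately have "(w has_field_derivative 0) (at x)" for x
    by (simp add: dd[OF u] dd[OF v])
  hence "w x = w 0" 
    using has_field_derivative_zero_constant[of UNIV w] by auto
  thus ?thesis using u v by (simp add: w_def entire_solution_def)
qed

lemma entire_solution_unique:
  assumes u: "entire_solution lam a b u" and v: "entire_solution lam a b v"
  shows "u = v"
proof
  fix x
  define p where "p = u1_formula lam"
  define q where "q = u2_formula lam"
  have p: "entire_solution lam 1 0 p" unfolding p_def by (rule entire_solution_u1_formula)
  have q: "entire_solution lam 0 1 q" unfolding q_def by (rule entire_solution_u2_formula)
  have eq: "f x = b * q x + a * p x" if f: "entire_solution lam a b f" for f
  proof -
    have 0: "p x * deriv q x - deriv p x * q x = 1"
      using entire_solution_wronskian[OF p q] by simp
    have 1: "f x * deriv q x - deriv f x * q x = a"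
      using entire_solution_wronskian[OF f q] by simp
    have 2: "f x * deriv p x - deriv f x * p x = - b"
      using entire_solution_wronskian[OF f p] by simp
    have "f x = f x * (p x * deriv q x - deriv p x * q x)" by (simp add: 0)
    also have "\<dots> = p x * (f x * deriv q x - deriv f x * q x) - q x * (f x * deriv p x - deriv f x * p x)"
      by (simp add: algebra_simps)
    finally show ?thesis by (simp add: 1 2)
  qed
  show "u x = v x" using eq[OF u] eq[OF v] by simp
qed

theorem u1_eq_formula: "u1 lam = u1_formula lam"
  unfolding u1_def
  by (rule the_equality) (blast intro: entire_solution_u1_formula entire_solution_unique)+

theorem u2_eq_formula: "u2 lam = u2_formula lam"
  unfolding u2_def
  by (rule the_equality) (blast intro: entire_solution_u2_formula entire_solution_unique)+

definition u_sol :: "nat \<Rightarrow> complex \<Rightarrow> complex \<Rightarrow> complex" where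
  "u_sol j = (if j = 1 then u1 else u2)"

definition p_weight :: "nat \<Rightarrow> real \<Rightarrow> real" where
  "p_weight j lam =
     (if j = 1 then 1 / (4 * pi ^ 3) * norm (Gamma (1/4 + \<i> * of_real lam / 2)) ^ 4
      else - 1 / pi ^ 3 * norm (Gamma (3/4 + \<i> * of_real lam / 2)) ^ 4)"

text \<open>The \<open>\<lambda>\<close>-integral is a Lebesgue integral. The \<open>k\<close>-integral has to be understood as an
  improper one, since it converges only conditionally if \<open>z = z0\<close>; by Hake's theorem this is
  what \<open>has_integral\<close> (Henstock-Kurzweil) on \<open>{0..}\<close> means. Arguments may be complex, so the
  integrand has type \<^typ>\<open>complex\<close>.\<close>

definition integrand ::
    "nat \<Rightarrow> real \<Rightarrow> real \<Rightarrow> real \<Rightarrow> real \<Rightarrow> real \<Rightarrow> real \<Rightarrow> real \<Rightarrow> real \<Rightarrow> complex" where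
  "integrand j \<xi> \<eta> z \<xi>0 \<eta>0 z0 k lam =
     of_real (p_weight j lam) *
     u_sol j (of_real lam) (of_real (sqrt (2 * k) * \<xi>)) *
     u_sol j (of_real lam) (\<i> * of_real (sqrt (2 * k) * \<eta>)) *
     u_sol j (of_real lam) (of_real (sqrt (2 * k) * \<xi>0)) *
     u_sol j (of_real lam) (\<i> * of_real (sqrt (2 * k) * \<eta>0)) *
     of_real (exp (- k * \<bar>z - z0\<bar>))"

end

theory Submission
  imports "HOL-Probability.Probability" Defs
begin

text \<open>
  Write \<open>T = tanh s\<close> and \<open>S = 1 / cosh s\<close>. The kernel
  \<open>cosh(s)\<^sup>-\<^sup>1\<^sup>/\<^sup>2 exp (i (a\<^sup>2 + b\<^sup>2) T / 4 + a b S / 2)\<close> is the Mehler kernel of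
  \<open>H = - d\<^sup>2/da\<^sup>2 - a\<^sup>2/4\<close> at the complex time \<open>s + i \<pi> / 2\<close>, hence solves \<open>i \<partial>\<^sub>s F = H F\<close>. Its Fourier
  transform in \<open>s\<close> therefore solves the eigenvalue equation in \<open>a\<close> and, by symmetry, in \<open>b\<close>; its even and
  odd parts are multiples of \<open>u\<^sub>1(\<lambda>, a) u\<^sub>1(\<lambda>, b)\<close> and \<open>u\<^sub>2(\<lambda>, a) u\<^sub>2(\<lambda>, b)\<close>, where the factors are Beta
  integrals and give the Gamma functions in the weights. Since \<open>u\<^sub>j(\<lambda>, i y)\<close> is a multiple of
  \<open>u\<^sub>j(- \<lambda>, y)\<close>, Parseval's identity turns the \<open>\<lambda>\<close>-integral into an integral over \<open>s\<close>, namely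
  \<open>(\<Psi>(A, B\<^sub>+) \<plusminus> \<Psi>(A, B\<^sub>-)) / 2\<close> with \<open>\<Psi>(A, B) = 1/\<pi> \<integral> S e\<^sup>i\<^sup>A\<^sup>T cosh (B S) ds\<close>. The function \<open>\<Psi>\<close> is invariant
  under hyperbolic rotations of \<open>(A, B)\<close>, so that \<open>\<Psi>(A, B) = J\<^sub>0(\<surd>(A\<^sup>2 - B\<^sup>2))\<close>, and the arguments are
  \<open>k\<close> times the distances in the \<open>(x, y)\<close>-plane of the first point from the second one and from its mirror
  image. What remains is the Laplace transform \<open>\<integral> J\<^sub>0(k \<rho>) e\<^sup>-\<^sup>k\<^sup>\<zeta> dk = 1 / \<surd>(\<rho>\<^sup>2 + \<zeta>\<^sup>2)\<close>, which for
  \<open>\<zeta> = 0\<close> is a Dirichlet integral.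
\<close>

section \<open>Integrals over the real line\<close>

text \<open>At real time s the kernel of exp (- i s H) contains \<open>sinh(s)^(-1/2)\<close>, coth
  s and 1 / sinh s and is singular at s = 0. The shift by i \<pi> / 2 turns sinh into a multiple of
  cosh, so the kernel is smooth on the whole line and decays like exp (- |s| / 2) for all complex a
  and b. Hence its transform converges absolutely and is entire in a, and one integration by parts
  gives decay in \<lambda> like 1 / |\<lambda>|, enough to integrate a product of two transforms.

  The four factors are grouped as (\<xi>, \<xi>0) and (\<eta>, \<eta>0), because the rotation to
  imaginary arguments reverses the sign of \<lambda>, which is what Parseval's identity without
  conjugation asks for. It multiplies two kernels at the same s, so their exponents add.

  The obstacle at the end is that the parts for j = 1 and j = 2 need not be integrable over k
  separately. They are therefore written as (P + Q) / 2 and (P - Q) / 2, with P from the pair of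
  points and Q from the pair with one point reflected, and Q cancels for each k before the
  integration over k.\<close>

lemma integrable_exp_neg_abs:
  fixes c :: real
  assumes "c > 0"
  shows "integrable lborel (\<lambda>s. exp (- (c * \<bar>s\<bar>)))"
proof -
  define h where "h = (\<lambda>s::real. exp (- s) * indicator {0<..} s :: real)"
  have "integrable lborel h"
    using has_bochner_integral_I0i_power_exp_m[of 0] unfolding h_def
    by (simp only: power_0 mult_1 has_bochner_integral_iff)
  from lborel_integrable_real_affine[OF this, of c 0] lborel_integrable_real_affine[OF this, of "-c" 0] assms
  have "integrable lborel (\<lambda>s. h (c * s) + h (- c * s))" by auto
  thus ?thesis
  proof (rule Bochner_Integration.integrable_bound)
    \<comment> \<open>Both summands vanish at s = 0, so the domination holds only almost
      everywhere.\<close>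
    have "norm (exp (- (c * \<bar>s\<bar>))) \<le> norm (h (c * s) + h (- c * s))" if "s \<noteq> 0" for s
      using that assms
      by (cases "s > 0") (auto simp: h_def indicator_def zero_less_mult_iff mult_less_0_iff)
    thus "AE s in lborel. norm (exp (- (c * \<bar>s\<bar>))) \<le> norm (h (c * s) + h (- c * s))"
      using AE_lborel_singleton[of 0] by (auto elim!: eventually_mono)
  qed auto
qed

lemma inverse_cosh_le: "inverse (cosh s) \<le> 2 * exp (- \<bar>s\<bar>)" for s :: real
proof -
  have "exp \<bar>s\<bar> \<le> 2 * cosh s" by (auto simp: cosh_field_def abs_real_def)
  thus ?thesis by (simp add: exp_minus field_simps)
qed

lemma cosh_powr_le:
  fixes s p :: real
  assumes "p > 0"
  shows "cosh s powr - p \<le> 2 powr p * exp (- (p * \<bar>s\<bar>))"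
proof -
  have "cosh s powr - p = inverse (cosh s) powr p"
    using cosh_real_pos[of s] by (simp add: powr_minus powr_divide inverse_eq_divide)
  also have "\<dots> \<le> (2 * exp (- \<bar>s\<bar>)) powr p"
    using inverse_cosh_le[of s] assms by (intro powr_mono2) auto
  also have "\<dots> = 2 powr p * exp (- (p * \<bar>s\<bar>))"
    by (simp add: powr_mult exp_powr_real mult.commute)
  finally show ?thesis .
qed

lemma integrable_cosh_powr:
  fixes p :: real
  assumes "p > 0"
  shows "integrable lborel (\<lambda>s. cosh s powr - p)"
proof (rule Bochner_Integration.integrable_bound)
  show "integrable lborel (\<lambda>s. 2 powr p * exp (- (p * \<bar>s\<bar>)))"
    using integrable_exp_neg_abs[OF assms] by simp
  show "(\<lambda>s::real. cosh s powr - p) \<in> borel_measurable lborel" 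
    unfolding cosh_field_def by measurable
qed (use cosh_powr_le[OF assms] in auto)

lemma tendsto_cosh_powr:
  fixes p :: real
  assumes "p > 0"
  shows "((\<lambda>s. cosh s powr - p) \<longlongrightarrow> 0) at_top" "((\<lambda>s. cosh s powr - p) \<longlongrightarrow> 0) at_bot"
proof -
  have *: "((\<lambda>s. 2 powr p * exp (- (p * \<bar>s\<bar>))) \<longlongrightarrow> 2 powr p * 0) F"
    if "filterlim (\<lambda>s. \<bar>s\<bar>) at_top F" for F
    using that assms
    by (intro tendsto_mult tendsto_const filterlim_compose[OF exp_at_bot]
        filterlim_uminus_at_bot[THEN iffD1]) 
       (auto simp: filterlim_uminus_at_bot intro!: filterlim_tendsto_pos_mult_at_top[OF tendsto_const])
  have **: "((\<lambda>s. cosh s powr - p) \<longlongrightarrow> 0) F" if "filterlim (\<lambda>s. \<bar>s\<bar>) at_top F" for F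
  proof (rule tendsto_sandwich[where f = "\<lambda>_. 0"])
    show "((\<lambda>s. 2 powr p * exp (- (p * \<bar>s\<bar>))) \<longlongrightarrow> 0) F" using *[OF that] by simp
    show "\<forall>\<^sub>F s in F. cosh s powr - p \<le> 2 powr p * exp (- (p * \<bar>s\<bar>))"
      using cosh_powr_le[OF assms] by simp
  qed auto
  show "((\<lambda>s. cosh s powr - p) \<longlongrightarrow> 0) at_top"
    by (rule **) real_asymp
  show "((\<lambda>s. cosh s powr - p) \<longlongrightarrow> 0) at_bot"
    by (rule **) real_asymp
qed

text \<open>Serves both for integration by parts and total derivatives along s, and for the explicit
  primitives with arctan and \<open>Si\<close>.\<close>

lemma integral_derivative_real_line:
  fixes F f :: "real \<Rightarrow> 'a::euclidean_space"
  assumes F: "\<And>s. (F has_vector_derivative f s) (at s)"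
    and f: "continuous_on UNIV f" "integrable lborel f"
    and "(F \<longlongrightarrow> A) at_bot" "(F \<longlongrightarrow> B) at_top"
  shows "(LINT s|lborel. f s) = B - A"
proof -
  have "(LBINT s=-\<infinity>..\<infinity>. f s) = B - A"
  proof (rule interval_integral_FTC_integrable)
    show "isCont f s" for s using f(1) by (simp add: continuous_on_eq_continuous_at)
    show "set_integrable lborel (einterval (- \<infinity>) \<infinity>) f"
      using f(2) by (simp add: set_integrable_def)
    show "((F \<circ> real_of_ereal) \<longlongrightarrow> A) (at_right (-\<infinity>))"
      using assms(4) by (simp add: ereal_tendsto_simps)
    show "((F \<circ> real_of_ereal) \<longlongrightarrow> B) (at_left \<infinity>)"
      using assms(5) by (simp add: ereal_tendsto_simps)
  qed (use F in auto)
  thus ?thesis by (simp add: interval_lebesgue_integral_def set_lebesgue_integral_def)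
qed

text \<open>The ball is convex, so the mean value inequality bounds the difference quotients by the
  bound \<open>g\<close> for the derivative, and dominated convergence applies.\<close>

lemma has_field_derivative_integral:
  fixes f f' :: "complex \<Rightarrow> real \<Rightarrow> complex"
  assumes der: "\<And>x s. x \<in> ball z r \<Longrightarrow> ((\<lambda>x. f x s) has_field_derivative f' x s) (at x)"
    and int: "\<And>x. x \<in> ball z r \<Longrightarrow> integrable lborel (f x)"
    and meas: "f' z \<in> borel_measurable borel"
    and bound: "\<And>x s. x \<in> ball z r \<Longrightarrow> norm (f' x s) \<le> g s"
    and g: "integrable lborel g" and r: "r > 0"
  shows "integrable lborel (f' z)"
        "((\<lambda>x. LINT s|lborel. f x s) has_field_derivative (LINT s|lborel. f' z s)) (at z)"
proof -
  have zb: "z \<in> ball z r" using r by simp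
  show "integrable lborel (f' z)"
    by (rule Bochner_Integration.integrable_bound[OF g])
       (use meas bound[OF zb] in \<open>auto intro!: AE_I2 intro: order.trans[OF _ abs_ge_self]\<close>)
  show "((\<lambda>x. LINT s|lborel. f x s) has_field_derivative (LINT s|lborel. f' z s)) (at z)"
    unfolding has_field_derivative_iff
  proof (rule tendsto_at_iff_sequentially[THEN iffD2], intro allI impI)
    fix X :: "nat \<Rightarrow> complex"
    assume X: "\<forall>i. X i \<in> UNIV - {z}" "X \<longlonglongrightarrow> z"
    have "eventually (\<lambda>n. X n \<in> ball z r) sequentially"
      using X(2) r by (simp add: tendsto_iff dist_commute)
    then obtain N where N: "\<And>n. n \<ge> N \<Longrightarrow> X n \<in> ball z r"
      by (auto simp: eventually_sequentially)
    \<comment> \<open>Dropping the first N terms puts the whole sequence into the ball, where the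
      bounds hold.\<close>
    define Y where "Y = (\<lambda>n. X (n + N))"
    have Y: "Y \<longlonglongrightarrow> z" "\<And>n. Y n \<noteq> z" "\<And>n. Y n \<in> ball z r"
      using X N LIMSEQ_ignore_initial_segment[OF X(2), of N] by (auto simp: Y_def)
    have "(\<lambda>n. LINT s|lborel. (f (Y n) s - f z s) / (Y n - z)) \<longlonglongrightarrow> (LINT s|lborel. f' z s)"
    proof (rule integral_dominated_convergence[where w = g])
      show "f' z \<in> borel_measurable lborel" using meas by simp
      show "(\<lambda>s. (f (Y n) s - f z s) / (Y n - z)) \<in> borel_measurable lborel" for n
        using int[OF Y(3)] int[OF zb] by (intro borel_measurable_divide borel_measurable_diff) auto
      show "AE s in lborel. (\<lambda>n. (f (Y n) s - f z s) / (Y n - z)) \<longlonglongrightarrow> f' z s"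
      proof (rule AE_I2)
        fix s
        have "((\<lambda>y. (f y s - f z s) / (y - z)) \<longlongrightarrow> f' z s) (at z)"
          using der[OF zb, of s] by (simp add: has_field_derivative_iff)
        thus "(\<lambda>n. (f (Y n) s - f z s) / (Y n - z)) \<longlonglongrightarrow> f' z s"
          using Y unfolding tendsto_at_iff_sequentially by (auto simp: o_def)
      qed
      show "AE s in lborel. norm ((f (Y n) s - f z s) / (Y n - z)) \<le> g s" for n
      proof (rule AE_I2)
        fix s
        have "norm (f (Y n) s - f z s) \<le> g s * norm (Y n - z)"
        proof (rule field_differentiable_bound[of "ball z r" _ "\<lambda>x. f' x s"])
          show "((\<lambda>x. f x s) has_field_derivative f' x s) (at x within ball z r)" if "x \<in> ball z r" for x
            using der[OF that] by (rule has_field_derivative_at_within)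
        qed (use bound Y(3) zb in auto)
        thus "norm ((f (Y n) s - f z s) / (Y n - z)) \<le> g s"
          using Y(2)[of n] by (simp add: norm_divide pos_divide_le_eq)
      qed
    qed (use g in auto)
    also have "(\<lambda>n. LINT s|lborel. (f (Y n) s - f z s) / (Y n - z)) =
               (\<lambda>n. ((LINT s|lborel. f (Y n) s) - (LINT s|lborel. f z s)) / (Y n - z))"
      using int[OF Y(3)] int[OF zb] by simp
    finally show "((\<lambda>y. ((LINT s|lborel. f y s) - (LINT s|lborel. f z s)) / (y - z)) \<circ> X) \<longlonglongrightarrow> (LINT s|lborel. f' z s)"
      using LIMSEQ_offset[of "(\<lambda>y. ((LINT s|lborel. f y s) - (LINT s|lborel. f z s)) / (y - z)) \<circ> X" N]
      by (simp add: Y_def o_def)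
  qed
qed

section \<open>Gamma functions, Gaussians and Parseval's identity\<close>

text \<open>Euler's integral after the substitution t = exp p: the domain becomes the whole line,
  where shifts of p are available.\<close>

lemma Gamma_integral_exp:
  fixes z :: complex
  assumes "Re z > 0"
  shows "integrable lborel (\<lambda>p. exp (z * of_real p) * of_real (exp (- exp p)))"
    and "(LINT p|lborel. exp (z * of_real p) * of_real (exp (- exp p))) = Gamma z"
proof -
  define h where "h = (\<lambda>p. exp (z * of_real p) * of_real (exp (- exp p)) :: complex)"
  define f where "f = (\<lambda>t. of_real t powr (z - 1) / of_real (exp t) :: complex)"
  have img: "range exp = {0::real<..}"
    by (auto simp: image_iff intro: exp_ln[symmetric])
  have "f absolutely_integrable_on {0<..} \<and> integral {0<..} f = Gamma z"
    using absolutely_integrable_Gamma_integral'[OF assms] Gamma_integral_complex'[OF assms]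
    unfolding f_def by (auto dest: integral_unique)
  hence "(\<lambda>x. \<bar>exp x\<bar> *\<^sub>R f (exp x)) absolutely_integrable_on UNIV \<and>
         integral UNIV (\<lambda>x. \<bar>exp x\<bar> *\<^sub>R f (exp x)) = Gamma z"
    by (subst has_absolute_integral_change_of_variables_real)
       (auto simp: img inj_on_def intro!: derivative_eq_intros)
  \<comment> \<open>The Jacobian exp x absorbs the - 1 in the exponent of Euler's integral.\<close>
  also have "(\<lambda>x. \<bar>exp x\<bar> *\<^sub>R f (exp x)) = h"
    unfolding f_def h_def
    by (auto simp: fun_eq_iff powr_def Ln_of_real exp_diff exp_minus exp_of_real
        scaleR_conv_of_real field_simps ring_distribs)
  finally have *: "h absolutely_integrable_on UNIV" "integral UNIV h = Gamma z" by auto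
  have "h \<in> borel_measurable borel" unfolding h_def by measurable
  with *(1) have "integrable lborel h"
    by (simp add: set_integrable_def integrable_completion)
  thus "integrable lborel h" "(LINT p|lborel. h p) = Gamma z"
    using *(2) integral_lborel[of h] by auto
qed

text \<open>The product of the two integrals over \<open>p\<close> and \<open>q\<close> is evaluated in the coordinates
  \<open>p = r + s\<close>, \<open>q = r - s\<close>, where the \<open>r\<close>-integral is again a Gamma integral.\<close>

lemma Gamma_product_integral:
  fixes z w :: complex
  assumes z: "Re z > 0" and w: "Re w > 0"
  shows "Gamma z * Gamma w =
         2 * Gamma (z + w) * (LINT s|lborel. exp ((z - w) * of_real s - (z + w) * of_real (ln (2 * cosh s))))"
proof -
  define g where "g = (\<lambda>(z::complex) p::real. exp (z * of_real p) * of_real (exp (- exp p)) :: complex)"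
  have g: "integrable lborel (g z)" "(LINT p|lborel. g z p) = Gamma z" if "Re z > 0" for z
    using Gamma_integral_exp[OF that] unfolding g_def by auto
  define L where "L = (\<lambda>s::real. ln (2 * cosh s))"
  \<comment> \<open>Here q = p - 2 s; the Jacobian of this substitution is the factor 2 in the
    result.\<close>
  define H where "H = (\<lambda>p s. g z p * g w (p - 2 * s))"
  have meas: "case_prod H \<in> borel_measurable (lborel \<Otimes>\<^sub>M lborel)"
    unfolding H_def g_def by measurable
  have int1: "integrable lborel (H p)" for p
    using lborel_integrable_real_affine[OF g(1)[OF w], of "-2" p] unfolding H_def by simp
  have absH: "(LINT s|lborel. norm (H p s)) = norm (g z p) * ((LINT q|lborel. norm (g w q)) / 2)" for p
    using lborel_integral_real_affine[of "-2" "\<lambda>q. norm (g w q)" p] unfolding H_def by (simp add: norm_mult)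
  have int: "integrable (lborel \<Otimes>\<^sub>M lborel) (case_prod H)"
    by (rule lborel_pair.Fubini_integrable[OF meas]) (simp_all add: absH int1, use g(1)[OF z] in auto)
  have "Gamma z * Gamma w = (LINT p|lborel. g z p * Gamma w)"
    using g[OF z] by simp
  also have "\<dots> = (LINT p|lborel. 2 * (LINT s|lborel. H p s))"
  proof (rule Bochner_Integration.integral_cong[OF refl])
    fix p
    show "g z p * Gamma w = 2 * (LINT s|lborel. H p s)"
      using lborel_integral_real_affine[of "-2" "g w" p] g(2)[OF w]
      unfolding H_def by (simp add: scaleR_conv_of_real)
  qed
  also have "\<dots> = 2 * (LINT s|lborel. LINT p|lborel. H p s)"
    using lborel_pair.Fubini_integral[OF int] by simp
  also have "(\<lambda>s. LINT p|lborel. H p s) =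
      (\<lambda>s. Gamma (z + w) * exp ((z - w) * of_real s - (z + w) * of_real (L s)))"
  proof
    fix s
    have eL: "exp (L s) = 2 * cosh s" by (simp add: L_def)
    have cc: "exp s + exp (-s) = 2 * cosh s" by (simp add: cosh_field_def)
    \<comment> \<open>The shift by L s = ln (2 cosh s) is chosen so that exp p + exp (p - 2 s)
      becomes exactly exp r; what remains is the integrand of Gamma (z + w) in r.\<close>
    have "H ((s - L s) + 1 * r) s = exp ((z - w) * of_real s - (z + w) * of_real (L s)) * g (z + w) r" for r
    proof -
      have "exp (s - L s + r) + exp (s - L s + r - 2 * s) = (exp s + exp (- s)) / exp (L s) * exp r"
        by (simp add: exp_diff exp_add exp_minus field_simps)
      also have "\<dots> = exp r" unfolding cc eL using cosh_real_pos[of s] by simp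
      finally have 1: "exp (s - L s + r) + exp (s - L s + r - 2 * s) = exp r" .
      have "H (s - L s + r) s = exp (z * of_real (s - L s + r) + w * of_real (s - L s + r - 2 * s)) *
              of_real (exp (- (exp (s - L s + r) + exp (s - L s + r - 2 * s))))"
        by (simp only: H_def g_def minus_add_distrib exp_add of_real_mult mult_ac)
      also have "\<dots> = exp (((z - w) * of_real s - (z + w) * of_real (L s)) + (z + w) * of_real r) * of_real (exp (- exp r))"
        unfolding 1 by (simp add: algebra_simps)
      finally show ?thesis by (simp add: g_def exp_add)
    qed
    with lborel_integral_real_affine[of 1 "\<lambda>p. H p s" "s - L s"]
    show "(LINT p|lborel. H p s) = Gamma (z + w) * exp ((z - w) * of_real s - (z + w) * of_real (L s))"
      using g[of "z + w"] z w by simp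
  qed
  finally show ?thesis by (simp add: L_def)
qed

lemma Fourier_integral_Gaussian:
  fixes d x :: real
  assumes d: "d > 0"
  shows "integrable lborel (\<lambda>l. exp (\<i> * of_real (l * x)) * of_real (exp (- (d * l)\<^sup>2 / 2)))"
    and "(LINT l|lborel. exp (\<i> * of_real (l * x)) * of_real (exp (- (d * l)\<^sup>2 / 2))) =
           of_real (sqrt (2 * pi) / d * exp (- (x / d)\<^sup>2 / 2))"
proof -
  define h where "h = (\<lambda>l::real. exp (\<i> * of_real (l * (x / d))) * of_real (exp (- l\<^sup>2 / 2)) :: complex)"
  have "of_real (exp (- (x / d)\<^sup>2 / 2)) = char std_normal_distribution (x / d)"
    by (simp add: char_std_normal_distribution)
  also have "\<dots> = (LINT l|lborel. std_normal_density l *\<^sub>R iexp (x / d * l))"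
    unfolding char_def by (subst integral_density) (auto simp: normal_density_nonneg)
  also have "\<dots> = (LINT l|lborel. of_real (1 / sqrt (2 * pi)) * h l)"
    by (intro Bochner_Integration.integral_cong)
       (auto simp: h_def std_normal_density_def scaleR_conv_of_real mult_ac)
  finally have 1: "(LINT l|lborel. h l) = of_real (sqrt (2 * pi) * exp (- (x / d)\<^sup>2 / 2))"
    by (simp add: field_simps)
  have "integrable lborel (\<lambda>l::real. exp (- l\<^sup>2 / 2))"
    using integrable_mult_right[OF integrable_normal_moment[of 1 0 0], of "sqrt (2 * pi)"]
    by (simp add: std_normal_density_def)
  hence 2: "integrable lborel h"
    by (rule Bochner_Integration.integrable_bound) (auto simp: h_def norm_mult intro!: borel_measurable_continuous_onI continuous_intros)
  have eq: "h (0 + d * l) = exp (\<i> * of_real (l * x)) * of_real (exp (- (d * l)\<^sup>2 / 2))" for l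
    using d by (simp add: h_def mult.commute)
  show "integrable lborel (\<lambda>l. exp (\<i> * of_real (l * x)) * of_real (exp (- (d * l)\<^sup>2 / 2)))"
    using lborel_integrable_real_affine[OF 2, of d 0] d unfolding eq by simp
  show "(LINT l|lborel. exp (\<i> * of_real (l * x)) * of_real (exp (- (d * l)\<^sup>2 / 2))) =
           of_real (sqrt (2 * pi) / d * exp (- (x / d)\<^sup>2 / 2))"
    using lborel_integral_real_affine[of d h 0] d 1 unfolding eq
    by (simp add: scaleR_conv_of_real field_simps)
qed

text \<open>With this sign a derivative in s becomes the factor - i l, so the evolution equation
  turns into the eigenvalue equation with eigenvalue + l. There is no normalising factor, whence the
  2 \<pi> in Parseval's identity.\<close>

definition fourier :: "(real \<Rightarrow> complex) \<Rightarrow> real \<Rightarrow> complex" where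
  "fourier f l = (LINT s|lborel. exp (\<i> * of_real (l * s)) * f s)"

lemma integrable_iexp_mult:
  assumes "integrable lborel f"
  shows "integrable lborel (\<lambda>s. exp (\<i> * of_real (l * s)) * f s)"
proof (rule Bochner_Integration.integrable_bound[OF assms])
  show "(\<lambda>s. exp (\<i> * of_real (l * s)) * f s) \<in> borel_measurable lborel"
    using borel_measurable_integrable[OF assms] by measurable
qed (auto simp: norm_mult)

text \<open>A regularised inversion formula: the Gaussian factor turns the inverse transform into an
  average of G around s at scale d, of total mass 2 \<pi>.\<close>

lemma fourier_Gaussian_product:
  fixes G :: "real \<Rightarrow> complex" and d s :: real
  assumes G: "integrable lborel G" and d: "d > 0"
  shows "(LINT l|lborel. exp (\<i> * of_real (l * s)) * fourier G (- l) * of_real (exp (- (d * l)\<^sup>2 / 2))) =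
         (LINT r|lborel. of_real (sqrt (2 * pi) * exp (- r\<^sup>2 / 2)) * G (s + d * r))"
proof -
  define E where "E = (\<lambda>l. of_real (exp (- (d * l)\<^sup>2 / 2)) :: complex)"
  note [measurable] = borel_measurable_integrable[OF G]
  have E: "integrable lborel E"
    using Fourier_integral_Gaussian(1)[OF d, of 0] by (simp add: E_def)
  define H where "H = (\<lambda>l t. exp (\<i> * of_real (l * (s - t))) * E l * G t)"
  have int: "integrable (lborel \<Otimes>\<^sub>M lborel) (case_prod H)"
  proof (rule lborel_pair.Fubini_integrable)
    show "case_prod H \<in> borel_measurable (lborel \<Otimes>\<^sub>M lborel)"
      unfolding H_def E_def by measurable
    have "norm (H l t) = norm (E l) * norm (G t)" for l t
      by (simp add: H_def norm_mult)
    thus "integrable lborel (\<lambda>l. LINT t|lborel. norm (case_prod H (l, t)))"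
      using E by simp
    have "integrable lborel (\<lambda>t. H l t)" for l
      using G by (rule Bochner_Integration.integrable_bound[OF integrable_mult_right[of "E l"]])
         (auto simp: H_def norm_mult)
    thus "AE l in lborel. integrable lborel (\<lambda>t. case_prod H (l, t))" by simp
  qed
  have "exp (\<i> * of_real (l * s)) * fourier G (- l) * E l = (LINT t|lborel. H l t)" for l
  proof -
    have "exp (\<i> * of_real (l * s)) * fourier G (- l) * E l =
       (LINT t|lborel. (exp (\<i> * of_real (l * s)) * E l) * (exp (\<i> * of_real (- l * t)) * G t))"
      unfolding fourier_def by simp
    also have "\<dots> = (LINT t|lborel. H l t)"
      by (intro Bochner_Integration.integral_cong)
         (auto simp: H_def exp_add[symmetric] algebra_simps exp_minus field_simps exp_diff)
    finally show ?thesis .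
  qed
  hence "(LINT l|lborel. exp (\<i> * of_real (l * s)) * fourier G (- l) * E l) =
        (LINT l|lborel. LINT t|lborel. H l t)" by simp
  also have "\<dots> = (LINT t|lborel. LINT l|lborel. H l t)"
    using lborel_pair.Fubini_integral[OF int] by simp
  also have "\<dots> = (LINT t|lborel. of_real (sqrt (2 * pi) / d * exp (- ((s - t) / d)\<^sup>2 / 2)) * G t)"
    unfolding H_def E_def integral_mult_left_zero Fourier_integral_Gaussian(2)[OF d] ..
  also have "\<dots> = (LINT r|lborel. of_real (sqrt (2 * pi) * exp (- r\<^sup>2 / 2)) * G (s + d * r))"
    using lborel_integral_real_affine[of d "\<lambda>t. of_real (sqrt (2 * pi) / d * exp (- ((s - t) / d)\<^sup>2 / 2)) * G t" s] d
    by (simp add: scaleR_conv_of_real mult.assoc)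
  finally show ?thesis by (simp add: E_def)
qed

text \<open>The factor \<open>exp (- d\<^sup>2 l\<^sup>2 / 2)\<close> makes the triple integral absolutely convergent; it is then removed
  by letting \<open>d \<rightarrow> 0\<close>.\<close>

lemma fourier_Parseval:
  fixes F G :: "real \<Rightarrow> complex"
  assumes F: "integrable lborel F" and G: "integrable lborel G"
    and contG: "continuous_on UNIV G" and bound: "\<And>s. norm (G s) \<le> C"
    and int: "integrable lborel (\<lambda>l. fourier F l * fourier G (- l))"
  shows "(LINT l|lborel. fourier F l * fourier G (- l)) = 2 * pi * (LINT s|lborel. F s * G s)"
proof -
  note [measurable] = borel_measurable_integrable[OF F] borel_measurable_integrable[OF G]
  define d where "d = (\<lambda>n. inverse (real (Suc n)))"
  have d: "d n > 0" for n by (simp add: d_def)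
  have d0: "d \<longlonglongrightarrow> 0" unfolding d_def by (rule LIMSEQ_inverse_real_of_nat)
  define E where "E = (\<lambda>n l. of_real (exp (- (d n * l)\<^sup>2 / 2)) :: complex)"
  define w where "w = (\<lambda>r. sqrt (2 * pi) * exp (- r\<^sup>2 / 2))"
  have w: "integrable lborel w" "(LINT r|lborel. w r) = 2 * pi"
  proof -
    have "has_bochner_integral lborel (\<lambda>r. std_normal_density r) 1"
      using std_normal_moment_even[of 0] by simp
    hence "has_bochner_integral lborel (\<lambda>r. 2 * pi * std_normal_density r) (2 * pi * 1)"
      by (rule has_bochner_integral_mult_right)
    also have "(\<lambda>r. 2 * pi * std_normal_density r) = w"
      by (auto simp: w_def std_normal_density_def fun_eq_iff real_div_sqrt real_sqrt_mult field_simps)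
    finally show "integrable lborel w" "(LINT r|lborel. w r) = 2 * pi"
      by (auto simp: has_bochner_integral_iff)
  qed
  \<comment> \<open>\<open>K n s\<close> is 2 \<pi> times a Gaussian mean of G around s at scale
    \<open>d n\<close>. It is bounded by 2 \<pi> C for all n and tends to 2 \<pi> G s by
    continuity.\<close>
  define K where "K = (\<lambda>n s. LINT r|lborel. of_real (w r) * G (s + d n * r))"
  have K_meas[measurable]: "K n \<in> borel_measurable borel" for n
    unfolding K_def w_def by measurable
  have C: "C \<ge> 0" using bound[of 0] norm_ge_zero order.trans by blast
  have w0: "w r \<ge> 0" for r by (simp add: w_def)
  have G': "integrable lborel (\<lambda>r. of_real (w r) * G (s + t * r))" for s t
    by (rule Bochner_Integration.integrable_bound[OF integrable_mult_left[OF w(1), of C]])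
       (use w0 C bound in \<open>auto simp: norm_mult w_def intro!: mult_mono\<close>)
  have K_bound: "norm (K n s) \<le> 2 * pi * C" for n s
  proof -
    have "norm (K n s) \<le> (LINT r|lborel. w r * C)"
      unfolding K_def 
      by (rule Bochner_Integration.integral_norm_bound_integral[OF G' integrable_mult_left[OF w(1)]])
         (use w0 bound in \<open>auto simp: norm_mult intro!: mult_left_mono\<close>)
    thus ?thesis using w(2) by simp
  qed
  have K_lim: "(\<lambda>n. K n s) \<longlonglongrightarrow> 2 * pi * G s" for s
  proof -
    have "(\<lambda>n. K n s) \<longlonglongrightarrow> (LINT r|lborel. of_real (w r) * G s)"
      unfolding K_def
    proof (rule integral_dominated_convergence[where w = "\<lambda>r. w r * C"])
      show "AE r in lborel. (\<lambda>n. of_real (w r) * G (s + d n * r)) \<longlonglongrightarrow> of_real (w r) * G s"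
      proof (rule AE_I2, intro tendsto_intros)
        fix r
        have "isCont G (s + 0 * r)" using contG by (simp add: continuous_on_eq_continuous_at)
        moreover have "(\<lambda>n. s + d n * r) \<longlonglongrightarrow> s + 0 * r" by (intro tendsto_intros d0)
        ultimately have "(\<lambda>n. G (s + d n * r)) \<longlonglongrightarrow> G (s + 0 * r)"
          by (rule isCont_tendsto_compose)
        thus "(\<lambda>n. G (s + d n * r)) \<longlonglongrightarrow> G s" by simp
      qed
    qed (use w w0 bound in \<open>auto simp: norm_mult w_def intro!: mult_left_mono\<close>)
    also have "(LINT r|lborel. of_real (w r) * G s) = 2 * pi * G s"
      using w by simp
    finally show ?thesis .
  qed
  have "(\<lambda>n. LINT l|lborel. fourier F l * fourier G (- l) * E n l) \<longlonglongrightarrow> (LINT l|lborel. fourier F l * fourier G (- l))"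
  proof (rule integral_dominated_convergence[where w = "\<lambda>l. norm (fourier F l * fourier G (- l))"])
    show "AE l in lborel. (\<lambda>n. fourier F l * fourier G (- l) * E n l) \<longlonglongrightarrow> fourier F l * fourier G (- l)"
    proof (rule AE_I2)
      fix l
      have "(\<lambda>n. fourier F l * fourier G (- l) * E n l) \<longlonglongrightarrow> fourier F l * fourier G (- l) * of_real (exp (- (0 * l)\<^sup>2 / 2))"
        unfolding E_def by (intro tendsto_intros d0) auto
      thus "(\<lambda>n. fourier F l * fourier G (- l) * E n l) \<longlonglongrightarrow> fourier F l * fourier G (- l)" by simp
    qed
    show "(\<lambda>l. fourier F l * fourier G (- l) * E n l) \<in> borel_measurable lborel" for n
      using borel_measurable_integrable[OF int] unfolding E_def by measurable
  qed (use int integrable_norm[OF int] in \<open>auto simp: norm_mult E_def intro!: mult_left_le\<close>)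
  moreover have "(LINT l|lborel. fourier F l * fourier G (- l) * E n l) = (LINT s|lborel. F s * K n s)" for n
  proof -
    define H where "H = (\<lambda>l s. exp (\<i> * of_real (l * s)) * F s * (fourier G (- l) * E n l))"
    have E: "integrable lborel (E n)"
      using Fourier_integral_Gaussian(1)[OF d, of 0] by (simp add: E_def)
    have Gm[measurable]: "fourier G \<in> borel_measurable borel"
      unfolding fourier_def by measurable
    have Gb: "norm (fourier G l) \<le> (LINT s|lborel. norm (G s))" for l
      unfolding fourier_def
      by (rule Bochner_Integration.integral_norm_bound_integral[OF integrable_iexp_mult[OF G] integrable_norm[OF G]])
         (auto simp: norm_mult)
    have GE: "integrable lborel (\<lambda>l. fourier G (- l) * E n l)"
      by (rule Bochner_Integration.integrable_bound[OF integrable_mult_left[OF integrable_norm[OF E], of "LINT s|lborel. norm (G s)"]])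
         (use Gb in \<open>auto simp: norm_mult E_def mult.commute intro!: mult_mono\<close>)
    have int': "integrable (lborel \<Otimes>\<^sub>M lborel) (case_prod H)"
    proof (rule lborel_pair.Fubini_integrable)
      show "case_prod H \<in> borel_measurable (lborel \<Otimes>\<^sub>M lborel)"
        unfolding H_def E_def by measurable
      have *: "norm (H l s) = norm (fourier G (- l) * E n l) * norm (F s)" for l s
        by (simp add: H_def norm_mult)
      show "integrable lborel (\<lambda>l. LINT s|lborel. norm (case_prod H (l, s)))"
        using GE by (simp only: * prod.case integral_mult_right_zero integrable_mult_left integrable_norm)
      have "integrable lborel (\<lambda>s. H l s)" for l
        unfolding H_def using integrable_iexp_mult[OF F] by (rule integrable_mult_left)
      thus "AE l in lborel. integrable lborel (\<lambda>s. case_prod H (l, s))" by simp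
    qed
    have "(LINT l|lborel. fourier F l * fourier G (- l) * E n l) = (LINT l|lborel. LINT s|lborel. H l s)"
      by (simp only: H_def integral_mult_left_zero fourier_def[of F], simp only: mult.assoc)
    also have "\<dots> = (LINT s|lborel. LINT l|lborel. H l s)"
      using lborel_pair.Fubini_integral[OF int'] by simp
    also have "(\<lambda>s. LINT l|lborel. H l s) = (\<lambda>s. F s * K n s)"
    proof
      fix s
      have "(LINT l|lborel. H l s) = F s * (LINT l|lborel. exp (\<i> * of_real (l * s)) * fourier G (- l) * E n l)"
        unfolding H_def by (simp add: mult_ac flip: integral_mult_right_zero)
      thus "(LINT l|lborel. H l s) = F s * K n s"
        using fourier_Gaussian_product[OF G d[of n], of s] by (simp add: K_def w_def E_def)
    qed
    finally show ?thesis .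
  qed
  ultimately have 1: "(\<lambda>n. LINT s|lborel. F s * K n s) \<longlonglongrightarrow> (LINT l|lborel. fourier F l * fourier G (- l))"
    by simp
  have "(\<lambda>n. LINT s|lborel. F s * K n s) \<longlonglongrightarrow> (LINT s|lborel. F s * (2 * pi * G s))"
  proof (rule integral_dominated_convergence[where w = "\<lambda>s. norm (F s) * (2 * pi * C)"])
    show "AE s in lborel. (\<lambda>n. F s * K n s) \<longlonglongrightarrow> F s * (2 * pi * G s)"
      by (intro AE_I2 tendsto_mult tendsto_const K_lim)
  qed (use F K_bound in \<open>auto simp: norm_mult intro!: mult_left_mono\<close>)
  also have "(LINT s|lborel. F s * (2 * pi * G s)) = 2 * pi * (LINT s|lborel. F s * G s)"
    by (simp add: mult_ac flip: integral_mult_right_zero)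
  finally show ?thesis using 1 LIMSEQ_unique by blast
qed

section \<open>The Mehler kernel\<close>

text \<open>One family for all kernels that occur: p = 1/2 is the Mehler kernel, p = 3/2 arises from
  its derivative in a at a = 0, p = 1 from the product of two Mehler kernels, and p = 0 is a
  primitive with nonzero limits. Products stay in the family, and p > 0 gives exponential
  decay.\<close>

definition kern :: "real \<Rightarrow> complex \<Rightarrow> complex \<Rightarrow> real \<Rightarrow> complex" where
  "kern p c d s = of_real (cosh s powr - p) * exp (c * of_real (tanh s) + d * of_real (inverse (cosh s)))"

lemma abs_tanh_le_1: "\<bar>tanh s\<bar> \<le> 1" for s :: real
  using tanh_real_bounds[of s] by auto

lemma inverse_cosh_bounds: "0 < inverse (cosh s)" "inverse (cosh s) \<le> 1" for s :: real
  using cosh_real_ge_1[of s] cosh_real_pos[of s] by (auto simp: field_simps)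

lemma tanh_sech_square: "(tanh s)\<^sup>2 + (inverse (cosh s))\<^sup>2 = 1" for s :: real
proof -
  have "(tanh s)\<^sup>2 + (inverse (cosh s))\<^sup>2 = ((sinh s)\<^sup>2 + 1) / (cosh s)\<^sup>2"
    by (simp add: tanh_def power_divide inverse_eq_divide add_divide_distrib)
  thus ?thesis using cosh_real_pos[of s] by (simp add: cosh_square_eq[symmetric])
qed

lemma norm_tanh_sech_combination_le:
  fixes u v :: complex and s :: real
  assumes "norm u \<le> M" "norm v \<le> M"
  shows "norm (u * of_real (tanh s) + v * of_real (inverse (cosh s))) \<le> 2 * M"
proof -
  have "M \<ge> 0" using assms(1) norm_ge_zero order.trans by blast
  hence "norm u * \<bar>tanh s\<bar> \<le> M * 1" "norm v * \<bar>inverse (cosh s)\<bar> \<le> M * 1"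
    using assms abs_tanh_le_1[of s] inverse_cosh_bounds[of s] by (intro mult_mono; simp)+
  hence "norm (u * of_real (tanh s) + v * of_real (inverse (cosh s))) \<le> M * 1 + M * 1"
    by (intro order.trans[OF norm_triangle_ineq] add_mono) (simp_all only: norm_mult norm_of_real)
  thus ?thesis by simp
qed

text \<open>The bound depends on c and d only through M, so one dominating function serves a whole
  ball of parameters.\<close>

lemma norm_kern_le:
  assumes "norm c \<le> M" "norm d \<le> M"
  shows "norm (kern p c d s) \<le> exp (2 * M) * cosh s powr - p"
proof -
  have "norm (c * of_real (tanh s) + d * of_real (inverse (cosh s)) :: complex) \<le> 2 * M"
    using assms by (rule norm_tanh_sech_combination_le)
  hence "norm (exp (c * of_real (tanh s) + d * of_real (inverse (cosh s)) :: complex)) \<le> exp (2 * M)"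
    by (intro order.trans[OF norm_exp]) auto
  thus ?thesis unfolding kern_def norm_mult norm_of_real
    by (subst mult.commute) (intro mult_mono, auto)
qed

lemma continuous_kern [continuous_intros]: "continuous_on A (kern p c d)"
proof -
  have "cosh s \<noteq> 0" for s :: real using cosh_real_pos[of s] by simp
  thus ?thesis unfolding kern_def by (intro continuous_intros) auto
qed

lemma measurable_kern [measurable]: "kern p c d \<in> borel_measurable borel"
  by (intro borel_measurable_continuous_onI continuous_intros)

lemma integrable_kern:
  assumes "p > 0"
  shows "integrable lborel (kern p c d)"
proof (rule Bochner_Integration.integrable_bound)
  show "integrable lborel (\<lambda>s. exp (2 * max (norm c) (norm d)) * cosh s powr - p)"
    using integrable_cosh_powr[OF assms] by simp
qed (use norm_kern_le[of c "max (norm c) (norm d)" d p] in auto)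

lemma integrable_kern_mult:
  assumes "p > 0" "continuous_on UNIV q" "\<And>s. norm (q s) \<le> M"
  shows "integrable lborel (\<lambda>s. kern p c d s * q s)"
proof (rule Bochner_Integration.integrable_bound)
  show "integrable lborel (\<lambda>s. M *\<^sub>R kern p c d s)"
    using integrable_kern[OF assms(1)] by simp
  have "q \<in> borel_measurable borel" using assms(2) by (rule borel_measurable_continuous_onI)
  thus "(\<lambda>s. kern p c d s * q s) \<in> borel_measurable lborel" by measurable
  show "AE s in lborel. norm (kern p c d s * q s) \<le> norm (M *\<^sub>R kern p c d s)"
  proof (rule AE_I2)
    fix s
    have "norm (q s) \<le> \<bar>M\<bar>" using assms(3)[of s] by linarith
    thus "norm (kern p c d s * q s) \<le> norm (M *\<^sub>R kern p c d s)"
      by (simp add: norm_mult mult.commute mult_right_mono)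
  qed
qed

lemma kern_mult: "kern p c d s * kern q c' d' s = kern (p + q) (c + c') (d + d') s"
  by (simp add: kern_def exp_add[symmetric] powr_add[symmetric] algebra_simps flip: of_real_mult)

lemma kern_mult_sech: "kern p c d s * of_real (inverse (cosh s)) = kern (p + 1) c d s"
proof -
  have "cosh s powr (- p - 1) = cosh s powr - p * inverse (cosh s)"
    using cosh_real_pos[of s] by (simp add: powr_diff field_simps)
  thus ?thesis by (simp add: kern_def)
qed

lemma kern_tendsto_0:
  assumes "p > 0"
  shows "(kern p c d \<longlongrightarrow> 0) at_top" "(kern p c d \<longlongrightarrow> 0) at_bot"
proof -
  define M where "M = max (norm c) (norm d)"
  have "((\<lambda>s. exp (2 * M) * cosh s powr - p) \<longlongrightarrow> exp (2 * M) * 0) F \<Longrightarrow> (kern p c d \<longlongrightarrow> 0) F" for F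
    by (rule Lim_null_comparison[of _ "\<lambda>s. exp (2 * M) * cosh s powr - p"])
       (auto simp: M_def intro!: always_eventually norm_kern_le)
  thus "(kern p c d \<longlongrightarrow> 0) at_top" "(kern p c d \<longlongrightarrow> 0) at_bot"
    using tendsto_mult[OF tendsto_const tendsto_cosh_powr(1)[OF assms]]
          tendsto_mult[OF tendsto_const tendsto_cosh_powr(2)[OF assms]] by blast+
qed

section \<open>Derivatives of the kernel and of its transform\<close>

lemma has_real_derivative_ln_cosh: "((\<lambda>s::real. ln (cosh s)) has_real_derivative tanh s) (at s)"
  using cosh_real_pos[of s] by (auto intro!: derivative_eq_intros simp: tanh_def)

lemma has_real_derivative_sech:
  "((\<lambda>s::real. inverse (cosh s)) has_real_derivative - (tanh s * inverse (cosh s))) (at s)"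
  using cosh_real_pos[of s] by (auto intro!: derivative_eq_intros simp: tanh_def field_simps)

lemma has_real_derivative_tanh: "(tanh has_real_derivative (inverse (cosh s))\<^sup>2) (at s)" for s :: real
  using cosh_real_pos[of s] tanh_sech_square[of s] 
  by (auto intro!: derivative_eq_intros simp: algebra_simps)

definition kern_log_deriv :: "real \<Rightarrow> complex \<Rightarrow> complex \<Rightarrow> real \<Rightarrow> complex" where
  "kern_log_deriv p c d s = - of_real (p * tanh s) + c * of_real ((inverse (cosh s))\<^sup>2)
     - d * of_real (tanh s * inverse (cosh s))"

lemma has_vector_derivative_kern:
  "(kern p c d has_vector_derivative kern p c d s * kern_log_deriv p c d s) (at s)"
proof -
  define h where "h = (\<lambda>s. of_real (- p * ln (cosh s)) + c * of_real (tanh s) + d * of_real (inverse (cosh s)) :: complex)"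
  have eq: "kern p c d = exp \<circ> h"
  proof
    fix s :: real
    have "of_real (cosh s powr - p) = exp (of_real (- p * ln (cosh s)) :: complex)"
      using cosh_real_pos[of s] by (simp only: powr_def exp_of_real) auto
    thus "kern p c d s = (exp \<circ> h) s" by (simp only: kern_def h_def o_def add.assoc exp_add)
  qed
  have "(h has_vector_derivative of_real (- p * tanh s) + c * of_real ((inverse (cosh s))\<^sup>2) 
          + d * of_real (- (tanh s * inverse (cosh s)))) (at s)"
    unfolding h_def
    by (intro has_vector_derivative_add has_vector_derivative_mult_right has_vector_derivative_of_real
          DERIV_cmult has_real_derivative_ln_cosh has_real_derivative_sech has_real_derivative_tanh)
  from field_vector_diff_chain_at[OF this DERIV_exp] show ?thesis
    unfolding eq by (simp add: kern_log_deriv_def algebra_simps)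
qed

lemma continuous_kern_log_deriv [continuous_intros]: "continuous_on A (kern_log_deriv p c d)"
proof -
  have "cosh s \<noteq> 0" for s :: real using cosh_real_pos[of s] by simp
  thus ?thesis unfolding kern_log_deriv_def by (intro continuous_intros) auto
qed

lemma norm_kern_log_deriv_le: "norm (kern_log_deriv p c d s) \<le> \<bar>p\<bar> + norm c + norm d"
proof -
  have 1: "\<bar>p * tanh s\<bar> \<le> \<bar>p\<bar> * 1" 
    unfolding abs_mult using abs_tanh_le_1[of s] by (intro mult_mono) auto
  have 2: "\<bar>(inverse (cosh s))\<^sup>2\<bar> \<le> 1" using inverse_cosh_bounds[of s] by (simp add: power_le_one)
  have 3: "\<bar>tanh s * inverse (cosh s)\<bar> \<le> 1 * 1" 
    unfolding abs_mult using abs_tanh_le_1[of s] inverse_cosh_bounds[of s] by (intro mult_mono) auto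
  show ?thesis unfolding kern_log_deriv_def
    using 1 2 3
    by (intro order.trans[OF norm_triangle_ineq4] order.trans[OF norm_triangle_ineq] add_mono)
       (auto simp only: norm_mult norm_of_real norm_minus_cancel mult_left_le mult_1_right norm_ge_zero)
qed

text \<open>Integration by parts; the boundary terms vanish because the kernel decays for p > 0. It
  is used twice: to replace the s-derivative in the evolution equation by a multiple of l, and to
  obtain decay in l.\<close>

lemma fourier_kern_derivative:
  assumes "p > 0"
  shows "fourier (\<lambda>s. kern p c d s * kern_log_deriv p c d s) l = - \<i> * of_real l * fourier (kern p c d) l"
proof -
  define e where "e = (\<lambda>s. exp (\<i> * of_real (l * s)))"
  have e: "(e has_vector_derivative e s * (\<i> * of_real l)) (at s)" for s
  proof -
    have "((\<lambda>s. \<i> * of_real (l * s)) has_vector_derivative \<i> * of_real (l * 1)) (at s)"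
      by (intro has_vector_derivative_mult_right has_vector_derivative_of_real DERIV_cmult DERIV_ident)
    from field_vector_diff_chain_at[OF this DERIV_exp] show ?thesis
      by (simp add: e_def o_def mult_ac)
  qed
  have int1: "integrable lborel (\<lambda>s. e s * (kern p c d s * kern_log_deriv p c d s))"
    unfolding e_def
    by (intro integrable_iexp_mult integrable_kern_mult[OF assms, where M = "\<bar>p\<bar> + norm c + norm d"]
         continuous_intros norm_kern_log_deriv_le)
  have int2: "integrable lborel (\<lambda>s. e s * kern p c d s)"
    unfolding e_def by (intro integrable_iexp_mult integrable_kern assms)
  have "(LINT s|lborel. e s * (kern p c d s * kern_log_deriv p c d s) + \<i> * of_real l * (e s * kern p c d s)) = 0 - 0"
  proof (rule integral_derivative_real_line[where F = "\<lambda>s. e s * kern p c d s"])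
    fix s
    show "((\<lambda>s. e s * kern p c d s) has_vector_derivative
             e s * (kern p c d s * kern_log_deriv p c d s) + \<i> * of_real l * (e s * kern p c d s)) (at s)"
      using has_vector_derivative_mult[OF e[of s] has_vector_derivative_kern[of p c d s]]
      by (simp add: algebra_simps)
  next
    have "norm (e s) = 1" for s by (simp add: e_def)
    thus "((\<lambda>s. e s * kern p c d s) \<longlongrightarrow> 0) at_bot" "((\<lambda>s. e s * kern p c d s) \<longlongrightarrow> 0) at_top"
      using kern_tendsto_0[OF assms, of c d, THEN tendsto_norm]
      by (auto intro!: tendsto_norm_zero_cancel[of "\<lambda>s. e s * kern p c d s"] simp: norm_mult)
    show "continuous_on UNIV (\<lambda>s. e s * (kern p c d s * kern_log_deriv p c d s) + \<i> * of_real l * (e s * kern p c d s))"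
      unfolding e_def by (intro continuous_intros)
  qed (use int1 int2 in auto)
  thus ?thesis using int1 int2 
    by (simp add: fourier_def e_def eq_neg_iff_add_eq_0)
qed

text \<open>The factor \<open>q\<close> makes the derivative again a transform of the form treated
  here, so the lemma can be applied to its own result and yields second derivatives. M has to work
  on the unit ball around z only.\<close>

lemma has_field_derivative_fourier_kern:
  fixes c d c' d' :: "complex \<Rightarrow> complex" and q q' :: "complex \<Rightarrow> real \<Rightarrow> complex"
  assumes p: "p > 0"
    and c: "\<And>x. (c has_field_derivative c' x) (at x)"
    and d: "\<And>x. (d has_field_derivative d' x) (at x)"
    and q: "\<And>x s. ((\<lambda>x. q x s) has_field_derivative q' x s) (at x)"
    and cont: "\<And>x. continuous_on UNIV (q x)" "\<And>x. continuous_on UNIV (q' x)"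
    and bound: "\<And>x. x \<in> ball z 1 \<Longrightarrow> norm (c x) \<le> M" "\<And>x. x \<in> ball z 1 \<Longrightarrow> norm (d x) \<le> M"
      "\<And>x. x \<in> ball z 1 \<Longrightarrow> norm (c' x) \<le> M" "\<And>x. x \<in> ball z 1 \<Longrightarrow> norm (d' x) \<le> M"
      "\<And>x s. x \<in> ball z 1 \<Longrightarrow> norm (q x s) \<le> M" "\<And>x s. x \<in> ball z 1 \<Longrightarrow> norm (q' x s) \<le> M"
  shows "((\<lambda>x. fourier (\<lambda>s. kern p (c x) (d x) s * q x s) l) has_field_derivative
           fourier (\<lambda>s. kern p (c z) (d z) s *
             (q z s * (c' z * of_real (tanh s) + d' z * of_real (inverse (cosh s))) + q' z s)) l) (at z)"
proof -
  define T where "T = (\<lambda>s. of_real (tanh s) :: complex)"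
  define S where "S = (\<lambda>s. of_real (inverse (cosh s)) :: complex)"
  have cnz: "cosh s \<noteq> 0" for s :: real using cosh_real_pos[of s] by simp
  have contT: "continuous_on UNIV T" "continuous_on UNIV S"
    unfolding T_def S_def using cnz by (auto intro!: continuous_intros)
  have M: "M \<ge> 0" using order.trans[OF norm_ge_zero bound(1)[of z]] by simp
  have comb: "norm (u * T s + v * S s) \<le> 2 * M" if "norm u \<le> M" "norm v \<le> M" for u v s
    unfolding T_def S_def using that by (rule norm_tanh_sech_combination_le)
  define f where "f = (\<lambda>x s. exp (\<i> * of_real (l * s)) * (kern p (c x) (d x) s * q x s))"
  define f' where "f' = (\<lambda>x s. exp (\<i> * of_real (l * s)) * (kern p (c x) (d x) s *
       (q x s * (c' x * T s + d' x * S s) + q' x s)))"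
  have "((\<lambda>x. LINT s|lborel. f x s) has_field_derivative (LINT s|lborel. f' z s)) (at z)"
  proof (rule has_field_derivative_integral(2))
    fix x s
    assume x: "x \<in> ball z 1"
    have k: "((\<lambda>x. kern p (c x) (d x) s) has_field_derivative
               kern p (c x) (d x) s * (c' x * T s + d' x * S s)) (at x)"
      unfolding kern_def T_def S_def
      by (rule derivative_eq_intros c d refl)+ (simp add: algebra_simps)
    show "((\<lambda>x. f x s) has_field_derivative f' x s) (at x)"
      unfolding f_def f'_def
      by (rule derivative_eq_intros k q refl)+ (simp add: algebra_simps)
    have "norm (q x s * (c' x * T s + d' x * S s)) \<le> M * (2 * M)"
      unfolding norm_mult using bound[OF x] M comb by (intro mult_mono) auto
    hence "norm (q x s * (c' x * T s + d' x * S s) + q' x s) \<le> 2 * M * M + M"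
      using bound(6)[OF x] by (intro order.trans[OF norm_triangle_ineq]) (simp add: add_mono mult_ac)
    moreover have "norm (kern p (c x) (d x) s) \<le> exp (2 * M) * cosh s powr - p"
      using bound[OF x] by (intro norm_kern_le)
    ultimately have "norm (kern p (c x) (d x) s) * norm (q x s * (c' x * T s + d' x * S s) + q' x s)
        \<le> (exp (2 * M) * cosh s powr - p) * (2 * M * M + M)"
      by (intro mult_mono) auto
    thus "norm (f' x s) \<le> (exp (2 * M) * cosh s powr - p) * (2 * M * M + M)"
      by (simp add: f'_def norm_mult)
  next
    fix x assume x: "x \<in> ball z 1"
    show "integrable lborel (f x)"
      unfolding f_def by (intro integrable_iexp_mult integrable_kern_mult[OF p, where M = M] cont bound x)
  next
    show "f' z \<in> borel_measurable borel"
      unfolding f'_def by (intro borel_measurable_continuous_onI continuous_intros cont contT)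
    show "integrable lborel (\<lambda>s. (exp (2 * M) * cosh s powr - p) * (2 * M * M + M))"
      using integrable_cosh_powr[OF p] by simp
  qed auto
  thus ?thesis by (simp add: f_def f'_def fourier_def T_def S_def)
qed

lemma fourier_add:
  assumes "integrable lborel f" "integrable lborel g"
  shows "fourier (\<lambda>s. f s + g s) l = fourier f l + fourier g l"
  using assms[THEN integrable_iexp_mult] by (simp add: fourier_def distrib_left)

lemma fourier_cmult: "fourier (\<lambda>s. c * f s) l = c * fourier f l"
  unfolding fourier_def by (simp add: mult.left_commute[of _ c])

definition mehler :: "complex \<Rightarrow> complex \<Rightarrow> real \<Rightarrow> complex" where
  "mehler a b = kern (1/2) (\<i> * (a\<^sup>2 + b\<^sup>2) / 4) (a * b / 2)"

lemma mehler_commute: "mehler a b = mehler b a"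
  by (simp add: mehler_def add.commute mult.commute)

section \<open>The solutions as Fourier transforms\<close>

text \<open>Cramer's rule for the Wronskian of \<open>u1\<close> and \<open>u2\<close>, which is
  constantly 1. A transform is thus identified by its value and derivative at 0 alone.\<close>

lemma entire_solution_eq_u1_u2:
  assumes f: "entire_solution lam a b f"
  shows "f x = a * u1 lam x + b * u2 lam x"
proof -
  define p where "p = u1 lam"
  define q where "q = u2 lam"
  have p: "entire_solution lam 1 0 p" unfolding p_def u1_eq_formula by (rule entire_solution_u1_formula)
  have q: "entire_solution lam 0 1 q" unfolding q_def u2_eq_formula by (rule entire_solution_u2_formula)
  have 0: "p x * deriv q x - deriv p x * q x = 1"
    using entire_solution_wronskian[OF p q] by simp
  have 1: "f x * deriv q x - deriv f x * q x = a"
    using entire_solution_wronskian[OF f q] by simp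
  have 2: "f x * deriv p x - deriv f x * p x = - b"
    using entire_solution_wronskian[OF f p] by simp
  have "f x = f x * (p x * deriv q x - deriv p x * q x)" by (simp add: 0)
  also have "\<dots> = p x * (f x * deriv q x - deriv f x * q x) - q x * (f x * deriv p x - deriv f x * p x)"
    by (simp add: algebra_simps)
  finally have "f x = p x * a - q x * (- b)" unfolding 1 2 .
  thus ?thesis by (simp add: p_def q_def mult.commute)
qed

lemma entire_solution_fourier_mehler:
  "entire_solution (of_real l) (fourier (mehler 0 b) l) (b / 2 * fourier (kern (3/2) (\<i> * b\<^sup>2 / 4) 0) l)
     (\<lambda>a. fourier (mehler a b) l)"
proof -
  define T where "T = (\<lambda>s. of_real (tanh s) :: complex)"
  define S where "S = (\<lambda>s. of_real (inverse (cosh s)) :: complex)"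
  have TS: "(T s)\<^sup>2 + (S s)\<^sup>2 = 1" for s
    using tanh_sech_square[of s] unfolding T_def S_def by (metis of_real_1 of_real_add of_real_power)
  have cnz: "cosh s \<noteq> 0" for s :: real using cosh_real_pos[of s] by simp
  have contT: "continuous_on UNIV T" "continuous_on UNIV S"
    unfolding T_def S_def using cnz by (auto intro!: continuous_intros)
  have nT: "norm (T s) \<le> 1" for s using abs_tanh_le_1 by (simp add: T_def)
  define c where "c = (\<lambda>a::complex. \<i> * (a\<^sup>2 + b\<^sup>2) / 4)"
  define d where "d = (\<lambda>a::complex. a * b / 2)"
  define m where "m = (\<lambda>a. kern (1/2) (c a) (d a))"
  define q where "q = (\<lambda>a s. \<i> * a / 2 * T s + b / 2 * S s)"
  have c: "(c has_field_derivative \<i> * a / 2) (at a)" for a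
    unfolding c_def by (auto intro!: derivative_eq_intros)
  have d: "(d has_field_derivative b / 2) (at a)" for a
    unfolding d_def by (auto intro!: derivative_eq_intros)
  have q: "((\<lambda>a. q a s) has_field_derivative \<i> / 2 * T s) (at a)" for a s
    unfolding q_def by (auto intro!: derivative_eq_intros)
  have cq: "continuous_on UNIV (q a)" for a
    unfolding q_def by (intro continuous_intros contT)
  have bounds: "norm (c x) \<le> M" "norm (d x) \<le> M" "norm (\<i> * x / 2) \<le> M" "norm (b / 2) \<le> M"
     "norm (q x s) \<le> M" "norm (\<i> / 2 * T s) \<le> M" "norm (1::complex) \<le> M" "norm (0::complex) \<le> M"
    if x: "x \<in> ball a 1" and M: "M = (norm a + norm b + 2)\<^sup>2" for x a M s
  proof -
    \<comment> \<open>R dominates |x| on the unit ball around a as well as |b| and 1, so R^2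
      dominates every term of degree at most two.\<close>
    define R where "R = norm a + norm b + 2"
    have "norm (x - a) < 1" using x by (simp add: dist_norm norm_minus_commute)
    moreover have "norm x \<le> norm a + norm (x - a)" using norm_triangle_ineq[of a "x - a"] by simp
    ultimately have "norm x \<le> R" unfolding R_def using norm_ge_zero[of b] by linarith
    moreover have "norm b \<le> R" "1 \<le> R" 
      unfolding R_def using norm_ge_zero[of a] norm_ge_zero[of b] by linarith+
    moreover have MR: "M = R * R" unfolding M R_def by (rule power2_eq_square)
    ultimately have xR: "norm x \<le> R" "norm b \<le> R" "1 \<le> R" "M = R * R" by blast+
    have "R * 1 \<le> R * R" by (rule mult_left_mono) (use xR(3) in linarith)+
    hence R1: "R \<le> M" unfolding MR by linarith
    have R2: "1 \<le> M" using R1 xR(3) by linarith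
    have xx: "norm x * norm x \<le> M" "norm b * norm b \<le> M" "norm x * norm b \<le> M"
      unfolding xR(4) using xR(1-3) by (intro mult_mono; simp)+
    have "norm (x\<^sup>2 + b\<^sup>2) \<le> norm x * norm x + norm b * norm b"
      by (rule order.trans[OF norm_triangle_ineq]) (simp add: norm_mult power2_eq_square)
    thus "norm (c x) \<le> M" unfolding c_def using xx R2 by (simp add: norm_mult norm_divide)
    show "norm (d x) \<le> M" unfolding d_def using xx R2 by (simp add: norm_mult norm_divide)
    show "norm (\<i> * x / 2) \<le> M" "norm (b / 2) \<le> M"
      using xR(1,2,3) R1 by (simp_all add: norm_mult norm_divide)
    have "norm (q x s) \<le> 2 * (R / 2)"
      unfolding q_def T_def S_def
      by (rule norm_tanh_sech_combination_le) (use xR in \<open>simp_all add: norm_mult norm_divide\<close>)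
    thus "norm (q x s) \<le> M" using R1 by simp
    show "norm (\<i> / 2 * T s) \<le> M" using nT[of s] R2 by (simp add: norm_mult)
    show "norm (1::complex) \<le> M" "norm (0::complex) \<le> M" using R2 by auto
  qed
  have D1: "((\<lambda>a. fourier (m a) l) has_field_derivative fourier (\<lambda>s. m a s * q a s) l) (at a)" for a
  proof -
    have "((\<lambda>x. fourier (\<lambda>s. kern (1/2) (c x) (d x) s * 1) l) has_field_derivative
           fourier (\<lambda>s. kern (1/2) (c a) (d a) s *
             (1 * (\<i> * a / 2 * of_real (tanh s) + b / 2 * of_real (inverse (cosh s))) + 0)) l) (at a)"
      by (rule has_field_derivative_fourier_kern[where M = "(norm a + norm b + 2)\<^sup>2"])
         (simp, rule c, rule d, rule DERIV_const, rule continuous_on_const, rule continuous_on_const,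
          erule bounds[OF _ refl], erule bounds[OF _ refl], erule bounds[OF _ refl],
          erule bounds[OF _ refl], erule bounds[OF _ refl], erule bounds[OF _ refl])
    thus ?thesis by (simp add: m_def q_def T_def S_def)
  qed
  have D2: "((\<lambda>a. fourier (\<lambda>s. m a s * q a s) l) has_field_derivative
              fourier (\<lambda>s. m a s * (q a s * q a s + \<i> / 2 * T s)) l) (at a)" for a
  proof -
    have "((\<lambda>x. fourier (\<lambda>s. kern (1/2) (c x) (d x) s * q x s) l) has_field_derivative
           fourier (\<lambda>s. kern (1/2) (c a) (d a) s *
             (q a s * (\<i> * a / 2 * of_real (tanh s) + b / 2 * of_real (inverse (cosh s))) + \<i> / 2 * T s)) l) (at a)"
      by (rule has_field_derivative_fourier_kern[where M = "(norm a + norm b + 2)\<^sup>2"])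
         (simp, rule c, rule d, rule q, rule cq, intro continuous_intros contT,
          erule bounds[OF _ refl], erule bounds[OF _ refl], erule bounds[OF _ refl],
          erule bounds[OF _ refl], erule bounds[OF _ refl], erule bounds[OF _ refl])
    thus ?thesis by (simp only: m_def q_def T_def S_def)
  qed
  have mehler_eq: "mehler a b = m a" for a
    by (simp add: mehler_def m_def c_def d_def)
  show ?thesis
    unfolding mehler_eq
  proof (rule entire_solutionI[OF D1 D2])
    show "fourier (m 0) l = fourier (m 0) l" ..
    \<comment> \<open>At a = 0 only the term b S / 2 of \<open>q\<close> survives, and its factor S
      raises the exponent 1/2 to 3/2.\<close>
    have "(\<lambda>s. m 0 s * q 0 s) = (\<lambda>s. b / 2 * kern (3/2) (\<i> * b\<^sup>2 / 4) 0 s)"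
      using kern_mult_sech[of "1/2" "\<i> * b\<^sup>2 / 4" 0]
      by (simp add: fun_eq_iff m_def q_def c_def d_def S_def)
    thus "fourier (\<lambda>s. m 0 s * q 0 s) l = b / 2 * fourier (kern (3/2) (\<i> * b\<^sup>2 / 4) 0) l"
      by (simp only: fourier_cmult)
  next
    fix a
    have i0: "integrable lborel (m a)" unfolding m_def by (intro integrable_kern) simp
    have qq: "norm (q a s) \<le> norm a + norm b" for s
    proof -
      have "norm (q a s) \<le> 2 * ((norm a + norm b) / 2)"
        unfolding q_def T_def S_def
        by (rule norm_tanh_sech_combination_le) (simp_all add: norm_mult norm_divide)
      thus ?thesis by simp
    qed
    have i2: "integrable lborel (\<lambda>s. m a s * (q a s * q a s + \<i> / 2 * T s))"
      unfolding m_def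
    proof (rule integrable_kern_mult)
      show "continuous_on UNIV (\<lambda>s. q a s * q a s + \<i> / 2 * T s)"
        by (intro continuous_intros cq contT)
      show "norm (q a s * q a s + \<i> / 2 * T s) \<le> (norm a + norm b) * (norm a + norm b) + 1" for s
        by (intro order.trans[OF norm_triangle_ineq] add_mono)
           (use qq[of s] nT[of s] in \<open>simp_all add: norm_mult mult_mono\<close>)
    qed simp
    \<comment> \<open>The evolution equation at a fixed s: the right-hand side is i times the
      s-derivative of the kernel.\<close>
    have eq: "- (m a s * (q a s * q a s + \<i> / 2 * T s)) - a\<^sup>2 / 4 * m a s =
              \<i> * (m a s * kern_log_deriv (1/2) (c a) (d a) s)" for s
    proof -
      have kl: "kern_log_deriv (1/2) (c a) (d a) s = - (T s / 2) + c a * (S s)\<^sup>2 - d a * (T s * S s)"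
        by (simp add: kern_log_deriv_def T_def S_def)
      \<comment> \<open>With the potential multiplied by T^2 + S^2 = 1 the T^2 terms cancel, and the
        rest is i times the logarithmic s-derivative.\<close>
      have "- (q a s * q a s + \<i> / 2 * T s) - a\<^sup>2 / 4 * ((T s)\<^sup>2 + (S s)\<^sup>2) =
            \<i> * (- (T s / 2) + c a * (S s)\<^sup>2 - d a * (T s * S s))"
        by (simp add: q_def c_def d_def power2_eq_square field_simps)
      hence "- (q a s * q a s + \<i> / 2 * T s) - a\<^sup>2 / 4 = \<i> * kern_log_deriv (1/2) (c a) (d a) s"
        unfolding TS kl by simp
      hence "m a s * (- (q a s * q a s + \<i> / 2 * T s) - a\<^sup>2 / 4) = m a s * (\<i> * kern_log_deriv (1/2) (c a) (d a) s)"
        by (rule arg_cong)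
      thus ?thesis
        by (simp only: right_diff_distrib mult_minus_right mult.left_commute[of _ "\<i>"] mult.commute[of _ "m a s"])
    qed
    have "- fourier (\<lambda>s. m a s * (q a s * q a s + \<i> / 2 * T s)) l - a\<^sup>2 / 4 * fourier (m a) l =
          fourier (\<lambda>s. - 1 * (m a s * (q a s * q a s + \<i> / 2 * T s))) l + fourier (\<lambda>s. - (a\<^sup>2 / 4) * m a s) l"
      unfolding fourier_cmult by simp
    also have "\<dots> = fourier (\<lambda>s. - 1 * (m a s * (q a s * q a s + \<i> / 2 * T s)) + - (a\<^sup>2 / 4) * m a s) l"
      by (rule fourier_add[symmetric]) (intro integrable_mult_right i0 i2)+
    also have "\<dots> = fourier (\<lambda>s. \<i> * (m a s * kern_log_deriv (1/2) (c a) (d a) s)) l"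
      by (rule arg_cong[where f = "\<lambda>f. fourier f l"]) (rule ext, subst eq[symmetric], simp)
    also have "\<dots> = of_real l * fourier (m a) l"
      unfolding fourier_cmult m_def by (subst fourier_kern_derivative) (simp_all add: mult_ac)
    finally show "- fourier (\<lambda>s. m a s * (q a s * q a s + \<i> / 2 * T s)) l - a\<^sup>2 / 4 * fourier (m a) l
        = of_real l * fourier (m a) l" .
  qed
qed

section \<open>Imaginary arguments and parity of the solutions\<close>

lemma entire_solution_has_derivs:
  assumes "entire_solution lam a b u"
  shows "(u has_field_derivative deriv u x) (at x)"
        "(deriv u has_field_derivative deriv (deriv u) x) (at x)"
  using assms holomorphic_derivI[of u UNIV x] holomorphic_derivI[of "deriv u" UNIV x]
    holomorphic_deriv[of u UNIV]
  by (auto simp: entire_solution_def)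

text \<open>Under x -> i x both the second derivative and x^2 change sign, which amounts to
  reversing the sign of the eigenvalue.\<close>

lemma entire_solution_rotate:
  assumes u: "entire_solution lam a b u"
  shows "entire_solution (- lam) a (\<i> * b) (\<lambda>x. u (\<i> * x))"
proof (rule entire_solutionI)
  note D = entire_solution_has_derivs[OF u]
  show "((\<lambda>x. u (\<i> * x)) has_field_derivative \<i> * deriv u (\<i> * x)) (at x)" for x
  proof -
    have "((\<lambda>x. u (\<i> * x)) has_field_derivative deriv u (\<i> * x) * \<i>) (at x)"
      by (rule DERIV_chain2[OF D(1) DERIV_cmult_Id])
    thus ?thesis by (simp only: mult.commute[of "deriv u (\<i> * x)" "\<i>"])
  qed
  show "((\<lambda>x. \<i> * deriv u (\<i> * x)) has_field_derivative - deriv (deriv u) (\<i> * x)) (at x)" for x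
  proof -
    have "((\<lambda>x. \<i> * deriv u (\<i> * x)) has_field_derivative \<i> * (deriv (deriv u) (\<i> * x) * \<i>)) (at x)"
      by (rule DERIV_cmult[OF DERIV_chain2[OF D(2) DERIV_cmult_Id]])
    moreover have "\<i> * (D * \<i>) = - D" for D by (simp add: complex_eq_iff)
    ultimately show ?thesis by (simp only:)
  qed
  show "- (- deriv (deriv u) (\<i> * x)) - x\<^sup>2 / 4 * u (\<i> * x) = - lam * u (\<i> * x)" for x
  proof -
    have "- deriv (deriv u) (\<i> * x) - (\<i> * x)\<^sup>2 / 4 * u (\<i> * x) = lam * u (\<i> * x)"
      using u unfolding entire_solution_def by blast
    moreover have "- (- deriv (deriv u) (\<i> * x)) - x\<^sup>2 / 4 * u (\<i> * x) =
       - (- deriv (deriv u) (\<i> * x) - (\<i> * x)\<^sup>2 / 4 * u (\<i> * x))"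
      by (simp add: power_mult_distrib)
    ultimately show ?thesis by simp
  qed
qed (use u in \<open>auto simp: entire_solution_def\<close>)

lemma entire_solution_u1: "entire_solution lam 1 0 (u1 lam)"
  unfolding u1_eq_formula by (rule entire_solution_u1_formula)

lemma entire_solution_u2: "entire_solution lam 0 1 (u2 lam)"
  unfolding u2_eq_formula by (rule entire_solution_u2_formula)

lemma u1_imaginary: "u1 lam (\<i> * x) = u1 (- lam) x"
  using entire_solution_eq_u1_u2[OF entire_solution_rotate[OF entire_solution_u1]] by simp

lemma u2_imaginary: "u2 lam (\<i> * x) = \<i> * u2 (- lam) x"
  using entire_solution_eq_u1_u2[OF entire_solution_rotate[OF entire_solution_u2]] by simp

lemma u1_even: "u1 lam (- x) = u1 lam x"
  by (simp add: u1_eq_formula u1_formula_def)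

lemma u2_odd: "u2 lam (- x) = - u2 lam x"
  by (simp add: u2_eq_formula u2_formula_def)

text \<open>By the symmetry of the kernel its transform at a = 0 is a solution in b. That solution
  has derivative 0 at b = 0, hence is a multiple of \<open>u1 l b\<close>. The derivative in a at 0
  belongs to a different kernel and stays unevaluated here.\<close>

lemma fourier_mehler_eq:
  "fourier (mehler a b) l = fourier (kern (1/2) 0 0) l * u1 l a * u1 l b
     + b / 2 * fourier (kern (3/2) (\<i> * b\<^sup>2 / 4) 0) l * u2 l a"
proof -
  have 1: "fourier (mehler a b) l = fourier (mehler 0 b) l * u1 l a
     + b / 2 * fourier (kern (3/2) (\<i> * b\<^sup>2 / 4) 0) l * u2 l a" for a b
    using entire_solution_eq_u1_u2[OF entire_solution_fourier_mehler] .
  have "fourier (mehler 0 b) l = fourier (mehler 0 0) l * u1 l b"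
    using 1[of b 0] by (simp add: mehler_commute[of 0 b])
  also have "mehler 0 0 = kern (1/2) 0 0" by (simp add: mehler_def)
  finally have "fourier (mehler 0 b) l = fourier (kern (1/2) 0 0) l * u1 l b" .
  with 1[of a b] show ?thesis by (simp add: mult_ac)
qed

text \<open>The antisymmetric part of the transform is symmetric under \<open>a \<leftrightarrow> b\<close>, which determines its dependence
  on \<open>b\<close> up to a factor; the factor is found by dividing by \<open>a\<close> and letting \<open>a \<rightarrow> 0\<close>.\<close>

lemma fourier_kern_three_halves_eq:
  "b * fourier (kern (3/2) (\<i> * b\<^sup>2 / 4) 0) l = fourier (kern (3/2) 0 0) l * u2 l b"
proof -
  define h where "h = (\<lambda>b. fourier (kern (3/2) (\<i> * b\<^sup>2 / 4) 0) l)"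
  have sym: "a * h a * u2 l b = b * h b * u2 l a" for a b
  proof -
    have 1: "fourier (mehler a b) l - fourier (mehler (- a) b) l = b * h b * u2 l a" for a b
      unfolding fourier_mehler_eq by (simp add: u1_even u2_odd h_def)
    have 2: "mehler (- a) b = mehler (- b) a"
      by (simp add: mehler_def add.commute mult.commute)
    show ?thesis using 1[of a b] 1[of b a] 2 by (simp add: mehler_commute[of b a])
  qed
  \<comment> \<open>Differentiability at 0 is derived for the sake of continuity of \<open>h\<close>
    there.\<close>
  have "((\<lambda>x. fourier (\<lambda>s. kern (3/2) (\<i> * x\<^sup>2 / 4) ((\<lambda>_. 0) x) s * 1) l) has_field_derivative
           fourier (\<lambda>s. kern (3/2) (\<i> * 0\<^sup>2 / 4) ((\<lambda>_. 0) 0) s *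
             (1 * (\<i> * 0 / 2 * of_real (tanh s) + 0 * of_real (inverse (cosh s))) + 0)) l) (at 0)"
  proof (rule has_field_derivative_fourier_kern[where M = 1 and c = "\<lambda>x. \<i> * x\<^sup>2 / 4"
        and c' = "\<lambda>x. \<i> * x / 2" and d' = "\<lambda>_. 0" and q = "\<lambda>_ _. 1" and q' = "\<lambda>_ _. 0"])
    show "((\<lambda>x. \<i> * x\<^sup>2 / 4) has_field_derivative \<i> * x / 2) (at x)" for x
      by (auto intro!: derivative_eq_intros)
    fix x :: complex assume "x \<in> ball 0 1"
    hence "norm x \<le> 1" by simp
    moreover from this have "(norm x)\<^sup>2 \<le> 1" by (simp add: power_le_one)
    ultimately show "norm (\<i> * x\<^sup>2 / 4) \<le> 1" "norm (\<i> * x / 2) \<le> 1"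
      by (auto simp: norm_mult norm_divide norm_power)
  qed auto
  from DERIV_isCont[OF this] have "isCont h 0" unfolding h_def by simp
  hence h: "(h \<longlongrightarrow> h 0) (at 0)" by (simp add: isCont_def)
  have u20: "u2 l 0 = 0" "deriv (u2 l) 0 = 1"
    using entire_solution_u2[of l] unfolding entire_solution_def by blast+
  have "(u2 l has_field_derivative 1) (at 0)"
    using entire_solution_has_derivs(1)[OF entire_solution_u2, of l 0] unfolding u20 .
  hence u2: "((\<lambda>x. u2 l x / x) \<longlongrightarrow> 1) (at 0)"
    by (simp add: has_field_derivative_iff u20)
  have "((\<lambda>x. b * h b * (u2 l x / x)) \<longlongrightarrow> b * h b * 1) (at 0)"
    by (intro tendsto_intros u2)
  moreover have "((\<lambda>x. h x * u2 l b) \<longlongrightarrow> h 0 * u2 l b) (at 0)"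
    by (intro tendsto_intros h)
  moreover have "\<forall>\<^sub>F x in at 0. b * h b * (u2 l x / x) = h x * u2 l b"
    unfolding eventually_at_filter
  proof (rule always_eventually, intro allI impI)
    fix x :: complex assume "x \<noteq> 0"
    thus "b * h b * (u2 l x / x) = h x * u2 l b" using sym[of b x] by (simp add: field_simps)
  qed
  ultimately have "((\<lambda>x. h x * u2 l b) \<longlongrightarrow> b * h b * 1) (at 0)" "((\<lambda>x. h x * u2 l b) \<longlongrightarrow> h 0 * u2 l b) (at 0)"
    by (blast intro: Lim_transform_eventually)+
  hence "b * h b * 1 = h 0 * u2 l b"
    by (rule tendsto_unique[OF trivial_limit_at])
  thus ?thesis by (simp add: h_def)
qed

definition mehler_part :: "nat \<Rightarrow> complex \<Rightarrow> complex \<Rightarrow> real \<Rightarrow> complex" where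
  "mehler_part j a b s = (if j = 1 then mehler a b s + mehler (- a) b s else mehler a b s - mehler (- a) b s) / 2"

text \<open>The 1/2 in the second case stems from the exponent a b S / 2, whose derivative in a is b
  S / 2.\<close>

definition spectral_weight :: "nat \<Rightarrow> real \<Rightarrow> complex" where
  "spectral_weight j l = (if j = 1 then fourier (kern (1/2) 0 0) l else fourier (kern (3/2) 0 0) l / 2)"

lemma integrable_mehler: "integrable lborel (mehler a b)"
  unfolding mehler_def by (intro integrable_kern) simp

lemma fourier_mehler_part_eq:
  "fourier (mehler_part j a b) l = 
     (if j = 1 then fourier (mehler a b) l + fourier (mehler (- a) b) l
      else fourier (mehler a b) l - fourier (mehler (- a) b) l) / 2"
  unfolding mehler_part_def fourier_def
  using integrable_iexp_mult[OF integrable_mehler]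
  by (auto simp: distrib_left right_diff_distrib times_divide_eq_right integrable_iexp_mult)

lemma fourier_mehler_part:
  "fourier (mehler_part j a b) l = spectral_weight j l * u_sol j l a * u_sol j l b"
proof -
  have "b / 2 * fourier (kern (3/2) (\<i> * b\<^sup>2 / 4) 0) l = fourier (kern (3/2) 0 0) l / 2 * u2 l b"
    using fourier_kern_three_halves_eq[of b l] by (simp add: field_simps)
  thus ?thesis
    unfolding fourier_mehler_part_eq fourier_mehler_eq u1_even u2_odd
    by (simp add: spectral_weight_def u_sol_def mult_ac)
qed

text \<open>For the conjugate arguments z, w = (p \<plusminus> i l) / 2 the sum is p and the
  difference is i l, so the Beta integral becomes the Fourier transform of a power of sech.\<close>

lemma Gamma_square_eq_fourier_kern:
  assumes p: "p > 0"
  shows "of_real ((norm (Gamma (of_real (p / 2) + \<i> * of_real l / 2)))\<^sup>2) =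
         of_real (2 powr (1 - p) * Gamma p) * fourier (kern p 0 0) l"
proof -
  define z where "z = of_real (p / 2) + \<i> * of_real l / 2"
  define w where "w = of_real (p / 2) - \<i> * of_real l / 2"
  have wz: "w = cnj z" by (simp add: w_def z_def)
  have zw: "z + w = of_real p" "z - w = \<i> * of_real l"
    by (simp_all add: z_def w_def)
  have "of_real ((norm (Gamma z))\<^sup>2) = Gamma z * Gamma w"
    unfolding wz by (simp only: complex_norm_square cnj_Gamma)
  also have "\<dots> = 2 * Gamma (z + w) * (LINT s|lborel. exp ((z - w) * of_real s - (z + w) * of_real (ln (2 * cosh s))))"
    by (rule Gamma_product_integral) (use p in \<open>auto simp: z_def w_def\<close>)
  also have "(\<lambda>s. exp ((z - w) * of_real s - (z + w) * of_real (ln (2 * cosh s)))) =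
      (\<lambda>s. of_real (2 powr - p) * (exp (\<i> * of_real (l * s)) * kern p 0 0 s))"
  proof
    fix s :: real
    have "exp (- of_real p * of_real (ln (2 * cosh s)) :: complex) = of_real ((2 * cosh s) powr - p)"
      using cosh_real_pos[of s] by (simp add: powr_def flip: exp_of_real)
    also have "\<dots> = of_real (2 powr - p) * kern p 0 0 s"
      using cosh_real_pos[of s] by (simp add: kern_def powr_mult)
    finally have e: "exp (- of_real p * of_real (ln (2 * cosh s)) :: complex) = of_real (2 powr - p) * kern p 0 0 s" .
    have "(z - w) * of_real s - (z + w) * of_real (ln (2 * cosh s)) =
          \<i> * of_real (l * s) + - of_real p * of_real (ln (2 * cosh s))"
      by (simp add: zw)
    thus "exp ((z - w) * of_real s - (z + w) * of_real (ln (2 * cosh s))) =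
        of_real (2 powr - p) * (exp (\<i> * of_real (l * s)) * kern p 0 0 s)"
      by (simp only: exp_add e) (simp only: mult_ac)
  qed
  also have "2 * Gamma (z + w) * (LINT s|lborel. of_real (2 powr - p) * (exp (\<i> * of_real (l * s)) * kern p 0 0 s))
      = of_real (2 * Gamma p * 2 powr - p) * fourier (kern p 0 0) l"
    unfolding zw fourier_def by (simp add: Gamma_complex_of_real)
  also have "2 * Gamma p * 2 powr - p = 2 powr (1 - p) * Gamma p"
    by (simp add: powr_diff powr_minus divide_inverse)
  finally show ?thesis unfolding z_def .
qed

text \<open>The fourth power is the square at l times the square at - l, since conjugate Gamma
  values have equal modulus. The constants (2^(1-p) Gamma p)^2 are 2 \<pi> for p = 1/2 and \<pi> / 8
  for p = 3/2; they bring 1 / (4 \<pi>^3) and 1 / \<pi>^3 to the common value 1 / (2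
  \<pi>^2).\<close>

lemma p_weight_eq_spectral_weight:
  assumes "j \<in> {1, 2}"
  shows "of_real (p_weight j l) = (if j = 1 then 1 else - 1) * spectral_weight j l * spectral_weight j (- l) / (2 * pi\<^sup>2)"
proof -
  have *: "of_real ((norm (Gamma (of_real (p / 2) + \<i> * of_real l / 2))) ^ 4) =
          of_real ((2 powr (1 - p) * Gamma p)\<^sup>2) * (fourier (kern p 0 0) l * fourier (kern p 0 0) (- l))"
    if p: "p > 0" for p
  proof -
    have "Gamma (of_real (p / 2) + \<i> * of_real (- l) / 2) = cnj (Gamma (of_real (p / 2) + \<i> * of_real l / 2))"
      unfolding cnj_Gamma by simp
    hence "norm (Gamma (of_real (p / 2) + \<i> * of_real (- l) / 2)) = norm (Gamma (of_real (p / 2) + \<i> * of_real l / 2))"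
      by simp
    with Gamma_square_eq_fourier_kern[OF p, of l] Gamma_square_eq_fourier_kern[OF p, of "- l"]
    have "of_real ((norm (Gamma (of_real (p / 2) + \<i> * of_real l / 2)))\<^sup>2 * (norm (Gamma (of_real (p / 2) + \<i> * of_real l / 2)))\<^sup>2) =
       of_real (2 powr (1 - p) * Gamma p) * fourier (kern p 0 0) l * (of_real (2 powr (1 - p) * Gamma p) * fourier (kern p 0 0) (- l))"
      by (simp only: of_real_mult)
    thus ?thesis by (simp add: power2_eq_square power4_eq_xxxx mult_ac)
  qed
  have g1: "(2 powr (1 - 1/2) * Gamma (1/2))\<^sup>2 = 2 * pi"
    by (simp add: power_mult_distrib Gamma_one_half_real powr_half_sqrt)
  have G32: "Gamma (3/2 :: real) = sqrt pi / 2"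
  proof -
    have "(1/2 :: real) \<notin> \<int>\<^sub>\<le>\<^sub>0" by (auto elim!: nonpos_Ints_cases)
    thus ?thesis using Gamma_plus1[of "1/2::real"] by (simp add: Gamma_one_half_real)
  qed
  have g2: "(2 powr (1 - 3/2) * Gamma (3/2))\<^sup>2 = pi / 8"
    by (simp add: G32 power_mult_distrib power_divide power_inverse powr_minus powr_half_sqrt)
  show ?thesis
  proof (cases "j = 1")
    case True
    have "complex_of_real (norm (Gamma (1/4 + \<i> * of_real l / 2)) ^ 4) = 2 * pi * (spectral_weight 1 l * spectral_weight 1 (- l))"
      using *[of "1/2"] unfolding g1 by (simp add: spectral_weight_def)
    thus ?thesis using True
      by (simp add: p_weight_def power2_eq_square power3_eq_cube field_simps)
  next
    case False
    with assms have "j = 2" by auto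
    moreover have "complex_of_real (norm (Gamma (3/4 + \<i> * of_real l / 2)) ^ 4) = pi / 2 * (spectral_weight 2 l * spectral_weight 2 (- l))"
      using *[of "3/2"] unfolding g2 by (simp add: spectral_weight_def)
    ultimately show ?thesis
      by (simp add: p_weight_def power2_eq_square power3_eq_cube field_simps)
  qed
qed

section \<open>The integral over the spectral parameter\<close>

lemma norm_fourier_le:
  assumes "integrable lborel f"
  shows "norm (fourier f l) \<le> (LINT s|lborel. norm (f s))"
  unfolding fourier_def
  by (rule Bochner_Integration.integral_norm_bound_integral[OF integrable_iexp_mult[OF assms] integrable_norm[OF assms]])
     (auto simp: norm_mult)

lemma borel_measurable_fourier:
  assumes [measurable]: "f \<in> borel_measurable borel"
  shows "fourier f \<in> borel_measurable borel"
  unfolding fourier_def by measurable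

text \<open>Smoothness in s gives decay in l: up to a unit factor, l times the transform is the
  transform of the derivative, which is integrable.\<close>

lemma fourier_kern_decay:
  assumes p: "p > 0"
  obtains C where "C \<ge> 0" "\<And>l. norm (fourier (kern p c d) l) \<le> C / (1 + \<bar>l\<bar>)"
proof
  define k' where "k' = (\<lambda>s. kern p c d s * kern_log_deriv p c d s)"
  define C where "C = (LINT s|lborel. norm (kern p c d s)) + (LINT s|lborel. norm (k' s))"
  have k': "integrable lborel k'"
    unfolding k'_def
    by (intro integrable_kern_mult[OF p, where M = "\<bar>p\<bar> + norm c + norm d"]
         continuous_intros norm_kern_log_deriv_le)
  show "C \<ge> 0" unfolding C_def by (intro add_nonneg_nonneg integral_nonneg) auto
  fix l
  have "norm (fourier k' l) = \<bar>l\<bar> * norm (fourier (kern p c d) l)"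
    unfolding k'_def fourier_kern_derivative[OF p] by (simp add: norm_mult)
  hence "(1 + \<bar>l\<bar>) * norm (fourier (kern p c d) l) \<le> C"
    using norm_fourier_le[OF k', of l] norm_fourier_le[OF integrable_kern[OF p], of c d l]
    unfolding C_def by (simp add: distrib_right)
  thus "norm (fourier (kern p c d) l) \<le> C / (1 + \<bar>l\<bar>)"
    by (simp add: field_simps)
qed

lemma fourier_mehler_part_decay:
  obtains C where "C \<ge> 0" "\<And>l. norm (fourier (mehler_part j a b) l) \<le> C / (1 + \<bar>l\<bar>)"
proof -
  obtain C where C: "C \<ge> 0" "\<And>l. norm (fourier (mehler a b) l) \<le> C / (1 + \<bar>l\<bar>)"
    unfolding mehler_def by (rule fourier_kern_decay) auto
  obtain D where D: "D \<ge> 0" "\<And>l. norm (fourier (mehler (- a) b) l) \<le> D / (1 + \<bar>l\<bar>)"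
    unfolding mehler_def by (rule fourier_kern_decay) auto
  show ?thesis
  proof (rule that[of "C + D"])
    fix l
    have "norm (x + y) / 2 \<le> norm x + norm y" "norm (x - y) / 2 \<le> norm x + norm y" for x y :: complex
      using norm_triangle_ineq[of x y] norm_triangle_ineq4[of x y] norm_ge_zero[of x] norm_ge_zero[of y]
      by linarith+
    hence "norm (fourier (mehler_part j a b) l) \<le> norm (fourier (mehler a b) l) + norm (fourier (mehler (- a) b) l)"
      unfolding fourier_mehler_part_eq by (simp add: norm_divide)
    thus "norm (fourier (mehler_part j a b) l) \<le> (C + D) / (1 + \<bar>l\<bar>)"
      using C(2)[of l] D(2)[of l] by (simp add: add_divide_distrib)
  qed (use C D in auto)
qed

lemma continuous_mehler_part: "continuous_on UNIV (mehler_part j a b)"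
  unfolding mehler_part_def mehler_def by (cases "j = 1") (auto intro!: continuous_intros)

lemma integrable_mehler_part: "integrable lborel (mehler_part j a b)"
  unfolding mehler_part_def using integrable_mehler by (cases "j = 1") auto

lemma bounded_mehler_part: obtains C where "\<And>s. norm (mehler_part j a b s) \<le> C"
proof -
  have "\<exists>C. \<forall>s. norm (mehler a b s) \<le> C" for a b
  proof -
    define M where "M = max (norm (\<i> * (a\<^sup>2 + b\<^sup>2) / 4)) (norm (a * b / 2))"
    have "norm (mehler a b s) \<le> exp (2 * M)" for s
    proof -
      have "norm (mehler a b s) \<le> exp (2 * M) * cosh s powr - (1/2)"
        unfolding mehler_def by (rule norm_kern_le) (auto simp: M_def)
      also have "\<dots> \<le> exp (2 * M) * 1"
        using cosh_real_ge_1[of s] by (intro mult_left_mono) (auto simp: powr_minus powr_half_sqrt inverse_le_1_iff)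
      finally show ?thesis by simp
    qed
    thus ?thesis by blast
  qed
  then obtain C D where C: "\<And>s. norm (mehler a b s) \<le> C" and D: "\<And>s. norm (mehler (- a) b s) \<le> D"
    by metis
  have "norm (mehler_part j a b s) \<le> C + D" for s
  proof -
    have "norm (x + y) / 2 \<le> norm x + norm y" "norm (x - y) / 2 \<le> norm x + norm y" for x y :: complex
      using norm_triangle_ineq[of x y] norm_triangle_ineq4[of x y] norm_ge_zero[of x] norm_ge_zero[of y]
      by linarith+
    hence "norm (mehler_part j a b s) \<le> norm (mehler a b s) + norm (mehler (- a) b s)"
      unfolding mehler_part_def by (simp add: norm_divide)
    thus ?thesis using C[of s] D[of s] by linarith
  qed
  thus ?thesis by (rule that)
qed

text \<open>Each factor is bounded by a multiple of 1 / (1 + |l|), so the product is bounded by a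
  multiple of 1 / (1 + l^2).\<close>

lemma integrable_fourier_mehler_part_mult:
  "integrable lborel (\<lambda>l. fourier (mehler_part j a a') l * fourier (mehler_part j b b') (- l))"
proof -
  obtain C where C: "C \<ge> 0" "\<And>l. norm (fourier (mehler_part j a a') l) \<le> C / (1 + \<bar>l\<bar>)"
    using fourier_mehler_part_decay[of j a a'] by blast
  obtain D where D: "D \<ge> 0" "\<And>l. norm (fourier (mehler_part j b b') l) \<le> D / (1 + \<bar>l\<bar>)"
    using fourier_mehler_part_decay[of j b b'] by blast
  have [measurable]: "fourier (mehler_part j a b) \<in> borel_measurable borel" for a b
    by (intro borel_measurable_fourier borel_measurable_continuous_onI continuous_mehler_part)
  show ?thesis
  proof (rule Bochner_Integration.integrable_bound)
    show "integrable lborel (\<lambda>l. (C * D) * inverse (1 + l\<^sup>2))"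
      using integrable_inverse_1_plus_square by (auto simp: set_integrable_def)
    show "AE l in lborel. norm (fourier (mehler_part j a a') l * fourier (mehler_part j b b') (- l))
            \<le> norm ((C * D) * inverse (1 + l\<^sup>2))"
    proof (rule AE_I2)
      fix l :: real
      have "norm (fourier (mehler_part j a a') l * fourier (mehler_part j b b') (- l))
            \<le> C / (1 + \<bar>l\<bar>) * (D / (1 + \<bar>l\<bar>))"
        unfolding norm_mult using C(2)[of l] D(2)[of "- l"] C(1) by (intro mult_mono) auto
      also have "\<dots> = (C * D) * inverse ((1 + \<bar>l\<bar>)\<^sup>2)"
        by (simp add: power2_eq_square divide_inverse)
      also have "\<dots> \<le> (C * D) * inverse (1 + l\<^sup>2)"
      proof (intro mult_left_mono le_imp_inverse_le)
        show "1 + l\<^sup>2 \<le> (1 + \<bar>l\<bar>)\<^sup>2" by (simp add: power2_eq_square algebra_simps)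
        show "0 < 1 + l\<^sup>2" using zero_le_power2[of l] by linarith
      qed (use C D in auto)
      also have "\<dots> \<le> norm ((C * D) * inverse (1 + l\<^sup>2))" unfolding real_norm_def by (rule abs_ge_self)
      finally show "norm (fourier (mehler_part j a a') l * fourier (mehler_part j b b') (- l))
            \<le> norm ((C * D) * inverse (1 + l\<^sup>2))" .
    qed
  qed measurable
qed

text \<open>The hyperbolic cosine is split into its two exponentials, so that each half is a
  \<open>kern\<close> with p = 1 and the lemmas on its transform apply.\<close>

definition Psi :: "real \<Rightarrow> real \<Rightarrow> complex" where
  "Psi A B = (LINT s|lborel. kern 1 (\<i> * of_real A) (of_real B) s + kern 1 (\<i> * of_real A) (- of_real B) s) / (2 * pi)"

text \<open>A depends on the squares of the arguments only, so the four sign combinations share it.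
  Their coefficients of S are B1, - B1, B2 and - B2, and each pair of opposite signs makes up one
  \<open>Psi\<close>.\<close>

lemma mehler_part_mult:
  fixes a a' b b' :: real
  defines "A \<equiv> (a\<^sup>2 + a'\<^sup>2 + b\<^sup>2 + b'\<^sup>2) / 4"
  assumes "j \<in> {1, 2}"
  shows "(LINT s|lborel. mehler_part j a a' s * mehler_part j b b' s) =
     pi / 2 * (Psi A ((a * a' + b * b') / 2) + (if j = 1 then 1 else -1) * Psi A ((a * a' - b * b') / 2))"
proof -
  define k where "k = (\<lambda>B s. kern 1 (\<i> * of_real A) (of_real B) s)"
  have k: "integrable lborel (k B)" for B unfolding k_def by (rule integrable_kern) simp
  have m: "mehler (of_real x) (of_real a') s * mehler (of_real y) (of_real b') s = k ((x * a' + y * b') / 2) s"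
    if "x\<^sup>2 = a\<^sup>2" "y\<^sup>2 = b\<^sup>2" for x y s
  proof -
    have "(complex_of_real x)\<^sup>2 = (complex_of_real a)\<^sup>2" "(complex_of_real y)\<^sup>2 = (complex_of_real b)\<^sup>2"
      using that by (metis of_real_power)+
    moreover have "kern (1/2 + 1/2) (\<i> * ((complex_of_real a)\<^sup>2 + (of_real a')\<^sup>2) / 4 + \<i> * ((of_real b)\<^sup>2 + (of_real b')\<^sup>2) / 4)
          (of_real x * of_real a' / 2 + of_real y * of_real b' / 2) s = k ((x * a' + y * b') / 2) s"
      unfolding k_def A_def
      by (intro arg_cong3[where f = "\<lambda>p c d. kern p c d s"]) (simp_all add: field_simps)
    ultimately show ?thesis
      unfolding mehler_def kern_mult by (simp only:)
  qed
  define B1 where "B1 = (a * a' + b * b') / 2"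
  define B2 where "B2 = (a * a' - b * b') / 2"
  define e where "e = (if j = 1 then 1 else -1 :: complex)"
  have mm: "mehler (of_real a) (of_real a') s * mehler (of_real b) (of_real b') s = k B1 s"
    "mehler (of_real a) (of_real a') s * mehler (- of_real b) (of_real b') s = k B2 s"
    "mehler (- of_real a) (of_real a') s * mehler (of_real b) (of_real b') s = k (- B2) s"
    "mehler (- of_real a) (of_real a') s * mehler (- of_real b) (of_real b') s = k (- B1) s" for s
    using m[of a b s] m[of a "-b" s] m[of "-a" b s] m[of "-a" "-b" s]
    by (simp_all add: B1_def B2_def add_ac algebra_simps minus_divide_left)
  have prod: "mehler_part j a a' s * mehler_part j b b' s =
      1 / 4 * ((k B1 s + k (- B1) s) + e * (k B2 s + k (- B2) s))" for s
    unfolding mm[symmetric] mehler_part_def e_def by (simp add: field_simps)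
  have "(LINT s|lborel. mehler_part j a a' s * mehler_part j b b' s) =
      1 / 4 * ((LINT s|lborel. k B1 s + k (- B1) s) + e * (LINT s|lborel. k B2 s + k (- B2) s))"
    unfolding prod using k by simp
  also have "\<dots> = pi / 2 * (Psi A B1 + e * Psi A B2)"
    unfolding Psi_def k_def by (simp add: field_simps)
  finally show ?thesis by (simp add: e_def B1_def B2_def)
qed

lemma integral_spectral_parameter:
  fixes \<xi> \<eta> z \<xi>0 \<eta>0 z0 k :: real
  assumes j: "j \<in> {1, 2}" and k: "k \<ge> 0"
  defines "\<sigma> \<equiv> (\<xi>\<^sup>2 + \<eta>\<^sup>2 + \<xi>0\<^sup>2 + \<eta>0\<^sup>2) / 2"
  shows "integrable lborel (\<lambda>l. integrand j \<xi> \<eta> z \<xi>0 \<eta>0 z0 k l)"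
    and "(LINT l|lborel. integrand j \<xi> \<eta> z \<xi>0 \<eta>0 z0 k l) =
      (Psi (k * \<sigma>) (k * (\<xi> * \<xi>0 + \<eta> * \<eta>0)) + (if j = 1 then 1 else -1) * Psi (k * \<sigma>) (k * (\<xi> * \<xi>0 - \<eta> * \<eta>0))) / 2
        * of_real (exp (- k * \<bar>z - z0\<bar>))"
proof -
  define r where "r = sqrt (2 * k)"
  have r: "r * r = 2 * k" using k by (simp add: r_def)
  define a where "a = r * \<xi>"
  define a' where "a' = r * \<xi>0"
  define b where "b = r * \<eta>"
  define b' where "b' = r * \<eta>0"
  define E where "E = complex_of_real (exp (- k * \<bar>z - z0\<bar>))"
  define f where "f = (\<lambda>l. fourier (mehler_part j a a') l * fourier (mehler_part j b b') (- l))"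
  have eq: "integrand j \<xi> \<eta> z \<xi>0 \<eta>0 z0 k l = E / (2 * pi\<^sup>2) * f l" for l
  proof -
    define e where "e = (if j = 1 then 1 else - 1 :: complex)"
    have ii: "(\<i> * X) * (\<i> * Y) = - (X * Y)" for X Y by (simp add: complex_eq_iff algebra_simps)
    \<comment> \<open>For j = 2 the two factors i contribute - 1, which then cancels the minus sign
      of the second weight.\<close>
    have uu: "u_sol j l (\<i> * x) * u_sol j l (\<i> * y) = e * (u_sol j (- of_real l) x * u_sol j (- of_real l) y)" for x y
      by (simp add: u_sol_def u1_imaginary u2_imaginary e_def ii)
    have ee: "e * e = 1" by (simp add: e_def)
    have "integrand j \<xi> \<eta> z \<xi>0 \<eta>0 z0 k l =
       (e * spectral_weight j l * spectral_weight j (- l) / (2 * pi\<^sup>2)) * (u_sol j l a * u_sol j l a') *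
       (u_sol j l (\<i> * b) * u_sol j l (\<i> * b')) * E"
      unfolding integrand_def p_weight_eq_spectral_weight[OF j] e_def[symmetric] r_def[symmetric]
        a_def[symmetric] a'_def[symmetric] b_def[symmetric] b'_def[symmetric] E_def[symmetric]
      by (simp only: mult_ac)
    also have "\<dots> = (e * e) * (E / (2 * pi\<^sup>2) * f l)"
      unfolding uu f_def fourier_mehler_part by (simp add: mult_ac)
    finally show ?thesis by (simp add: ee)
  qed
  have f: "integrable lborel f" unfolding f_def by (rule integrable_fourier_mehler_part_mult)
  show "integrable lborel (\<lambda>l. integrand j \<xi> \<eta> z \<xi>0 \<eta>0 z0 k l)"
    unfolding eq using f by simp
  obtain C where C: "\<And>s. norm (mehler_part j b b' s) \<le> C" using bounded_mehler_part[of j b b'] by blast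
  have "(LINT l|lborel. f l) = 2 * pi * (LINT s|lborel. mehler_part j a a' s * mehler_part j b b' s)"
    unfolding f_def
    by (rule fourier_Parseval[OF integrable_mehler_part integrable_mehler_part continuous_mehler_part C])
       (rule f[unfolded f_def])
  also have "\<dots> = pi\<^sup>2 * (Psi (k * \<sigma>) (k * (\<xi> * \<xi>0 + \<eta> * \<eta>0)) + (if j = 1 then 1 else -1) * Psi (k * \<sigma>) (k * (\<xi> * \<xi>0 - \<eta> * \<eta>0)))"
  proof -
    have "(a\<^sup>2 + a'\<^sup>2 + b\<^sup>2 + b'\<^sup>2) / 4 = (r * r) * (\<xi>\<^sup>2 + \<eta>\<^sup>2 + \<xi>0\<^sup>2 + \<eta>0\<^sup>2) / 4"
      "(a * a' + b * b') / 2 = (r * r) * (\<xi> * \<xi>0 + \<eta> * \<eta>0) / 2"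
      "(a * a' - b * b') / 2 = (r * r) * (\<xi> * \<xi>0 - \<eta> * \<eta>0) / 2"
      unfolding a_def a'_def b_def b'_def by (simp_all add: power2_eq_square algebra_simps)
    hence eqs: "(a\<^sup>2 + a'\<^sup>2 + b\<^sup>2 + b'\<^sup>2) / 4 = k * \<sigma>"
      "(a * a' + b * b') / 2 = k * (\<xi> * \<xi>0 + \<eta> * \<eta>0)" "(a * a' - b * b') / 2 = k * (\<xi> * \<xi>0 - \<eta> * \<eta>0)"
      unfolding r \<sigma>_def by simp_all
    thus ?thesis
      unfolding mehler_part_mult[OF j] eqs by (simp add: power2_eq_square)
  qed
  finally show "(LINT l|lborel. integrand j \<xi> \<eta> z \<xi>0 \<eta>0 z0 k l) =
      (Psi (k * \<sigma>) (k * (\<xi> * \<xi>0 + \<eta> * \<eta>0)) + (if j = 1 then 1 else -1) * Psi (k * \<sigma>) (k * (\<xi> * \<xi>0 - \<eta> * \<eta>0))) / 2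
        * of_real (exp (- k * \<bar>z - z0\<bar>))"
    unfolding eq integral_mult_right_zero E_def[symmetric] by simp
qed

section \<open>Reduction to the Bessel function\<close>

text \<open>With tanh s = sin \<theta> one has ds / cosh s = d\<theta>, and this becomes Bessel's
  integral of cos (r sin \<theta>) over (- \<pi> / 2, \<pi> / 2), divided by \<pi>.\<close>

definition bessel_J0 :: "real \<Rightarrow> real" where
  "bessel_J0 r = (LINT s|lborel. inverse (cosh s) * cos (r * tanh s)) / pi"

lemma kern_0_conv: "kern 0 c d s = exp (c * of_real (tanh s) + d * of_real (inverse (cosh s)))"
  by (simp add: kern_def less_imp_neq[OF cosh_real_pos, symmetric])

lemma tendsto_sech:
  "((\<lambda>s::real. inverse (cosh s)) \<longlongrightarrow> 0) at_top" "((\<lambda>s::real. inverse (cosh s)) \<longlongrightarrow> 0) at_bot"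
  using tendsto_cosh_powr[of 1] cosh_real_pos by (simp_all add: powr_minus)

text \<open>The integrand is the s-derivative of exp (c T + d S). This primitive has p = 0 and does
  not decay; its limits are taken at T = 1 and T = - 1 with S = 0.\<close>

lemma integral_kern_total:
  "(LINT s|lborel. kern 1 c d s * (c * of_real (inverse (cosh s)) - d * of_real (tanh s))) = exp c - exp (- c)"
proof (rule integral_derivative_real_line)
  have cnz: "cosh s \<noteq> 0" for s :: real using cosh_real_pos[of s] by simp
  define q where "q = (\<lambda>s. c * of_real (inverse (cosh s)) - d * of_real (tanh s))"
  have q: "continuous_on UNIV q" unfolding q_def by (intro continuous_intros) (auto simp: cnz)
  show "continuous_on UNIV (\<lambda>s. kern 1 c d s * (c * of_real (inverse (cosh s)) - d * of_real (tanh s)))"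
    using q unfolding q_def by (rule continuous_on_mult[OF continuous_kern])
  show "integrable lborel (\<lambda>s. kern 1 c d s * (c * of_real (inverse (cosh s)) - d * of_real (tanh s)))"
  proof (rule integrable_kern_mult[where M = "2 * max (norm c) (norm d)"])
    show "norm (c * of_real (inverse (cosh s)) - d * of_real (tanh s)) \<le> 2 * max (norm c) (norm d)" for s
      using norm_tanh_sech_combination_le[of "- d" "max (norm c) (norm d)" c s] by (simp add: add.commute)
  qed (use q in \<open>simp_all add: q_def\<close>)
  show "(kern 0 c d has_vector_derivative kern 1 c d s * (c * of_real (inverse (cosh s)) - d * of_real (tanh s))) (at s)" for s
  proof -
    have "kern 1 c d s * (c * of_real (inverse (cosh s)) - d * of_real (tanh s)) = kern 0 c d s * kern_log_deriv 0 c d s"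
      using kern_mult_sech[of 0 c d s, symmetric]
      by (simp add: kern_log_deriv_def power2_eq_square algebra_simps)
    thus ?thesis using has_vector_derivative_kern[of 0 c d s] by simp
  qed
  have lim: "((\<lambda>s. c * of_real (tanh s) + d * of_real (inverse (cosh s))) \<longlongrightarrow> c * of_real x + d * of_real 0) F"
    if "(tanh \<longlongrightarrow> x) F" "((\<lambda>s. inverse (cosh s)) \<longlongrightarrow> 0) F" for x :: real and F
    using that by (intro tendsto_intros)
  show "(kern 0 c d \<longlongrightarrow> exp c) at_top"
    using tendsto_exp[OF lim[OF tanh_real_at_top tendsto_sech(1)]] unfolding kern_0_conv[abs_def] by simp
  show "(kern 0 c d \<longlongrightarrow> exp (- c)) at_bot"
    using tendsto_exp[OF lim[OF tanh_real_at_bot tendsto_sech(2)]] unfolding kern_0_conv[abs_def] by simp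
qed

text \<open>Reading the integrals as transforms at frequency 0 makes the differentiation lemma for
  transforms available.\<close>

lemma Psi_eq_fourier:
  "Psi A B = (fourier (kern 1 (\<i> * of_real A) (of_real B)) 0 + fourier (kern 1 (\<i> * of_real A) (- of_real B)) 0) / (2 * pi)"
  unfolding Psi_def fourier_def using integrable_kern[of 1] by simp

lemma norm_cosh_sinh_le:
  fixes x :: complex
  shows "norm (cosh x) \<le> exp (norm x)" "norm (sinh x) \<le> exp (norm x)"
proof -
  have *: "norm (exp x) \<le> exp (norm x)" "norm (exp (- x)) \<le> exp (norm x)"
    using norm_exp[of x] norm_exp[of "- x"] by auto
  have "norm (exp x + exp (- x)) \<le> 2 * exp (norm x)" "norm (exp x - exp (- x)) \<le> 2 * exp (norm x)"
    using norm_triangle_ineq[of "exp x" "exp (- x)"] norm_triangle_ineq4[of "exp x" "exp (- x)"] * by linarith+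
  thus "norm (cosh x) \<le> exp (norm x)" "norm (sinh x) \<le> exp (norm x)"
    unfolding cosh_field_def sinh_field_def norm_divide by simp_all
qed

text \<open>The derivative of the integrand along a hyperbolic rotation is a total \<open>s\<close>-derivative. The boundary
  terms do not vanish, but they cancel between \<open>e = 1\<close> and \<open>e = - 1\<close>.\<close>

lemma fourier_kern_hyperbolic_deriv:
  assumes e: "e = 1 \<or> e = - 1"
  shows "((\<lambda>x. fourier (kern 1 (\<i> * of_real r * cosh x) (e * of_real r * sinh x)) 0) has_field_derivative
           - \<i> * e * (exp (\<i> * of_real r * cosh z) - exp (- (\<i> * of_real r * cosh z)))) (at z)"
proof -
  define M where "M = \<bar>r\<bar> * exp (norm z + 1) + 1"
  have ne: "norm e = 1" "e * e = 1" using e by auto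
  have le: "\<bar>r\<bar> * norm (cosh x) \<le> M" "\<bar>r\<bar> * norm (sinh x) \<le> M" if x: "x \<in> ball z 1" for x
  proof -
    have "norm x \<le> norm z + 1" using x norm_triangle_ineq[of z "x - z"] by (simp add: dist_norm norm_minus_commute)
    hence "exp (norm x) \<le> exp (norm z + 1)" by simp
    hence "norm (cosh x) \<le> exp (norm z + 1)" "norm (sinh x) \<le> exp (norm z + 1)"
      using norm_cosh_sinh_le[of x] by linarith+
    hence "\<bar>r\<bar> * norm (cosh x) \<le> \<bar>r\<bar> * exp (norm z + 1)" "\<bar>r\<bar> * norm (sinh x) \<le> \<bar>r\<bar> * exp (norm z + 1)"
      by (intro mult_left_mono; simp)+
    thus "\<bar>r\<bar> * norm (cosh x) \<le> M" "\<bar>r\<bar> * norm (sinh x) \<le> M" by (simp_all add: M_def)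
  qed
  define c where "c = \<i> * of_real r * cosh z"
  define d where "d = e * of_real r * sinh z"
  have "((\<lambda>x. fourier (\<lambda>s. kern 1 (\<i> * of_real r * cosh x) (e * of_real r * sinh x) s * 1) 0) has_field_derivative
           fourier (\<lambda>s. kern 1 (\<i> * of_real r * cosh z) (e * of_real r * sinh z) s *
             (1 * (\<i> * of_real r * sinh z * of_real (tanh s) + e * of_real r * cosh z * of_real (inverse (cosh s))) + 0)) 0) (at z)"
  proof (rule has_field_derivative_fourier_kern[where M = M and c = "\<lambda>x. \<i> * of_real r * cosh x"
        and c' = "\<lambda>x. \<i> * of_real r * sinh x" and d = "\<lambda>x. e * of_real r * sinh x"
        and d' = "\<lambda>x. e * of_real r * cosh x" and q = "\<lambda>_ _. 1" and q' = "\<lambda>_ _. 0"])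
    show "((\<lambda>x. \<i> * of_real r * cosh x) has_field_derivative \<i> * of_real r * sinh x) (at x)" for x
      by (auto intro!: derivative_eq_intros)
    show "((\<lambda>x. e * of_real r * sinh x) has_field_derivative e * of_real r * cosh x) (at x)" for x
      by (auto intro!: derivative_eq_intros)
    fix x assume x: "x \<in> ball z 1"
    show "norm (\<i> * of_real r * cosh x) \<le> M" "norm (\<i> * of_real r * sinh x) \<le> M"
      "norm (e * of_real r * cosh x) \<le> M" "norm (e * of_real r * sinh x) \<le> M"
      using le[OF x] by (simp_all add: norm_mult ne)
    show "norm (1::complex) \<le> M" "norm (0::complex) \<le> M" by (simp_all add: M_def)
  qed auto
  \<comment> \<open>Since e^2 = 1, the derivative of the exponent in the rotation parameter is - i e
    (c S - d T), a multiple of its s-derivative divided by S.\<close>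
  also have "(\<lambda>s. kern 1 (\<i> * of_real r * cosh z) (e * of_real r * sinh z) s *
             (1 * (\<i> * of_real r * sinh z * of_real (tanh s) + e * of_real r * cosh z * of_real (inverse (cosh s))) + 0))
      = (\<lambda>s. - \<i> * e * (kern 1 c d s * (c * of_real (inverse (cosh s)) - d * of_real (tanh s))))"
    using ne(2) e by (auto simp: c_def d_def fun_eq_iff algebra_simps)
  also have "fourier \<dots> 0 = - \<i> * e * (exp c - exp (- c))"
    unfolding fourier_cmult using integral_kern_total[of c d] by (simp add: fourier_def)
  finally show ?thesis by (simp add: c_def)
qed

lemma cosh_sinh_complex_of_real:
  "cosh (complex_of_real t) = of_real (cosh t)" "sinh (complex_of_real t) = of_real (sinh t)"
  by (simp_all add: cosh_field_def sinh_field_def flip: exp_of_real)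

lemma Psi_hyperbolic: "Psi (r * cosh t) (r * sinh t) = Psi r 0"
proof -
  define g where "g = (\<lambda>x. fourier (kern 1 (\<i> * of_real r * cosh x) (1 * of_real r * sinh x)) 0 +
      fourier (kern 1 (\<i> * of_real r * cosh x) ((- 1) * of_real r * sinh x)) 0)"
  have "(g has_field_derivative 0) (at x)" for x
  proof -
    note D = fourier_kern_hyperbolic_deriv[of 1 r x] fourier_kern_hyperbolic_deriv[of "-1" r x]
    show ?thesis unfolding g_def
      using DERIV_add[OF D(1) D(2)] by simp
  qed
  hence "g (of_real t) = g 0"
    using has_field_derivative_zero_constant[of UNIV g] by auto
  moreover have "Psi (r * cosh t) (r * sinh t) = g (of_real t) / (2 * pi)"
    unfolding Psi_eq_fourier g_def by (simp add: cosh_sinh_complex_of_real mult.assoc)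
  moreover have "Psi r 0 = g 0 / (2 * pi)" unfolding Psi_eq_fourier g_def by simp
  ultimately show ?thesis by simp
qed

lemma Psi_0_right: "Psi r 0 = of_real (bessel_J0 r)"
proof -
  have k: "kern 1 c 0 s = of_real (inverse (cosh s)) * exp (c * of_real (tanh s))" for c s
    using cosh_real_pos[of s] by (simp add: kern_def powr_minus)
  have int: "integrable lborel (kern 1 c 0)" for c by (rule integrable_kern) simp
  \<comment> \<open>The reflection s -> - s changes the sign of T only; averaging both forms leaves
    a cosine.\<close>
  have "(LINT s|lborel. kern 1 (\<i> * of_real r) 0 s) = (LINT s|lborel. kern 1 (- \<i> * of_real r) 0 s)"
    using lborel_integral_real_affine[of "-1" "kern 1 (\<i> * of_real r) 0" 0] by (simp add: k)
  hence "Psi r 0 = (LINT s|lborel. kern 1 (\<i> * of_real r) 0 s + kern 1 (- \<i> * of_real r) 0 s) / (2 * pi)"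
    unfolding Psi_def using int by simp
  also have "(\<lambda>s. kern 1 (\<i> * of_real r) 0 s + kern 1 (- \<i> * of_real r) 0 s) =
      (\<lambda>s. 2 * of_real (inverse (cosh s) * cos (r * tanh s)))"
  proof
    fix s
    have "exp (\<i> * of_real r * of_real (tanh s)) + exp (- \<i> * of_real r * of_real (tanh s)) = 2 * of_real (cos (r * tanh s))"
      by (simp add: cos_of_real[symmetric] cos_exp_eq mult.assoc)
    thus "kern 1 (\<i> * of_real r) 0 s + kern 1 (- \<i> * of_real r) 0 s = 2 * of_real (inverse (cosh s) * cos (r * tanh s))"
      unfolding k distrib_left[symmetric] by (simp only: of_real_mult mult.left_commute)
  qed
  also have "(LINT s|lborel. 2 * complex_of_real (inverse (cosh s) * cos (r * tanh s))) / (2 * pi) = of_real (bessel_J0 r)"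
  proof -
    have "(LINT s|lborel. 2 * complex_of_real (inverse (cosh s) * cos (r * tanh s))) =
          2 * of_real (LINT s|lborel. inverse (cosh s) * cos (r * tanh s))"
      unfolding integral_mult_right_zero integral_complex_of_real ..
    thus ?thesis by (simp add: bessel_J0_def)
  qed
  finally show ?thesis .
qed

lemma isCont_Psi: "isCont (\<lambda>x. Psi x B) A"
proof -
  have *: "isCont (\<lambda>x. fourier (kern 1 (\<i> * x) d) 0) z" for d z
  proof -
    define M where "M = norm z + norm d + 1"
    have "((\<lambda>x. fourier (\<lambda>s. kern 1 (\<i> * x) ((\<lambda>_. d) x) s * 1) 0) has_field_derivative
           fourier (\<lambda>s. kern 1 (\<i> * z) ((\<lambda>_. d) z) s *
             (1 * (\<i> * of_real (tanh s) + 0 * of_real (inverse (cosh s))) + 0)) 0) (at z)"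
    proof (rule has_field_derivative_fourier_kern[where M = M and c = "\<lambda>x. \<i> * x" and c' = "\<lambda>_. \<i>"
          and d' = "\<lambda>_. 0" and q = "\<lambda>_ _. 1" and q' = "\<lambda>_ _. 0"])
      show "((\<lambda>x. \<i> * x) has_field_derivative \<i>) (at x)" for x by (rule DERIV_cmult_Id)
      fix x assume x: "x \<in> ball z 1"
      show "norm (\<i> * x) \<le> M" using x norm_triangle_ineq[of z "x - z"] norm_ge_zero[of d]
        unfolding M_def norm_mult mem_ball dist_norm norm_minus_commute[of z x] by (simp del: norm_ge_zero)
    qed (auto simp: M_def)
    from DERIV_isCont[OF this] show ?thesis by simp
  qed
  have **: "isCont (\<lambda>x. fourier (kern 1 (\<i> * of_real x) d) 0) A" for d
    by (rule isCont_o2[where f = of_real and g = "\<lambda>x. fourier (kern 1 (\<i> * x) d) 0"])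
       (rule isCont_of_real[OF continuous_ident], rule *)
  show ?thesis unfolding Psi_eq_fourier by (intro continuous_intros **) auto
qed

lemma isCont_bessel_J0: "isCont bessel_J0 r"
proof -
  have "isCont (\<lambda>x. Re (Psi x 0)) r"
    using isCont_Psi[of r 0] unfolding isCont_def by (rule tendsto_Re)
  thus ?thesis by (simp add: Psi_0_right)
qed

text \<open>The light cone \<open>A = \<bar>B\<bar>\<close> is reached as a limit from inside.\<close>

lemma Psi_eq_bessel_J0:
  assumes "\<bar>B\<bar> \<le> A"
  shows "Psi A B = of_real (bessel_J0 (sqrt (A\<^sup>2 - B\<^sup>2)))"
proof -
  have eq: "Psi A B = of_real (bessel_J0 (sqrt (A\<^sup>2 - B\<^sup>2)))" if A: "\<bar>B\<bar> < A" for A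
  proof -
    define r where "r = sqrt (A\<^sup>2 - B\<^sup>2)"
    have "B\<^sup>2 < A\<^sup>2" using power_strict_mono[OF A, of 2] by simp
    hence r: "r > 0" "r\<^sup>2 = A\<^sup>2 - B\<^sup>2" by (simp_all add: r_def)
    define t where "t = arsinh (B / r)"
    have "r * sinh t = B" using r by (simp add: t_def)
    moreover have "r * cosh t = A"
    proof -
      have "(r * cosh t)\<^sup>2 = A\<^sup>2"
        using r by (simp add: power_mult_distrib t_def cosh_arsinh_real power_divide field_simps)
      thus ?thesis using A r cosh_real_pos[of t] by (simp add: power2_eq_iff_nonneg)
    qed
    ultimately show ?thesis using Psi_hyperbolic[of r t] Psi_0_right[of r] by (simp add: r_def)
  qed
  have "((\<lambda>x. Psi x B) \<longlongrightarrow> Psi A B) (at_right A)"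
    using isCont_Psi[of A B] by (simp add: isCont_def filterlim_at_split)
  moreover have "((\<lambda>x. complex_of_real (bessel_J0 (sqrt (x\<^sup>2 - B\<^sup>2)))) \<longlongrightarrow> of_real (bessel_J0 (sqrt (A\<^sup>2 - B\<^sup>2)))) (at_right A)"
    by (intro tendsto_intros isCont_tendsto_compose[OF isCont_bessel_J0])
  moreover have "eventually (\<lambda>x. Psi x B = of_real (bessel_J0 (sqrt (x\<^sup>2 - B\<^sup>2)))) (at_right A)"
    using eventually_at_right_less[of A] by eventually_elim (use assms eq in auto)
  ultimately have "((\<lambda>x. Psi x B) \<longlongrightarrow> Psi A B) (at_right A)"
    "((\<lambda>x. Psi x B) \<longlongrightarrow> of_real (bessel_J0 (sqrt (A\<^sup>2 - B\<^sup>2)))) (at_right A)"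
    by (simp_all cong: tendsto_cong)
  thus ?thesis by (rule tendsto_unique[OF trivial_limit_at_right_real])
qed

section \<open>The Laplace transform of the Bessel function\<close>

lemma integrable_sech: "integrable lborel (\<lambda>s::real. inverse (cosh s))"
  using integrable_cosh_powr[of 1] cosh_real_pos by (simp add: powr_minus)

lemma continuous_sech: "continuous_on A (\<lambda>s::real. inverse (cosh s))"
  using cosh_real_pos by (intro continuous_intros) (auto simp: less_imp_neq[symmetric])

lemma continuous_tanh_real: "continuous_on A (tanh :: real \<Rightarrow> real)"
  using cosh_real_pos by (intro continuous_intros) (auto simp: less_imp_neq[symmetric])

lemma measurable_tanh_real [measurable]: "(tanh :: real \<Rightarrow> real) \<in> borel_measurable borel"
  by (intro borel_measurable_continuous_onI continuous_tanh_real)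

lemma measurable_sech [measurable]: "(\<lambda>s::real. inverse (cosh s)) \<in> borel_measurable borel"
  by (intro borel_measurable_continuous_onI continuous_sech)

text \<open>Multiplying numerator and denominator by (cosh s)^2 and putting u = sinh s turns the
  integrand into \<zeta> / (\<zeta>^2 + R^2 u^2), whence the arctan. The second factor of the
  integrand is the Laplace transform of cos (k \<rho> T) at \<zeta>.\<close>

lemma sech_rational_integral:
  fixes \<zeta> \<rho> :: real
  assumes \<zeta>: "\<zeta> > 0"
  shows "(LINT s|lborel. inverse (cosh s) * (\<zeta> / (\<zeta>\<^sup>2 + (\<rho> * tanh s)\<^sup>2))) = pi / sqrt (\<zeta>\<^sup>2 + \<rho>\<^sup>2)"
proof -
  define R where "R = sqrt (\<zeta>\<^sup>2 + \<rho>\<^sup>2)"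
  have R: "R > 0" "R\<^sup>2 = \<zeta>\<^sup>2 + \<rho>\<^sup>2" using \<zeta> by (auto simp: R_def intro!: add_pos_nonneg)
  have pos: "\<zeta>\<^sup>2 + (\<rho> * tanh s)\<^sup>2 > 0" for s using \<zeta> by (intro add_pos_nonneg) auto
  have "(LINT s|lborel. inverse (cosh s) * (\<zeta> / (\<zeta>\<^sup>2 + (\<rho> * tanh s)\<^sup>2))) = pi / 2 / R - (- (pi / 2)) / R"
  proof (rule integral_derivative_real_line[where F = "\<lambda>s. arctan (R / \<zeta> * sinh s) / R"])
    show "((\<lambda>s. arctan (R / \<zeta> * sinh s) / R) has_vector_derivative
             inverse (cosh s) * (\<zeta> / (\<zeta>\<^sup>2 + (\<rho> * tanh s)\<^sup>2))) (at s)" for s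
    proof -
      have c: "cosh s > 0" by (rule cosh_real_pos)
      have "\<zeta>\<^sup>2 + R\<^sup>2 * (sinh s)\<^sup>2 = (cosh s)\<^sup>2 * (\<zeta>\<^sup>2 + (\<rho> * tanh s)\<^sup>2)"
      proof -
        have "cosh s * tanh s = sinh s" using c by (simp add: tanh_def)
        hence "(cosh s)\<^sup>2 * (\<zeta>\<^sup>2 + (\<rho> * tanh s)\<^sup>2) = (cosh s)\<^sup>2 * \<zeta>\<^sup>2 + \<rho>\<^sup>2 * (sinh s)\<^sup>2"
          by (simp add: power_mult_distrib distrib_left) (metis (no_types) mult.left_commute power_mult_distrib)
        thus ?thesis by (simp add: R(2) cosh_square_eq[of s] algebra_simps)
      qed
      moreover have "1 + (R / \<zeta> * sinh s)\<^sup>2 = (\<zeta>\<^sup>2 + R\<^sup>2 * (sinh s)\<^sup>2) / \<zeta>\<^sup>2"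
        using \<zeta> by (simp add: power_mult_distrib power_divide field_simps)
      ultimately have "1 + (R / \<zeta> * sinh s)\<^sup>2 = (cosh s)\<^sup>2 * (\<zeta>\<^sup>2 + (\<rho> * tanh s)\<^sup>2) / \<zeta>\<^sup>2"
        by simp
      hence "R / \<zeta> * cosh s / (1 + (R / \<zeta> * sinh s)\<^sup>2) / R = inverse (cosh s) * (\<zeta> / (\<zeta>\<^sup>2 + (\<rho> * tanh s)\<^sup>2))"
        using c \<zeta> R(1) pos[of s] by (simp add: divide_simps power2_eq_square)
      moreover have "((\<lambda>s. arctan (R / \<zeta> * sinh s) / R) has_real_derivative
             (R / \<zeta> * cosh s / (1 + (R / \<zeta> * sinh s)\<^sup>2) / R)) (at s)"
        by (auto intro!: derivative_eq_intros simp: divide_inverse)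
      ultimately show ?thesis
        by (simp only: has_real_derivative_iff_has_vector_derivative)
    qed
    show "continuous_on UNIV (\<lambda>s. inverse (cosh s) * (\<zeta> / (\<zeta>\<^sup>2 + (\<rho> * tanh s)\<^sup>2)))"
      using pos by (intro continuous_intros continuous_sech continuous_tanh_real) (auto simp: less_imp_neq[symmetric])
    show "integrable lborel (\<lambda>s. inverse (cosh s) * (\<zeta> / (\<zeta>\<^sup>2 + (\<rho> * tanh s)\<^sup>2)))"
    proof (rule Bochner_Integration.integrable_bound[OF integrable_mult_right[OF integrable_sech, of "1 / \<zeta>"]])
      show "AE s in lborel. norm (inverse (cosh s) * (\<zeta> / (\<zeta>\<^sup>2 + (\<rho> * tanh s)\<^sup>2))) \<le> norm (1 / \<zeta> * inverse (cosh s))"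
      proof (rule AE_I2)
        fix s
        have "\<zeta> / (\<zeta>\<^sup>2 + (\<rho> * tanh s)\<^sup>2) \<le> \<zeta> / \<zeta>\<^sup>2"
          using \<zeta> by (intro divide_left_mono) (auto intro!: mult_pos_pos add_pos_nonneg)
        hence "inverse (cosh s) * (\<zeta> / (\<zeta>\<^sup>2 + (\<rho> * tanh s)\<^sup>2)) \<le> inverse (cosh s) * (\<zeta> / \<zeta>\<^sup>2)"
          using inverse_cosh_bounds[of s] by (intro mult_left_mono) auto
        moreover have "0 \<le> inverse (cosh s) * (\<zeta> / (\<zeta>\<^sup>2 + (\<rho> * tanh s)\<^sup>2))"
          using inverse_cosh_bounds[of s] pos[of s] \<zeta> by auto
        ultimately show "norm (inverse (cosh s) * (\<zeta> / (\<zeta>\<^sup>2 + (\<rho> * tanh s)\<^sup>2))) \<le> norm (1 / \<zeta> * inverse (cosh s))"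
          using \<zeta> inverse_cosh_bounds[of s] by (simp add: power2_eq_square mult.commute)
      qed
    qed measurable
    have sinh_top: "filterlim (\<lambda>s::real. R / \<zeta> * sinh s) at_top at_top"
      using R \<zeta> by (intro filterlim_tendsto_pos_mult_at_top[OF tendsto_const _ sinh_real_at_top]) auto
    have sinh_bot: "filterlim (\<lambda>s::real. R / \<zeta> * sinh s) at_bot at_bot"
      using R \<zeta> by (intro filterlim_tendsto_pos_mult_at_bot[OF tendsto_const _ sinh_real_at_bot]) auto
    show "((\<lambda>s. arctan (R / \<zeta> * sinh s) / R) \<longlongrightarrow> (- (pi / 2)) / R) at_bot"
      using R by (intro tendsto_divide tendsto_const filterlim_compose[OF tendsto_arctan_at_bot sinh_bot]) auto
    show "((\<lambda>s. arctan (R / \<zeta> * sinh s) / R) \<longlongrightarrow> pi / 2 / R) at_top"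
      using R by (intro tendsto_divide tendsto_const filterlim_compose[OF tendsto_arctan_at_top sinh_top]) auto
  qed
  thus ?thesis by (simp add: R_def)
qed

lemma integral_sech: "(LINT s|lborel. inverse (cosh s)) = (pi::real)"
  using sech_rational_integral[of 1 0] by simp

lemma abs_bessel_J0_le_1: "\<bar>bessel_J0 r\<bar> \<le> 1"
proof -
  have le: "\<bar>inverse (cosh s) * cos (r * tanh s)\<bar> \<le> inverse (cosh s)" for s
    using inverse_cosh_bounds[of s] by (auto simp: abs_mult mult_left_le)
  have "\<bar>LINT s|lborel. inverse (cosh s) * cos (r * tanh s)\<bar> \<le> (LINT s|lborel. inverse (cosh s) :: real)"
    unfolding real_norm_def[symmetric]
    by (rule Bochner_Integration.integral_norm_bound_integral
         [OF Bochner_Integration.integrable_bound[OF integrable_sech] integrable_sech])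
       (use le inverse_cosh_bounds in \<open>auto simp: abs_of_pos\<close>)
  thus ?thesis unfolding bessel_J0_def integral_sech by simp
qed

lemma continuous_bessel_J0: "continuous_on A bessel_J0"
  using isCont_bessel_J0 by (simp add: continuous_at_imp_continuous_on)

section \<open>Truncated Laplace integrals\<close>

lemma integral_exp_cos:
  fixes \<zeta> \<omega> K :: real
  assumes K: "K \<ge> 0" and nz: "\<zeta>\<^sup>2 + \<omega>\<^sup>2 \<noteq> 0"
  shows "(LINT k|lborel. indicator {0..K} k *\<^sub>R (exp (- (k * \<zeta>)) * cos (k * \<omega>))) =
           (\<zeta> + exp (- (K * \<zeta>)) * (\<omega> * sin (K * \<omega>) - \<zeta> * cos (K * \<omega>))) / (\<zeta>\<^sup>2 + \<omega>\<^sup>2)"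
proof -
  define F where "F = (\<lambda>k. exp (- (k * \<zeta>)) * (\<omega> * sin (k * \<omega>) - \<zeta> * cos (k * \<omega>)) / (\<zeta>\<^sup>2 + \<omega>\<^sup>2))"
  have "(LINT k|lborel. indicator {0..K} k *\<^sub>R (exp (- (k * \<zeta>)) * cos (k * \<omega>))) = F K - F 0"
  proof (rule integral_FTC_Icc[OF K])
    fix k
    have "(F has_real_derivative (exp (- (k * \<zeta>)) * cos (k * \<omega>) * (\<zeta>\<^sup>2 + \<omega>\<^sup>2)) / (\<zeta>\<^sup>2 + \<omega>\<^sup>2)) (at k within {0..K})"
      unfolding F_def
      by (intro DERIV_cdivide) (auto intro!: derivative_eq_intros simp: algebra_simps power2_eq_square)
    thus "(F has_vector_derivative exp (- (k * \<zeta>)) * cos (k * \<omega>)) (at k within {0..K})"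
      unfolding nonzero_mult_div_cancel_right[OF nz] has_real_derivative_iff_has_vector_derivative .
  qed (intro continuous_intros)
  thus ?thesis by (simp add: F_def add_divide_distrib)
qed

text \<open>Over a bounded range of k the double integral converges absolutely even for \<zeta> = 0,
  so Fubini applies. The limit of K to infinity is postponed to the s-integral.\<close>

lemma integral_bessel_J0_Icc:
  fixes \<zeta> \<rho> K :: real
  assumes K: "K \<ge> 0" and nz: "\<zeta> > 0 \<or> (\<zeta> = 0 \<and> \<rho> \<noteq> 0)"
  shows "integral {0..K} (\<lambda>k. bessel_J0 (k * \<rho>) * exp (- (k * \<zeta>))) =
    (LINT s|lborel. inverse (cosh s) * ((\<zeta> + exp (- (K * \<zeta>)) *
       (\<rho> * tanh s * sin (K * (\<rho> * tanh s)) - \<zeta> * cos (K * (\<rho> * tanh s)))) / (\<zeta>\<^sup>2 + (\<rho> * tanh s)\<^sup>2))) / pi"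
proof -
  define f where "f = (\<lambda>k. bessel_J0 (k * \<rho>) * exp (- (k * \<zeta>)))"
  have cf: "continuous_on {0..K} f"
    unfolding f_def by (intro continuous_intros continuous_on_compose2[OF continuous_bessel_J0[of UNIV]]) auto
  define H where "H = (\<lambda>k s. indicator {0..K} k *\<^sub>R (exp (- (k * \<zeta>)) * (inverse (cosh s) * cos (k * \<rho> * tanh s))))"
  have int: "integrable (lborel \<Otimes>\<^sub>M lborel) (case_prod H)"
  proof (rule Bochner_Integration.integrable_bound)
    have ind: "integrable lborel (indicator {0..K} :: real \<Rightarrow> real)"
      by (rule integrable_real_indicator) (auto simp: emeasure_lborel_Icc_eq)
    define g where "g = (\<lambda>k s. indicator {0..K} k * inverse (cosh s) :: real)"
    show "integrable (lborel \<Otimes>\<^sub>M lborel) (case_prod g)"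
    proof (rule lborel_pair.Fubini_integrable)
      show "case_prod g \<in> borel_measurable (lborel \<Otimes>\<^sub>M lborel)" unfolding g_def by measurable
      have "norm (g k s) = indicator {0..K} k * inverse (cosh s)" for k s
        using inverse_cosh_bounds[of s] by (auto simp: g_def indicator_def)
      thus "integrable lborel (\<lambda>k. LINT s|lborel. norm (case_prod g (k, s)))" using ind by simp
      show "AE k in lborel. integrable lborel (\<lambda>s. case_prod g (k, s))"
        using integrable_sech by (simp add: g_def)
    qed
    show "case_prod H \<in> borel_measurable (lborel \<Otimes>\<^sub>M lborel)" unfolding H_def by measurable
    have "norm (H k s) \<le> norm (g k s)" for k s
    proof (cases "k \<in> {0..K}")
      case True
      hence "exp (- (k * \<zeta>)) \<le> 1" using nz by auto
      hence "exp (- (k * \<zeta>)) * (inverse (cosh s) * \<bar>cos (k * \<rho> * tanh s)\<bar>) \<le> 1 * (inverse (cosh s) * 1)"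
        using inverse_cosh_bounds[of s] by (intro mult_mono) (auto intro!: mult_nonneg_nonneg)
      thus ?thesis using True inverse_cosh_bounds[of s] by (simp add: H_def g_def abs_mult abs_of_pos)
    qed (simp add: H_def)
    thus "AE x in lborel \<Otimes>\<^sub>M lborel. norm (case_prod H x) \<le> norm (case_prod g x)" by auto
  qed
  have "integral {0..K} f = (LINT k|lborel. indicator {0..K} k *\<^sub>R f k)"
    using set_borel_integral_eq_integral(2)[OF borel_integrable_atLeastAtMost'[OF cf]]
    by (simp add: set_lebesgue_integral_def)
  also have "\<dots> = (LINT k|lborel. (LINT s|lborel. H k s) / pi)"
    unfolding H_def f_def bessel_J0_def by (intro Bochner_Integration.integral_cong) auto
  also have "\<dots> = (LINT s|lborel. LINT k|lborel. H k s) / pi"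
    using lborel_pair.Fubini_integral[OF int] by simp
  also have "(LINT s|lborel. LINT k|lborel. H k s) = (LINT s|lborel. inverse (cosh s) * ((\<zeta> + exp (- (K * \<zeta>)) *
       (\<rho> * tanh s * sin (K * (\<rho> * tanh s)) - \<zeta> * cos (K * (\<rho> * tanh s)))) / (\<zeta>\<^sup>2 + (\<rho> * tanh s)\<^sup>2)))"
  proof (rule integral_cong_AE)
    show "AE s in lborel. (LINT k|lborel. H k s) = inverse (cosh s) * ((\<zeta> + exp (- (K * \<zeta>)) *
       (\<rho> * tanh s * sin (K * (\<rho> * tanh s)) - \<zeta> * cos (K * (\<rho> * tanh s)))) / (\<zeta>\<^sup>2 + (\<rho> * tanh s)\<^sup>2))"
      using AE_lborel_singleton[of 0]
    proof (rule AE_mp, intro AE_I2 impI)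
      \<comment> \<open>For \<zeta> = 0 the denominator vanishes at s = 0, so the closed form is
        used off this null set.\<close>
      fix s :: real assume "s \<noteq> 0"
      hence nz': "\<zeta>\<^sup>2 + (\<rho> * tanh s)\<^sup>2 \<noteq> 0" using nz by (auto simp: sum_power2_eq_zero_iff)
      have "(LINT k|lborel. H k s) = (LINT k|lborel. inverse (cosh s) * (indicator {0..K} k *\<^sub>R (exp (- (k * \<zeta>)) * cos (k * (\<rho> * tanh s)))))"
        unfolding H_def by (intro Bochner_Integration.integral_cong) (auto simp: mult_ac)
      thus "(LINT k|lborel. H k s) = inverse (cosh s) * ((\<zeta> + exp (- (K * \<zeta>)) *
       (\<rho> * tanh s * sin (K * (\<rho> * tanh s)) - \<zeta> * cos (K * (\<rho> * tanh s)))) / (\<zeta>\<^sup>2 + (\<rho> * tanh s)\<^sup>2))"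
        unfolding integral_mult_right_zero integral_exp_cos[OF K nz'] .
    qed
    show "(\<lambda>s. LINT k|lborel. H k s) \<in> borel_measurable lborel" unfolding H_def by measurable
  qed measurable
  finally show ?thesis by (simp add: f_def)
qed

text \<open>A box containing a large ball meets \<open>{a..}\<close> in an interval
  \<open>{a..v}\<close> with v large, so the integral over the box is one of the truncated
  integrals.\<close>

lemma has_integral_improper_atLeast:
  fixes f :: "real \<Rightarrow> 'a::euclidean_space"
  assumes f: "\<And>b. b \<ge> a \<Longrightarrow> f integrable_on {a..b}"
    and lim: "((\<lambda>b. integral {a..b} f) \<longlongrightarrow> L) at_top"
  shows "(f has_integral L) {a..}"
  unfolding has_integral'[of f]
proof (intro allI impI)
  fix e :: real assume "e > 0"
  from tendstoD[OF lim this] obtain B0 where B0: "\<And>b. b \<ge> B0 \<Longrightarrow> dist (integral {a..b} f) L < e"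
    by (auto simp: eventually_at_top_linorder)
  define B where "B = max B0 (\<bar>a\<bar> + 1)"
  show "\<exists>B>0. \<forall>u v. ball 0 B \<subseteq> cbox u v \<longrightarrow>
          (\<exists>z. ((\<lambda>x. if x \<in> {a..} then f x else 0) has_integral z) (cbox u v) \<and> norm (z - L) < e)"
  proof (intro exI[of _ B] conjI allI impI)
    show "B > 0" by (simp add: B_def)
    fix u v :: real assume sub: "ball 0 B \<subseteq> cbox u v"
    have uv: "u \<le> - b \<and> b \<le> v" if "0 \<le> b" "b < B" for b
    proof -
      have "b \<in> ball 0 B" "- b \<in> ball 0 B" using that by auto
      hence "b \<in> cbox u v" "- b \<in> cbox u v" using subsetD[OF sub] by blast+
      thus ?thesis by simp
    qed
    \<comment> \<open>The ball is open, so membership is available for b < B only; B itself is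
      reached by density.\<close>
    have v: "v \<ge> B"
      by (rule dense_le_bounded[OF \<open>B > 0\<close>]) (use uv in auto)
    have "\<bar>a\<bar> < B" by (simp add: B_def)
    hence u: "u \<le> a" using uv[of "\<bar>a\<bar>"] by linarith
    have "v \<ge> a" using v by (auto simp: B_def)
    have eq: "{a..} \<inter> cbox u v = {a..v}" using u by auto
    have "(f has_integral integral {a..v} f) {a..v}"
      using f[OF \<open>v \<ge> a\<close>] by (rule integrable_integral)
    hence "((\<lambda>x. if x \<in> {a..} then f x else 0) has_integral integral {a..v} f) (cbox u v)"
      unfolding has_integral_restrict_Int eq .
    moreover have "norm (integral {a..v} f - L) < e"
      using B0[of v] v by (simp add: B_def dist_norm)
    ultimately show "\<exists>z. ((\<lambda>x. if x \<in> {a..} then f x else 0) has_integral z) (cbox u v) \<and> norm (z - L) < e"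
      by blast
  qed
qed

text \<open>Integration by parts against the phase M tanh s, whose derivative M S^2 has no zeros;
  \<open>v\<close> is the amplitude divided by S^2. Since \<open>v\<close> grows exponentially, the
  estimate is confined to a compact interval and C depends on n.\<close>

lemma Riemann_Lebesgue_tanh_compact:
  fixes n :: real
  assumes n: "n \<ge> 0"
  obtains C where "\<And>M. M > 0 \<Longrightarrow>
    \<bar>LINT s|lborel. indicator {-n..n} s *\<^sub>R (sin (M * tanh s) * (tanh (s / 2) * inverse (cosh s)))\<bar> \<le> C / M"
proof -
  define v where "v = (\<lambda>s::real. tanh (s / 2) * cosh s)"
  define v' where "v' = (\<lambda>s::real. (inverse (cosh (s / 2)))\<^sup>2 / 2 * cosh s + tanh (s / 2) * sinh s)"
  have v: "(v has_real_derivative v' s) (at s)" for s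
  proof -
    have "((\<lambda>s. tanh (s / 2)) has_real_derivative (inverse (cosh (s / 2)))\<^sup>2 * (1 / 2)) (at s)"
      by (rule DERIV_chain2[OF has_real_derivative_tanh]) (auto intro!: derivative_eq_intros)
    moreover have "(cosh has_real_derivative sinh s) (at s)" by (auto intro!: derivative_eq_intros)
    ultimately have "((\<lambda>s. tanh (s / 2) * cosh s) has_real_derivative
        (inverse (cosh (s / 2)))\<^sup>2 * (1 / 2) * cosh s + sinh s * tanh (s / 2)) (at s)"
      by (rule DERIV_mult)
    thus ?thesis unfolding v_def v'_def by (simp add: mult_ac)
  qed
  have cosh_nz: "cosh s \<noteq> 0" for s :: real using cosh_real_pos[of s] by simp
  have cv': "continuous_on A v'" for A
    unfolding v'_def by (intro continuous_intros) (auto simp: cosh_nz)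
  define D where "D = (LINT s|lborel. indicator {-n..n} s *\<^sub>R \<bar>v' s\<bar>)"
  define C where "C = D + \<bar>v n\<bar> + \<bar>v (- n)\<bar>"
  show ?thesis
  proof (rule that[of C])
    fix M :: real assume M: "M > 0"
    define q where "q = (\<lambda>s. sin (M * tanh s) * (tanh (s / 2) * inverse (cosh s)))"
    have cq: "continuous_on A q" for A
      unfolding q_def by (intro continuous_intros) (auto simp: cosh_nz)
    have cvc: "continuous_on A (\<lambda>s. v' s * cos (M * tanh s))" for A
      by (intro continuous_intros cv') (auto simp: cosh_nz)
    have i1: "integrable lborel (\<lambda>s. indicator {-n..n} s *\<^sub>R q s)"
      using borel_integrable_atLeastAtMost'[OF cq] by (simp add: set_integrable_def)
    have i2: "integrable lborel (\<lambda>s. indicator {-n..n} s *\<^sub>R (v' s * cos (M * tanh s)))"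
      using borel_integrable_atLeastAtMost'[OF cvc] by (simp add: set_integrable_def)
    have i3: "integrable lborel (\<lambda>s. indicator {-n..n} s *\<^sub>R \<bar>v' s\<bar>)"
      using borel_integrable_atLeastAtMost'[OF continuous_on_rabs[OF cv']] by (simp add: set_integrable_def)
    have "(LINT s|lborel. indicator {-n..n} s *\<^sub>R (v' s * cos (M * tanh s) - M * q s)) =
          v n * cos (M * tanh n) - v (- n) * cos (M * tanh (- n))"
    proof (rule integral_FTC_Icc)
      show "((\<lambda>s. v s * cos (M * tanh s)) has_vector_derivative v' s * cos (M * tanh s) - M * q s) (at s within {-n..n})" for s
      proof -
        have "((\<lambda>s. cos (M * tanh s)) has_real_derivative - sin (M * tanh s) * (M * (inverse (cosh s))\<^sup>2)) (at s)"
          by (rule DERIV_chain2[OF DERIV_cos DERIV_cmult[OF has_real_derivative_tanh]])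
        from DERIV_mult[OF v this]
        have "((\<lambda>s. v s * cos (M * tanh s)) has_real_derivative
            v' s * cos (M * tanh s) + - sin (M * tanh s) * (M * (inverse (cosh s))\<^sup>2) * v s) (at s)" .
        moreover have "v s * (inverse (cosh s))\<^sup>2 = tanh (s / 2) * inverse (cosh s)"
          using cosh_nz[of s] by (simp add: v_def power2_eq_square field_simps)
        moreover have "- sin (M * tanh s) * (M * (inverse (cosh s))\<^sup>2) * v s =
            - (M * (sin (M * tanh s) * (v s * (inverse (cosh s))\<^sup>2)))"
          by (simp add: mult_ac)
        ultimately have "((\<lambda>s. v s * cos (M * tanh s)) has_real_derivative v' s * cos (M * tanh s) - M * q s) (at s)"
          by (simp only: q_def diff_conv_add_uminus)
        thus ?thesis
          by (simp add: has_real_derivative_iff_has_vector_derivative has_vector_derivative_at_within)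
      qed
      show "continuous_on {-n..n} (\<lambda>s. v' s * cos (M * tanh s) - M * q s)"
        by (intro continuous_intros cvc cq)
    qed (use n in auto)
    moreover have "(\<lambda>s. indicator {-n..n} s *\<^sub>R (v' s * cos (M * tanh s) - M * q s)) =
        (\<lambda>s. indicator {-n..n} s *\<^sub>R (v' s * cos (M * tanh s)) - M * (indicator {-n..n} s *\<^sub>R q s))"
      by (simp add: fun_eq_iff algebra_simps)
    ultimately have "M * (LINT s|lborel. indicator {-n..n} s *\<^sub>R q s) =
        (LINT s|lborel. indicator {-n..n} s *\<^sub>R (v' s * cos (M * tanh s)))
          - (v n * cos (M * tanh n) - v (- n) * cos (M * tanh (- n)))"
      using i1 i2 by simp
    moreover have "\<bar>LINT s|lborel. indicator {-n..n} s *\<^sub>R (v' s * cos (M * tanh s))\<bar> \<le> D"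
      unfolding D_def real_norm_def[symmetric]
      by (rule Bochner_Integration.integral_norm_bound_integral[OF i2])
         (use i3 in \<open>auto simp: indicator_def abs_mult mult_left_le\<close>)
    moreover have "\<bar>v n * cos (M * tanh n)\<bar> \<le> \<bar>v n\<bar>" "\<bar>v (- n) * cos (M * tanh (- n))\<bar> \<le> \<bar>v (- n)\<bar>"
      by (simp_all add: abs_mult mult_left_le)
    ultimately have "\<bar>M * (LINT s|lborel. indicator {-n..n} s *\<^sub>R q s)\<bar> \<le> C"
      unfolding C_def by linarith
    thus "\<bar>LINT s|lborel. indicator {-n..n} s *\<^sub>R (sin (M * tanh s) * (tanh (s / 2) * inverse (cosh s)))\<bar> \<le> C / M"
      using M by (simp add: q_def abs_mult field_simps)
  qed
qed

lemma Riemann_Lebesgue_tanh: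
  "integrable lborel (\<lambda>s::real. sin (M * tanh s) * (tanh (s / 2) * inverse (cosh s)))"
  "((\<lambda>M. LINT s|lborel. sin (M * tanh s) * (tanh (s / 2) * inverse (cosh s))) \<longlongrightarrow> (0::real)) at_top"
proof -
  define q where "q = (\<lambda>M s. sin (M * tanh s) * (tanh (s / 2) * inverse (cosh s)) :: real)"
  have cosh_nz: "cosh s \<noteq> 0" for s :: real using cosh_real_pos[of s] by simp
  have q_meas[measurable]: "q M \<in> borel_measurable borel" for M
    unfolding q_def by (intro borel_measurable_continuous_onI continuous_intros) (auto simp: cosh_nz)
  have q_le: "\<bar>q M s\<bar> \<le> inverse (cosh s)" for M s
  proof -
    have "\<bar>q M s\<bar> \<le> 1 * (1 * inverse (cosh s))"
      unfolding q_def abs_mult using inverse_cosh_bounds[of s] abs_tanh_le_1[of "s / 2"]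
      by (intro mult_mono) auto
    thus ?thesis by simp
  qed
  have iq: "integrable lborel (q M)" for M
    by (rule Bochner_Integration.integrable_bound[OF integrable_sech]) (use q_le in \<open>auto intro!: AE_I2 order.trans[OF _ abs_ge_self]\<close>)
  thus "integrable lborel (\<lambda>s. sin (M * tanh s) * (tanh (s / 2) * inverse (cosh s)))" unfolding q_def .
  \<comment> \<open>The mass of sech outside [-n, n] bounds the tails for all M at once, so n can be
    fixed before M tends to infinity.\<close>
  define a where "a = (\<lambda>n::nat. LINT s|lborel. inverse (cosh s) - indicator {- real n..real n} s *\<^sub>R inverse (cosh s) :: real)"
  have "a \<longlonglongrightarrow> (LINT s::real|lborel. 0)"
    unfolding a_def
  proof (rule integral_dominated_convergence[OF _ _ integrable_sech])
    show "AE s in lborel. (\<lambda>n. inverse (cosh s) - indicator {- real n..real n} s *\<^sub>R inverse (cosh s) :: real) \<longlonglongrightarrow> 0"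
    proof (rule AE_I2)
      fix s :: real
      have "eventually (\<lambda>n. real n \<ge> \<bar>s\<bar>) sequentially" by real_asymp
      hence "eventually (\<lambda>n. inverse (cosh s) - indicator {- real n..real n} s *\<^sub>R inverse (cosh s) = (0::real)) sequentially"
        by eventually_elim (auto simp: indicator_def)
      thus "(\<lambda>n. inverse (cosh s) - indicator {- real n..real n} s *\<^sub>R inverse (cosh s) :: real) \<longlonglongrightarrow> 0"
        by (rule tendsto_eventually)
    qed
    show "AE s in lborel. norm (inverse (cosh s) - indicator {- real n..real n} s *\<^sub>R inverse (cosh s) :: real) \<le> inverse (cosh s)" for n
      using inverse_cosh_bounds by (auto simp: indicator_def less_imp_le)
  qed auto
  hence a: "a \<longlonglongrightarrow> 0" by simp
  have "((\<lambda>M. LINT s|lborel. q M s) \<longlongrightarrow> 0) at_top"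
  proof (rule tendstoI)
    fix e :: real assume e: "e > 0"
    have "eventually (\<lambda>n. dist (a n) 0 < e / 2) sequentially" using tendstoD[OF a, of "e / 2"] e by simp
    then obtain n where n: "\<bar>a n\<bar> < e / 2" by (auto simp: eventually_sequentially dist_real_def)
    obtain C where C: "\<And>M. M > 0 \<Longrightarrow> \<bar>LINT s|lborel. indicator {- real n..real n} s *\<^sub>R q M s\<bar> \<le> C / M"
      using Riemann_Lebesgue_tanh_compact[of "real n"] unfolding q_def by auto
    have ev: "eventually (\<lambda>M. C / M < e / 2) at_top"
    proof -
      have "((\<lambda>M. C / M) \<longlongrightarrow> 0) at_top" by real_asymp
      thus ?thesis using e by (auto dest!: order_tendstoD(2)[of _ _ _ "e / 2"])
    qed
    have qi: "integrable lborel (\<lambda>s. indicator {- real n..real n} s *\<^sub>R q M s)" for M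
      using iq[of M] by (intro integrable_mult_indicator) auto
    have si: "integrable lborel (\<lambda>s::real. indicator {- real n..real n} s *\<^sub>R inverse (cosh s) :: real)"
      using integrable_sech by (intro integrable_mult_indicator) auto
    have tail: "\<bar>(LINT s|lborel. q M s) - (LINT s|lborel. indicator {- real n..real n} s *\<^sub>R q M s)\<bar> \<le> a n" for M
    proof -
      have "(LINT s|lborel. q M s) - (LINT s|lborel. indicator {- real n..real n} s *\<^sub>R q M s) =
            (LINT s|lborel. q M s - indicator {- real n..real n} s *\<^sub>R q M s)"
        using iq qi by simp
      also have "\<bar>\<dots>\<bar> \<le> a n"
        unfolding a_def real_norm_def[symmetric]
        by (rule Bochner_Integration.integral_norm_bound_integral)
           (use iq qi si integrable_sech q_le in \<open>auto simp: indicator_def\<close>)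
      finally show ?thesis .
    qed
    from ev eventually_gt_at_top[of 0] show "eventually (\<lambda>M. dist (LINT s|lborel. q M s) 0 < e) at_top"
    proof eventually_elim
      case (elim M)
      thus ?case using tail[of M] C[of M] n unfolding dist_real_def by linarith
    qed
  qed
  thus "((\<lambda>M. LINT s|lborel. sin (M * tanh s) * (tanh (s / 2) * inverse (cosh s))) \<longlongrightarrow> (0::real)) at_top"
    unfolding q_def .
qed

text \<open>\<open>1 / sinh s = S\<^sup>2 / T + tanh (s / 2) S\<close>: the first summand is a derivative of the sine integral, the
  second one is integrable, so the Riemann-Lebesgue argument applies to it.\<close>

lemma tendsto_integral_sin_tanh:
  "((\<lambda>M. LINT s|lborel. sin (M * tanh s) / sinh s) \<longlongrightarrow> pi) at_top"
proof -
  define q where "q = (\<lambda>M s. sin (M * tanh s) * (tanh (s / 2) * inverse (cosh s)) :: real)"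
  \<comment> \<open>\<open>sinc\<close> fills the removable singularity at s = 0 that division by
    tanh s would leave, so \<open>g M\<close> is continuous as the fundamental theorem
    requires.\<close>
  define g where "g = (\<lambda>M s. sinc (M * tanh s) * (M * (inverse (cosh s))\<^sup>2))"
  have cg: "continuous_on UNIV (g M)" for M
    unfolding g_def
    by (intro continuous_intros continuous_sech continuous_on_compose2[OF continuous_at_imp_continuous_on[of UNIV sinc]]
          continuous_tanh_real) (auto intro: isCont_sinc)
  have sinc_le: "\<bar>sinc x\<bar> \<le> 1" for x
    using abs_sin_x_le_abs_x[of x] by (auto simp: field_simps)
  have g_le: "\<bar>g M s\<bar> \<le> \<bar>M\<bar> * inverse (cosh s)" for M s
  proof -
    have "(inverse (cosh s))\<^sup>2 \<le> inverse (cosh s)" 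
      using inverse_cosh_bounds[of s] by (simp add: power2_eq_square mult_left_le)
    hence "\<bar>M * (inverse (cosh s))\<^sup>2\<bar> \<le> \<bar>M\<bar> * inverse (cosh s)"
      by (simp add: abs_mult mult_left_mono)
    hence "\<bar>sinc (M * tanh s)\<bar> * \<bar>M * (inverse (cosh s))\<^sup>2\<bar> \<le> 1 * (\<bar>M\<bar> * inverse (cosh s))"
      by (intro mult_mono[OF sinc_le]) simp_all
    hence "\<bar>g M s\<bar> \<le> 1 * (\<bar>M\<bar> * inverse (cosh s))"
      unfolding g_def abs_mult[of "sinc _"] .
    thus ?thesis by simp
  qed
  have ig: "integrable lborel (g M)" for M
    by (rule Bochner_Integration.integrable_bound[OF integrable_mult_right[OF integrable_sech, of "\<bar>M\<bar>"]])
       (use g_le[of M] borel_measurable_continuous_onI[OF cg] in \<open>auto intro!: AE_I2 order.trans[OF _ abs_ge_self]\<close>)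
  have int_g: "(LINT s|lborel. g M s) = Si M - Si (- M)" for M
  proof (rule integral_derivative_real_line[OF _ cg ig])
    show "((\<lambda>s. Si (M * tanh s)) has_vector_derivative g M s) (at s)" for s
      using DERIV_chain2[OF DERIV_Si DERIV_cmult[OF has_real_derivative_tanh], of M s]
      by (simp add: g_def has_real_derivative_iff_has_vector_derivative)
    have "((\<lambda>s. Si (M * tanh s)) \<longlongrightarrow> Si (M * 1)) at_top"
      by (intro isCont_tendsto_compose[OF isCont_Si] tendsto_intros tanh_real_at_top)
    thus "((\<lambda>s. Si (M * tanh s)) \<longlongrightarrow> Si M) at_top" by simp
    have "((\<lambda>s. Si (M * tanh s)) \<longlongrightarrow> Si (M * -1)) at_bot"
      by (intro isCont_tendsto_compose[OF isCont_Si] tendsto_intros tanh_real_at_bot)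
    thus "((\<lambda>s. Si (M * tanh s)) \<longlongrightarrow> Si (- M)) at_bot" by simp
  qed
  have iq: "integrable lborel (q M)" for M using Riemann_Lebesgue_tanh(1) unfolding q_def .
  have eq: "(LINT s|lborel. sin (M * tanh s) / sinh s) = 2 * Si M + (LINT s|lborel. q M s)" if M: "M > 0" for M
  proof -
    have "(LINT s|lborel. sin (M * tanh s) / sinh s) = (LINT s|lborel. g M s + q M s)"
    proof (rule integral_cong_AE)
      show "AE s in lborel. sin (M * tanh s) / sinh s = g M s + q M s"
        using AE_lborel_singleton[of 0]
      proof (rule AE_mp, intro AE_I2 impI)
        \<comment> \<open>At s = 0 the quotient is 0 by the convention x / 0 = 0, whereas g M 0 = M;
          the equality holds almost everywhere.\<close>
        fix s :: real assume s: "s \<noteq> 0"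
        define x where "x = s / 2"
        define c where "c = cosh x"
        define h where "h = sinh x"
        have c: "c > 0" unfolding c_def by (rule cosh_real_pos)
        have "h \<noteq> 0" using s by (simp add: h_def x_def)
        moreover have "c\<^sup>2 = h\<^sup>2 + 1" unfolding c_def h_def by (rule cosh_square_eq)
        moreover have "c\<^sup>2 + h\<^sup>2 \<noteq> 0" using c by (simp add: sum_power2_eq_zero_iff)
        ultimately have nz: "h \<noteq> 0" "c \<noteq> 0" "c\<^sup>2 + h\<^sup>2 \<noteq> 0" "c\<^sup>2 = h\<^sup>2 + 1"
          using c by simp_all
        have sc: "sinh s = 2 * h * c" "cosh s = c\<^sup>2 + h\<^sup>2" "tanh (s / 2) = h / c"
          using sinh_double[of x] cosh_double[of x] by (simp_all add: h_def c_def x_def tanh_def)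
        have "1 / sinh s = (inverse (cosh s))\<^sup>2 / tanh s + tanh (s / 2) * inverse (cosh s)"
        proof -
          \<comment> \<open>D is cosh s = 1 + 2 h^2, so the two fractions over the common
            denominator 2 h c D have numerators 1 and 2 h^2 that add up to D.\<close>
          define D where "D = c\<^sup>2 + h\<^sup>2"
          have D: "D \<noteq> 0" "D = 1 + 2 * h * h"
            using nz(3) unfolding D_def by (simp, simp only: nz(4), simp add: power2_eq_square)
          have "(inverse D)\<^sup>2 / (2 * h * c / D) + h / c * inverse D = 1 / (2 * h * c * D) + 2 * h * h / (2 * h * c * D)"
            using nz(1,2) D(1) by (simp add: power2_eq_square divide_simps)
          also have "\<dots> = D / (2 * h * c * D)" by (simp only: D(2) add_divide_distrib)
          also have "\<dots> = 1 / (2 * h * c)" using D(1) by simp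
          finally show ?thesis unfolding tanh_def[of s] sc D_def by simp
        qed
        hence "sin (M * tanh s) * (1 / sinh s) = sin (M * tanh s) * ((inverse (cosh s))\<^sup>2 / tanh s + tanh (s / 2) * inverse (cosh s))"
          by simp
        moreover have "g M s = sin (M * tanh s) * ((inverse (cosh s))\<^sup>2 / tanh s)"
          using M s by (simp add: g_def)
        ultimately show "sin (M * tanh s) / sinh s = g M s + q M s"
          unfolding q_def by (simp add: distrib_left)
      qed
      have [measurable]: "sinh \<in> borel_measurable (borel :: real measure)"
        by (intro borel_measurable_continuous_onI continuous_intros)
      show "(\<lambda>s. sin (M * tanh s) / sinh s) \<in> borel_measurable lborel" by measurable
      show "(\<lambda>s. g M s + q M s) \<in> borel_measurable lborel" using ig[of M] iq[of M] by measurable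
    qed
    thus ?thesis using ig[of M] iq[of M] int_g[of M] Si_neg[of M] M by simp
  qed
  have "((\<lambda>M. 2 * Si M + (LINT s|lborel. q M s)) \<longlongrightarrow> 2 * (pi / 2) + 0) at_top"
    unfolding q_def by (intro tendsto_intros Si_at_top Riemann_Lebesgue_tanh)
  moreover have "eventually (\<lambda>M. 2 * Si M + (LINT s|lborel. q M s) = (LINT s|lborel. sin (M * tanh s) / sinh s)) at_top"
    using eventually_gt_at_top[of 0] by eventually_elim (simp add: eq)
  ultimately have "((\<lambda>M. LINT s|lborel. sin (M * tanh s) / sinh s) \<longlongrightarrow> 2 * (pi / 2) + 0) at_top"
    by (rule Lim_transform_eventually)
  thus ?thesis by simp
qed

text \<open>For \<zeta> > 0 the factor exp (- K \<zeta>) kills the oscillating terms, with a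
  multiple of sech as majorant. That majorant contains 1 / \<zeta>^2; for \<zeta> = 0 only 1 / |sinh
  s| would remain, which is not integrable at 0, so cancellation in the Dirichlet integral has to be
  used.\<close>

lemma has_integral_bessel_J0_exp:
  fixes \<zeta> \<rho> :: real
  assumes nz: "\<zeta> > 0 \<or> (\<zeta> = 0 \<and> \<rho> > 0)"
  shows "((\<lambda>k. bessel_J0 (k * \<rho>) * exp (- (k * \<zeta>))) has_integral 1 / sqrt (\<zeta>\<^sup>2 + \<rho>\<^sup>2)) {0..}"
proof (rule has_integral_improper_atLeast)
  show "(\<lambda>k. bessel_J0 (k * \<rho>) * exp (- (k * \<zeta>))) integrable_on {0..b}" for b
    by (intro integrable_continuous_interval continuous_intros
          continuous_on_compose2[OF continuous_bessel_J0[of UNIV]]) auto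
  define g where "g = (\<lambda>K s. inverse (cosh s) * ((\<zeta> + exp (- (K * \<zeta>)) *
       (\<rho> * tanh s * sin (K * (\<rho> * tanh s)) - \<zeta> * cos (K * (\<rho> * tanh s)))) / (\<zeta>\<^sup>2 + (\<rho> * tanh s)\<^sup>2)))"
  have "((\<lambda>K. (LINT s|lborel. g K s) / pi) \<longlongrightarrow> 1 / sqrt (\<zeta>\<^sup>2 + \<rho>\<^sup>2)) at_top"
    using nz
  proof
    assume \<zeta>: "\<zeta> > 0"
    have num: "\<bar>\<rho> * tanh s * sin x - \<zeta> * cos y\<bar> \<le> \<bar>\<rho>\<bar> + \<zeta>" for s x y
    proof -
      have "\<bar>\<rho>\<bar> * (\<bar>tanh s\<bar> * \<bar>sin x\<bar>) \<le> \<bar>\<rho>\<bar> * (1 * 1)"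
        using abs_tanh_le_1[of s] by (intro mult_mono) auto
      moreover have "\<zeta> * \<bar>cos y\<bar> \<le> \<zeta> * 1" using \<zeta> by (intro mult_left_mono) auto
      moreover have "\<bar>\<rho> * tanh s * sin x - \<zeta> * cos y\<bar> \<le> \<bar>\<rho>\<bar> * (\<bar>tanh s\<bar> * \<bar>sin x\<bar>) + \<zeta> * \<bar>cos y\<bar>"
        using \<zeta> by (intro order.trans[OF abs_triangle_ineq4]) (simp add: abs_mult mult.assoc)
      ultimately show ?thesis by linarith
    qed
    have den: "\<zeta>\<^sup>2 \<le> \<zeta>\<^sup>2 + (\<rho> * tanh s)\<^sup>2" "0 < \<zeta>\<^sup>2 + (\<rho> * tanh s)\<^sup>2" for s
      using \<zeta> by (auto intro!: add_pos_nonneg)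
    have "((\<lambda>K. LINT s|lborel. g K s) \<longlongrightarrow>
        (LINT s|lborel. inverse (cosh s) * (\<zeta> / (\<zeta>\<^sup>2 + (\<rho> * tanh s)\<^sup>2)))) at_top"
    proof (rule integral_dominated_convergence_at_top[where w = "\<lambda>s. inverse (cosh s) * ((2 * \<zeta> + \<bar>\<rho>\<bar>) / \<zeta>\<^sup>2)"])
      show "integrable lborel (\<lambda>s. inverse (cosh s) * ((2 * \<zeta> + \<bar>\<rho>\<bar>) / \<zeta>\<^sup>2))"
        by (intro integrable_mult_left integrable_sech)
      show "AE s in lborel. ((\<lambda>K. g K s) \<longlongrightarrow> inverse (cosh s) * (\<zeta> / (\<zeta>\<^sup>2 + (\<rho> * tanh s)\<^sup>2))) at_top"
      proof (rule AE_I2)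
        fix s
        have "((\<lambda>K. exp (- (K * \<zeta>)) * (\<bar>\<rho>\<bar> + \<zeta>)) \<longlongrightarrow> 0) at_top"
          using \<zeta> by real_asymp
        hence "((\<lambda>K. exp (- (K * \<zeta>)) * (\<rho> * tanh s * sin (K * (\<rho> * tanh s)) - \<zeta> * cos (K * (\<rho> * tanh s)))) \<longlongrightarrow> 0) at_top"
          by (rule Lim_null_comparison[rotated]) (auto simp: abs_mult intro!: always_eventually mult_left_mono num)
        hence "((\<lambda>K. g K s) \<longlongrightarrow> inverse (cosh s) * ((\<zeta> + 0) / (\<zeta>\<^sup>2 + (\<rho> * tanh s)\<^sup>2))) at_top"
          unfolding g_def using den(2)[of s] by (intro tendsto_mult tendsto_divide tendsto_add tendsto_const) auto
        thus "((\<lambda>K. g K s) \<longlongrightarrow> inverse (cosh s) * (\<zeta> / (\<zeta>\<^sup>2 + (\<rho> * tanh s)\<^sup>2))) at_top" by simp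
      qed
      show "\<forall>\<^sub>F K in at_top. AE s in lborel. norm (g K s) \<le> inverse (cosh s) * ((2 * \<zeta> + \<bar>\<rho>\<bar>) / \<zeta>\<^sup>2)"
        using eventually_ge_at_top[of 0]
      proof eventually_elim
        case (elim K)
        show ?case
        proof (rule AE_I2)
          fix s
          define X where "X = \<rho> * tanh s * sin (K * (\<rho> * tanh s)) - \<zeta> * cos (K * (\<rho> * tanh s))"
          have "exp (- (K * \<zeta>)) * \<bar>X\<bar> \<le> 1 * (\<bar>\<rho>\<bar> + \<zeta>)"
            unfolding X_def using elim \<zeta> by (intro mult_mono num) auto
          hence "\<bar>\<zeta> + exp (- (K * \<zeta>)) * X\<bar> \<le> 2 * \<zeta> + \<bar>\<rho>\<bar>"
            using \<zeta> by (intro order.trans[OF abs_triangle_ineq]) (simp add: abs_mult)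
          hence "\<bar>\<zeta> + exp (- (K * \<zeta>)) * X\<bar> / (\<zeta>\<^sup>2 + (\<rho> * tanh s)\<^sup>2) \<le> (2 * \<zeta> + \<bar>\<rho>\<bar>) / \<zeta>\<^sup>2"
            using \<zeta> den[of s] by (intro frac_le) auto
          hence "inverse (cosh s) * (\<bar>\<zeta> + exp (- (K * \<zeta>)) * X\<bar> / (\<zeta>\<^sup>2 + (\<rho> * tanh s)\<^sup>2))
                  \<le> inverse (cosh s) * ((2 * \<zeta> + \<bar>\<rho>\<bar>) / \<zeta>\<^sup>2)"
            using inverse_cosh_bounds[of s] by (intro mult_left_mono) auto
          moreover have "norm (g K s) = inverse (cosh s) * (\<bar>\<zeta> + exp (- (K * \<zeta>)) * X\<bar> / (\<zeta>\<^sup>2 + (\<rho> * tanh s)\<^sup>2))"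
            unfolding g_def X_def[symmetric] real_norm_def abs_mult abs_divide
            using inverse_cosh_bounds[of s] den(2)[of s] by simp
          ultimately show "norm (g K s) \<le> inverse (cosh s) * ((2 * \<zeta> + \<bar>\<rho>\<bar>) / \<zeta>\<^sup>2)" by simp
        qed
      qed
      show "g K \<in> borel_measurable lborel" for K unfolding g_def by measurable
    qed measurable
    hence "((\<lambda>K. (LINT s|lborel. g K s) / pi) \<longlongrightarrow> (pi / sqrt (\<zeta>\<^sup>2 + \<rho>\<^sup>2)) / pi) at_top"
      unfolding sech_rational_integral[OF \<zeta>] by (intro tendsto_divide tendsto_const) auto
    thus ?thesis by simp
  next
    assume *: "\<zeta> = 0 \<and> \<rho> > 0"
    have g: "g K s = 1 / \<rho> * (sin (K * \<rho> * tanh s) / sinh s)" for K s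
    \<comment> \<open>At s = 0 both sides vanish by the convention x / 0 = 0.\<close>
    proof (cases "s = 0")
      case False
      thus ?thesis using * cosh_real_pos[of s]
        by (simp add: g_def power2_eq_square tanh_def field_simps)
    qed (simp add: g_def *)
    have "filterlim (\<lambda>K. K * \<rho>) at_top at_top" using * by real_asymp
    from filterlim_compose[OF tendsto_integral_sin_tanh this]
    have "((\<lambda>K. 1 / \<rho> * (LINT s|lborel. sin (K * \<rho> * tanh s) / sinh s) / pi) \<longlongrightarrow> 1 / \<rho> * pi / pi) at_top"
      by (intro tendsto_mult tendsto_divide tendsto_const) auto
    thus ?thesis unfolding g integral_mult_right_zero using * by simp
  qed
  moreover have "eventually (\<lambda>K. (LINT s|lborel. g K s) / pi = integral {0..K} (\<lambda>k. bessel_J0 (k * \<rho>) * exp (- (k * \<zeta>)))) at_top"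
    using eventually_ge_at_top[of 0]
  proof eventually_elim
    case (elim K)
    show ?case unfolding g_def using integral_bessel_J0_Icc[OF elim, of \<zeta> \<rho>] nz by auto
  qed
  ultimately show "((\<lambda>K. integral {0..K} (\<lambda>k. bessel_J0 (k * \<rho>) * exp (- (k * \<zeta>)))) \<longlongrightarrow> 1 / sqrt (\<zeta>\<^sup>2 + \<rho>\<^sup>2)) at_top"
    by (rule Lim_transform_eventually)
qed

section \<open>The expansion of the reciprocal distance\<close>

lemma norm_diff_vec3:
  fixes x y :: "real^3"
  shows "(norm (x - y))\<^sup>2 = (x $ 1 - y $ 1)\<^sup>2 + (x $ 2 - y $ 2)\<^sup>2 + (x $ 3 - y $ 3)\<^sup>2"
  unfolding power2_norm_eq_inner inner_vec_def sum_3 by (simp add: power2_eq_square)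

text \<open>With w = \<xi> + i \<eta> the plane coordinates are w^2 / 2, so the squared distance in
  the plane is |w - w0|^2 |w + w0|^2 / 4. The two factors are 2 (\<sigma> - \<beta>) and 2 (\<sigma>
  + \<beta>) with \<beta> = \<xi> \<xi>0 + \<eta> \<eta>0. The reflection replaces \<xi> by -
  \<xi>.\<close>

lemma parabolic_cylinder_distances:
  assumes "has_parabolic_cylinder_coords x \<xi> \<eta> z" "has_parabolic_cylinder_coords x0 \<xi>0 \<eta>0 z0"
  defines "\<sigma> \<equiv> (\<xi>\<^sup>2 + \<eta>\<^sup>2 + \<xi>0\<^sup>2 + \<eta>0\<^sup>2) / 2"
  shows "(norm (x - x0))\<^sup>2 = \<bar>z - z0\<bar>\<^sup>2 + (\<sigma>\<^sup>2 - (\<xi> * \<xi>0 + \<eta> * \<eta>0)\<^sup>2)"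
    and "(norm (reflect_y x - x0))\<^sup>2 = \<bar>z - z0\<bar>\<^sup>2 + (\<sigma>\<^sup>2 - (\<xi> * \<xi>0 - \<eta> * \<eta>0)\<^sup>2)"
    and "\<bar>\<xi> * \<xi>0 + \<eta> * \<eta>0\<bar> \<le> \<sigma>" "\<bar>\<xi> * \<xi>0 - \<eta> * \<eta>0\<bar> \<le> \<sigma>"
proof -
  have c: "x $ 1 = (\<xi>\<^sup>2 - \<eta>\<^sup>2) / 2" "x $ 2 = \<xi> * \<eta>" "x $ 3 = z"
    "x0 $ 1 = (\<xi>0\<^sup>2 - \<eta>0\<^sup>2) / 2" "x0 $ 2 = \<xi>0 * \<eta>0" "x0 $ 3 = z0"
    using assms(1,2) by (auto simp: has_parabolic_cylinder_coords_def)
  show "(norm (x - x0))\<^sup>2 = \<bar>z - z0\<bar>\<^sup>2 + (\<sigma>\<^sup>2 - (\<xi> * \<xi>0 + \<eta> * \<eta>0)\<^sup>2)"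
    unfolding norm_diff_vec3 c \<sigma>_def by (simp add: power2_eq_square field_simps)
  show "(norm (reflect_y x - x0))\<^sup>2 = \<bar>z - z0\<bar>\<^sup>2 + (\<sigma>\<^sup>2 - (\<xi> * \<xi>0 - \<eta> * \<eta>0)\<^sup>2)"
    unfolding norm_diff_vec3 reflect_y_def vector_3 c \<sigma>_def by (simp add: power2_eq_square field_simps)
  have le: "\<bar>a * b\<bar> \<le> (a\<^sup>2 + b\<^sup>2) / 2" for a b :: real
    using sum_squares_bound[of "\<bar>a\<bar>" "\<bar>b\<bar>"] by (simp add: abs_mult)
  have "\<bar>\<xi> * \<xi>0\<bar> + \<bar>\<eta> * \<eta>0\<bar> \<le> \<sigma>"
    using add_mono[OF le[of \<xi> \<xi>0] le[of \<eta> \<eta>0]] by (simp add: \<sigma>_def add_divide_distrib)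
  from order.trans[OF abs_triangle_ineq this] order.trans[OF abs_triangle_ineq4 this]
  show "\<bar>\<xi> * \<xi>0 + \<eta> * \<eta>0\<bar> \<le> \<sigma>" "\<bar>\<xi> * \<xi>0 - \<eta> * \<eta>0\<bar> \<le> \<sigma>" .
qed

text \<open>The hyperbolic invariant of (k \<sigma>, k \<beta>) is k \<rho>, so the k-integral is a
  Laplace transform. The norm bound later supplies the majorant for absolute integrability.\<close>

lemma has_integral_Psi_exp:
  fixes \<sigma> \<beta> \<zeta> :: real
  assumes \<beta>: "\<bar>\<beta>\<bar> \<le> \<sigma>" and \<zeta>: "\<zeta> \<ge> 0" and d: "d > 0" "d\<^sup>2 = \<zeta>\<^sup>2 + (\<sigma>\<^sup>2 - \<beta>\<^sup>2)"
  shows "((\<lambda>k. Psi (k * \<sigma>) (k * \<beta>) * of_real (exp (- k * \<zeta>))) has_integral of_real (1 / d)) {0..}"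
    and "k \<ge> 0 \<Longrightarrow> norm (Psi (k * \<sigma>) (k * \<beta>)) \<le> 1"
proof -
  define \<rho> where "\<rho> = sqrt (\<sigma>\<^sup>2 - \<beta>\<^sup>2)"
  have "\<beta>\<^sup>2 \<le> \<sigma>\<^sup>2" using power_mono[OF \<beta>, of 2] by simp
  hence \<rho>: "\<rho> \<ge> 0" "\<rho>\<^sup>2 = \<sigma>\<^sup>2 - \<beta>\<^sup>2" by (simp_all add: \<rho>_def)
  have Psi: "Psi (k * \<sigma>) (k * \<beta>) = of_real (bessel_J0 (k * \<rho>))" if k: "k \<ge> 0" for k
  proof -
    have "\<bar>k * \<beta>\<bar> \<le> k * \<sigma>" using k \<beta> by (simp add: abs_mult mult_left_mono)
    moreover have "(k * \<sigma>)\<^sup>2 - (k * \<beta>)\<^sup>2 = (k * \<rho>)\<^sup>2"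
      by (simp add: power_mult_distrib \<rho>(2) right_diff_distrib)
    hence "sqrt ((k * \<sigma>)\<^sup>2 - (k * \<beta>)\<^sup>2) = k * \<rho>" using k \<rho>(1) by simp
    ultimately show ?thesis by (simp add: Psi_eq_bessel_J0)
  qed
  show "norm (Psi (k * \<sigma>) (k * \<beta>)) \<le> 1" if "k \<ge> 0"
    using abs_bessel_J0_le_1 by (simp add: Psi[OF that])
  \<comment> \<open>d > 0 excludes that \<zeta> and \<rho> vanish together; \<rho> = 0 alone means
    that the points lie on a common vertical line.\<close>
  have "\<zeta> > 0 \<or> (\<zeta> = 0 \<and> \<rho> > 0)"
    using d \<zeta> \<rho> by (cases "\<zeta> = 0"; cases "\<rho> = 0") auto
  moreover have "sqrt (\<zeta>\<^sup>2 + \<rho>\<^sup>2) = d"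
    unfolding \<rho>(2) d(2)[symmetric] using d(1) by simp
  ultimately have "((\<lambda>k. bessel_J0 (k * \<rho>) * exp (- (k * \<zeta>))) has_integral 1 / d) {0..}"
    using has_integral_bessel_J0_exp[of \<zeta> \<rho>] by (simp only:)
  from has_integral_linear[OF this bounded_linear_of_real]
  have "((\<lambda>k. complex_of_real (bessel_J0 (k * \<rho>) * exp (- (k * \<zeta>)))) has_integral of_real (1 / d)) {0..}"
    by (simp only: o_def)
  thus "((\<lambda>k. Psi (k * \<sigma>) (k * \<beta>) * of_real (exp (- k * \<zeta>))) has_integral of_real (1 / d)) {0..}"
    by (rule has_integral_eq[rotated]) (simp add: Psi)
qed

theorem theorem3p3:
  fixes x x0 :: "real^3" and \<xi> \<eta> z \<xi>0 \<eta>0 z0 :: real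
  assumes "x \<noteq> x0"
    and "has_parabolic_cylinder_coords x \<xi> \<eta> z"
    and "has_parabolic_cylinder_coords x0 \<xi>0 \<eta>0 z0"
  shows
    "(\<forall>j\<in>{1,2}. \<forall>k>0. integrable lborel (\<lambda>lam. integrand j \<xi> \<eta> z \<xi>0 \<eta>0 z0 k lam)) \<and>
     ((\<lambda>k. \<Sum>j\<in>{1,2}. LINT lam|lborel. integrand j \<xi> \<eta> z \<xi>0 \<eta>0 z0 k lam)
        has_integral of_real (1 / norm (x - x0))) {0..} \<and>
     (x0 \<noteq> reflect_y x \<longrightarrow>
        (\<forall>j\<in>{1,2}. (\<lambda>k. LINT lam|lborel. integrand j \<xi> \<eta> z \<xi>0 \<eta>0 z0 k lam) integrable_on {0..}) \<and>
        of_real (1 / norm (x - x0)) =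
          (\<Sum>j\<in>{1,2}. integral {0..}
             (\<lambda>k. LINT lam|lborel. integrand j \<xi> \<eta> z \<xi>0 \<eta>0 z0 k lam))) \<and>
     (z \<noteq> z0 \<longrightarrow>
        (\<forall>j\<in>{1,2}. (\<lambda>k. LINT lam|lborel. integrand j \<xi> \<eta> z \<xi>0 \<eta>0 z0 k lam)
           absolutely_integrable_on {0..}))"
proof -
  define \<sigma> where "\<sigma> = (\<xi>\<^sup>2 + \<eta>\<^sup>2 + \<xi>0\<^sup>2 + \<eta>0\<^sup>2) / 2"
  define \<zeta> where "\<zeta> = \<bar>z - z0\<bar>"
  define P where "P = (\<lambda>k. Psi (k * \<sigma>) (k * (\<xi> * \<xi>0 + \<eta> * \<eta>0)) * of_real (exp (- k * \<zeta>)))"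
  define Q where "Q = (\<lambda>k. Psi (k * \<sigma>) (k * (\<xi> * \<xi>0 - \<eta> * \<eta>0)) * of_real (exp (- k * \<zeta>)))"
  define I where "I = (\<lambda>j k. LINT lam|lborel. integrand j \<xi> \<eta> z \<xi>0 \<eta>0 z0 k lam)"
  note dist = parabolic_cylinder_distances[OF assms(2,3), folded \<sigma>_def \<zeta>_def]
  have \<zeta>: "\<zeta> \<ge> 0" by (simp add: \<zeta>_def)
  have I1: "I 1 k = (P k + Q k) / 2" and I2: "I 2 k = (P k - Q k) / 2" if "k \<ge> 0" for k
    using that by (simp_all add: I_def P_def Q_def integral_spectral_parameter \<sigma>_def \<zeta>_def algebra_simps add_divide_distrib diff_divide_distrib)
  have int: "\<forall>j\<in>{1,2}. \<forall>k>0. integrable lborel (\<lambda>lam. integrand j \<xi> \<eta> z \<xi>0 \<eta>0 z0 k lam)"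
    by (intro ballI allI impI integral_spectral_parameter) auto
  define d where "d = norm (x - x0)"
  have d: "d > 0" using assms(1) by (simp add: d_def)
  note P = has_integral_Psi_exp[OF dist(3) \<zeta> d dist(1)[folded d_def]]
  have P_int: "(P has_integral of_real (1 / d)) {0..}" using P(1) unfolding P_def .
  \<comment> \<open>Q cancels for every k, so the sum is integrable also for x0 = reflect_y x, where
    Q is constantly 1 on \<open>{0..}\<close>.\<close>
  have "P k = (\<Sum>j\<in>{1,2}. I j k)" if "k \<in> {0..}" for k
  proof -
    have "(\<Sum>j\<in>{1,2}. I j k) = I 1 k + I 2 k" by simp
    also have "\<dots> = P k" using that by (subst I1, simp, subst I2, simp, simp add: field_simps)
    finally show ?thesis ..
  qed
  from has_integral_eq[OF this P_int]
  have total: "((\<lambda>k. \<Sum>j\<in>{1,2}. I j k) has_integral of_real (1 / d)) {0..}" .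
  have parts: "(I 1 has_integral (of_real (1 / d) + of_real (1 / norm (reflect_y x - x0))) / 2) {0..}"
      "(I 2 has_integral (of_real (1 / d) - of_real (1 / norm (reflect_y x - x0))) / 2) {0..}"
    if "x0 \<noteq> reflect_y x"
  proof -
    have "norm (reflect_y x - x0) > 0" using that by auto
    from has_integral_Psi_exp(1)[OF dist(4) \<zeta> this dist(2)]
    have Q_int: "(Q has_integral of_real (1 / norm (reflect_y x - x0))) {0..}" unfolding Q_def .
    show "(I 1 has_integral (of_real (1 / d) + of_real (1 / norm (reflect_y x - x0))) / 2) {0..}"
      by (rule has_integral_eq[OF _ has_integral_divide[OF has_integral_add[OF P_int Q_int]]]) (subst I1, auto)
    show "(I 2 has_integral (of_real (1 / d) - of_real (1 / norm (reflect_y x - x0))) / 2) {0..}"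
      by (rule has_integral_eq[OF _ has_integral_divide[OF has_integral_diff[OF P_int Q_int]]]) (subst I2, auto)
  qed
  have separate: "x0 \<noteq> reflect_y x \<longrightarrow> (\<forall>j\<in>{1,2}. I j integrable_on {0..}) \<and>
      of_real (1 / d) = (\<Sum>j\<in>{1,2}. integral {0..} (I j))"
  proof
    assume "x0 \<noteq> reflect_y x"
    note p = parts[OF this]
    have "(\<Sum>j\<in>{1,2}. integral {0..} (I j)) = integral {0..} (I 1) + integral {0..} (I 2)" by simp
    also have "\<dots> = of_real (1 / d)"
      unfolding integral_unique[OF p(1)] integral_unique[OF p(2)] by (simp add: field_simps)
    finally have "of_real (1 / d) = (\<Sum>j\<in>{1,2}. integral {0..} (I j))" by (rule sym)
    moreover have "\<forall>j\<in>{1,2}. I j integrable_on {0..}"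
      using has_integral_integrable[OF p(1)] has_integral_integrable[OF p(2)] by blast
    ultimately show "(\<forall>j\<in>{1,2}. I j integrable_on {0..}) \<and>
        of_real (1 / d) = (\<Sum>j\<in>{1,2}. integral {0..} (I j))" by (rule conjI[rotated])
  qed
  have absolute: "z \<noteq> z0 \<longrightarrow> (\<forall>j\<in>{1,2}. I j absolutely_integrable_on {0..})"
  proof
    assume z: "z \<noteq> z0"
    have \<zeta>': "\<zeta> > 0" using z by (simp add: \<zeta>_def)
    \<comment> \<open>The reflection keeps the third coordinate, so the mirror image of x also
      differs from x0.\<close>
    have "x0 \<noteq> reflect_y x"
      using assms(2,3) z by (auto simp: has_parabolic_cylinder_coords_def reflect_y_def)
    note parts = parts[OF this]
    have "norm (reflect_y x - x0) > 0" using \<open>x0 \<noteq> reflect_y x\<close> by auto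
    note Q = has_integral_Psi_exp(2)[OF dist(4) \<zeta> this dist(2)]
    have e: "(\<lambda>k. exp (- \<zeta> * k)) integrable_on {0..}"
      by (rule integrable_on_exp_minus_to_infinity[OF \<zeta>'])
    \<comment> \<open>Both Bessel factors have modulus at most 1, which leaves the exponential as an
      integrable majorant because \<zeta> > 0.\<close>
    have "norm (P k) \<le> exp (- \<zeta> * k)" "norm (Q k) \<le> exp (- \<zeta> * k)" if "k \<ge> 0" for k
      using P(2)[OF that] Q[OF that] by (simp_all add: P_def Q_def norm_mult mult.commute mult_left_le)
    note PQ = this
    have bound: "norm (I 1 k) \<le> exp (- \<zeta> * k)" "norm (I 2 k) \<le> exp (- \<zeta> * k)" if "k \<in> {0..}" for k
    proof -
      have k: "k \<ge> 0" using that by simp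
      have "norm (P k + Q k) \<le> 2 * exp (- \<zeta> * k)" "norm (P k - Q k) \<le> 2 * exp (- \<zeta> * k)"
        using norm_triangle_ineq[of "P k" "Q k"] norm_triangle_ineq4[of "P k" "Q k"] PQ[OF k] by linarith+
      thus "norm (I 1 k) \<le> exp (- \<zeta> * k)" "norm (I 2 k) \<le> exp (- \<zeta> * k)"
        unfolding I1[OF k] I2[OF k] norm_divide by simp_all
    qed
    have "I 1 absolutely_integrable_on {0..}"
      by (rule absolutely_integrable_integrable_bound[OF bound(1) has_integral_integrable[OF parts(1)] e])
    moreover have "I 2 absolutely_integrable_on {0..}"
      by (rule absolutely_integrable_integrable_bound[OF bound(2) has_integral_integrable[OF parts(2)] e])
    ultimately show "\<forall>j\<in>{1,2}. I j absolutely_integrable_on {0..}" by blast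
  qed
  from conjI[OF int conjI[OF total conjI[OF separate absolute]]] show ?thesis
    unfolding I_def d_def .
qed

end
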